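(* Let $F$ be a graph with $e(F)\ge 2$ which has a bipartition $S\cup T$ such that there exists a vertex $v^*\in T$ which is adjacent to every vertex in $S$, and such that any set $\nu\subseteq V(F)$ with $|\nu|\ge 3$ and $\frac{e(F[\nu])-1}{|\nu|-2}=m_2(F)$ has $S\subseteq \nu$. Then for every $p=p(n)\in[0,1]$ with \[n^{-\frac{1}{m_2(F)}}\ll p\le n^{\frac{1}{e(F)^2}-\frac{1}{m_2(F)}}\] we have a.a.s. \[\mathrm{ex}(G_{n,p},F)=n^{2-1/m_2(F)}(\log n)^{\Theta(1)}.\]
   Context: All graphs are finite and simple; $e(\cdot)$ and $v(\cdot)$ denote numbers of edges and vertices, and $F[\nu]$ is the subgraph of $F$ induced by $\nu$. For a graph $F$ on at least 3 vertices, the 2-density of $F$ is $m_2(F)=\max_{F'\subseteq F:\ v(F')\ge 3}\frac{e(F')-1}{v(F')-2}$. $G_{n,p}$ is the random graph on $n$ vertices in which each possible edge is included independently with probability $p$, and $\mathrm{ex}(G_{n,p},F)$ is the maximum number of edges in an $F$-free subgraph of $G_{n,p}$. A sequence of events $A_n$ holds asymptotically almost surely (a.a.s.) if $\Pr[A_n]\to1$ as $n\to\infty$. $f(n)\ll g(n)$ means $f(n)/g(n)\to0$ as $n\to\infty$. "A.a.s. $X_n=g(n)(\log n)^{\Theta(1)}$" means there is a constant $C>0$ depending only on $F$ such that a.a.s. $g(n)(\log n)^{-C}\le X_n\le g(n)(\log n)^{C}$. *)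

theory Defs
  imports "HOL-Probability.Probability" "HOL-Library.Landau_Symbols"
begin

datatype 'a ugraph = Graph (verts: "'a set") (edges: "'a set set")

definition simple_graph :: "'a ugraph \<Rightarrow> bool" where
  "simple_graph G \<longleftrightarrow>
     finite (verts G) \<and> edges G \<subseteq> {e. e \<subseteq> verts G \<and> card e = 2}"

abbreviation num_verts :: "'a ugraph \<Rightarrow> nat" where
  "num_verts G \<equiv> card (verts G)"

abbreviation num_edges :: "'a ugraph \<Rightarrow> nat" where
  "num_edges G \<equiv> card (edges G)"

definition subgraph :: "'a ugraph \<Rightarrow> 'a ugraph \<Rightarrow> bool" where
  "subgraph H G \<longleftrightarrow> simple_graph H \<and> verts H \<subseteq> verts G \<and> edges H \<subseteq> edges G"

definition induced_subgraph :: "'a ugraph \<Rightarrow> 'a set \<Rightarrow> 'a ugraph" where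
  "induced_subgraph G U = Graph (verts G \<inter> U) {e \<in> edges G. e \<subseteq> U}"

definition graph_iso :: "'a ugraph \<Rightarrow> 'b ugraph \<Rightarrow> bool" where
  "graph_iso G H \<longleftrightarrow>
     (\<exists>f. bij_betw f (verts G) (verts H) \<and> edges H = (\<lambda>e. f ` e) ` edges G)"

definition bipartition :: "'a ugraph \<Rightarrow> 'a set \<Rightarrow> 'a set \<Rightarrow> bool" where
  "bipartition G S T \<longleftrightarrow>
     S \<union> T = verts G \<and> S \<inter> T = {} \<and> (\<forall>e\<in>edges G. \<exists>s\<in>S. \<exists>t\<in>T. e = {s, t})"

definition two_density :: "'a ugraph \<Rightarrow> real" where
  "two_density F =
     Max {(real (num_edges F') - 1) / (real (num_verts F') - 2) | F'.
            subgraph F' F \<and> num_verts F' \<ge> 3}"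

text \<open>Subgraphs are not required to be induced, in freeness as well as in the extremal number.\<close>

definition graph_free :: "'a ugraph \<Rightarrow> 'b ugraph \<Rightarrow> bool" where
  "graph_free F G \<longleftrightarrow> \<not> (\<exists>H. subgraph H G \<and> graph_iso F H)"

definition ex_number :: "'b ugraph \<Rightarrow> 'a ugraph \<Rightarrow> nat" where
  "ex_number G F = Max {num_edges H | H. subgraph H G \<and> graph_free F H}"

definition all_edges :: "nat \<Rightarrow> nat set set" where
  "all_edges n = {e. e \<subseteq> {..<n} \<and> card e = 2}"

definition random_graph :: "nat \<Rightarrow> real \<Rightarrow> nat ugraph pmf" where
  "random_graph n p =
     map_pmf (\<lambda>X. Graph {..<n} {e \<in> all_edges n. X e})
       (Pi_pmf (all_edges n) False (\<lambda>_. bernoulli_pmf p))"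

definition asymp_almost_surely :: "(nat \<Rightarrow> 'a pmf) \<Rightarrow> (nat \<Rightarrow> 'a \<Rightarrow> bool) \<Rightarrow> bool" where
  "asymp_almost_surely M A \<longleftrightarrow>
     (\<lambda>n. measure_pmf.prob (M n) {x. A n x}) \<longlonglongrightarrow> 1"

text \<open>
  The relation \<open>f \<ll> g\<close> is rendered as \<open>f \<in> o(g)\<close>. This is the limit
  \<open>f n / g n \<longlonglongrightarrow> 0\<close>, except that it also excludes \<open>g n = 0 \<noteq> f n\<close> for infinitely many \<open>n\<close>,
  where the HOL quotient would be \<open>0\<close>.
\<close>

end

theory Submission
  imports Defs
begin

text \<open>
  Write \<open>e\<close> for the number of edges of \<open>F\<close>, \<open>m2\<close> for its 2-density and
  \<open>P = n powr (2 - 1/m2)\<close>.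

  The lower bound is the deletion method. If \<open>F'\<close> is a subgraph of \<open>F\<close> attaining the 2-density, then
  at edge probability \<open>n powr (-1/m2)\<close> the expected number of copies of \<open>F'\<close> is of the same order \<open>P\<close> as
  the expected number of edges. Thinning the random graph to a probability smaller than this by a
  logarithmic factor makes the copies negligible, and removing one edge from each of them leaves
  an \<open>F\<close>-free graph with \<open>P / O(log n)\<close> edges (\<open>random_deletion\<close>, \<open>lower_bound_prob\<close>).

  The upper bound is a union bound over containers. Suppose that all \<open>F\<close>-free edge sets on \<open>n\<close> vertices
  lie in one of \<open>exp (O(P log^2 n))\<close> containers, each with at most \<open>n powr (2 - 1/e^2)\<close> edges. In the stated
  range of \<open>p\<close> the random graph has on average at most \<open>P\<close> edges inside a fixed container, so the chance
  that it has \<open>P log^3 n\<close> edges there is at most \<open>exp (2 P - P log^3 n)\<close>, which beats the number of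
  containers (\<open>upper_bound_prob\<close>).

  The containers are found by repeatedly shrinking. For large \<open>n\<close>, any graph \<open>G\<close> with \<open>m \<ge> n powr (2 - 1/e^2)\<close> edges
  carries a probability weight on its copies of \<open>F\<close> that is spread: every set of \<open>j \<ge> 1\<close> edges lies in
  copies of total weight at most \<open>K P^(j-1) / m^j\<close>, with \<open>K\<close> depending on \<open>F\<close> only
  (\<open>weight_codegree\<close>). For such a weight the hypergraph container
  theorem (\<open>container_lemma\<close>) covers the \<open>F\<close>-free subgraphs of \<open>G\<close> by \<open>exp (O(P log n))\<close> subgraphs
  having at most \<open>(1 - \<delta>) m\<close> edges, and \<open>O(log n)\<close> rounds of this reach the required size.

  The spread weight is where the structure of \<open>F\<close> enters. Choose a random star in \<open>G\<close>: its centre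
  with probability proportional to the degree, its leaves independently among the neighbours.
  Send \<open>S\<close> to the leaves of such a star, forget the centre, and let every \<open>t\<close> in \<open>T\<close> be a fresh centre,
  conditioned on the images of the neighbours of \<open>t\<close> and independent of everything else. Then a given edge
  of \<open>F\<close> is sent to a given edge of \<open>G\<close> with probability \<open>O(1/m)\<close> only (\<open>mass_edge\<close>). If a set \<open>\<nu>\<close> of vertices of \<open>F\<close>
  contains \<open>S\<close> and a vertex complete to \<open>S\<close>, any prescribed values on \<open>\<nu>\<close> have probability at
  most a constant times what they would have for a random graph of the same density
  (\<open>mass_containing_S\<close>). The sets attaining the 2-density, for which no loss would be affordable, are
  of this kind: they contain \<open>S\<close> by hypothesis, and then a vertex complete to \<open>S\<close> because adding
  the apex, a vertex of \<open>T\<close> adjacent to all of \<open>S\<close>, cannot raise the density. For all other \<open>\<nu>\<close> the exponent in the codegree condition has a slack of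
  at least \<open>1/e\<close> (\<open>tight_or_slack\<close>), and a crude bound losing a factor \<open>(n^2/m)^e\<close> is good enough:
  this is what the exponent \<open>1/e^2\<close> in the range of \<open>p\<close> pays for.
\<close>

section \<open>Hypergraph containers for weighted uniform hypergraphs\<close>

text \<open>
  A weighted hypergraph on \<open>V\<close> is a function on sets; \<open>wdeg V w \<sigma>\<close> is the codegree of \<open>\<sigma>\<close>, and
  \<open>wdeg V w {}\<close> the total weight.
\<close>

definition wdeg :: "'v set \<Rightarrow> ('v set \<Rightarrow> real) \<Rightarrow> 'v set \<Rightarrow> real" where
  "wdeg V w \<sigma> = sum w {X. X \<subseteq> V \<and> \<sigma> \<subseteq> X}"

definition uniform_weight :: "'v set \<Rightarrow> nat \<Rightarrow> ('v set \<Rightarrow> real) \<Rightarrow> bool" where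
  "uniform_weight V r w \<longleftrightarrow> (\<forall>X. 0 \<le> w X) \<and> (\<forall>X. w X \<noteq> 0 \<longrightarrow> X \<subseteq> V \<and> card X = r)"

text \<open>
  This is the codegree hypothesis of the container theorem,
  \<open>\<Delta>\<^sub>j \<le> K \<tau>^(j-1) / |V|\<close> for a hypergraph of total weight about 1, written with the number
  \<open>b = \<tau> |V|\<close> of vertices that a fingerprint may use. In this form it does not mention the
  density of \<open>V\<close> in some ambient set, so \<open>b\<close> can be kept fixed while \<open>V\<close> shrinks.
\<close>

definition codeg_bound :: "'v set \<Rightarrow> real \<Rightarrow> nat \<Rightarrow> ('v set \<Rightarrow> real) \<Rightarrow> bool" where
  "codeg_bound V K b w \<longleftrightarrow> (\<forall>\<sigma>. \<sigma> \<noteq> {} \<longrightarrow> \<sigma> \<subseteq> V \<longrightarrow>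
     wdeg V w \<sigma> \<le> K * real b ^ (card \<sigma> - 1) / real (card V) ^ card \<sigma>)"

definition link :: "'v \<Rightarrow> ('v set \<Rightarrow> real) \<Rightarrow> 'v set \<Rightarrow> real" where
  "link v w Y = (if v \<in> Y then 0 else w (insert v Y))"

definition independent :: "('v set \<Rightarrow> real) \<Rightarrow> 'v set \<Rightarrow> bool" where
  "independent w I \<longleftrightarrow> (\<forall>X\<subseteq>I. w X = 0)"

text \<open>
  Only the number of containers is recorded, not the map sending a fingerprint to its container: a union bound
  needs no more, and counts of this kind compose under iteration.
\<close>

definition covered :: "'v set \<Rightarrow> nat \<Rightarrow> real \<Rightarrow> ('v set \<Rightarrow> bool) \<Rightarrow> bool" where
  "covered V M g P \<longleftrightarrow> (\<exists>\<C>. finite \<C> \<and> card \<C> \<le> M \<and> (\<forall>C\<in>\<C>. C \<subseteq> V \<and> real (card C) \<le> g)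
      \<and> (\<forall>I\<subseteq>V. P I \<longrightarrow> (\<exists>C\<in>\<C>. I \<subseteq> C)))"

lemma covered_mono:
  assumes "covered V M g P" "M \<le> M'" "g \<le> g'" "\<And>I. I \<subseteq> V \<Longrightarrow> P' I \<Longrightarrow> P I"
  shows "covered V M' g' P'"
  using assms unfolding covered_def by (metis order_trans)

lemma wdeg_nonneg: "(\<And>X. 0 \<le> w X) \<Longrightarrow> 0 \<le> wdeg V w \<sigma>"
  unfolding wdeg_def by (rule sum_nonneg) auto

text \<open>
  Double counting: an edge of size \<open>r\<close> contributes to the codegree of each of its \<open>2 ^ r\<close> subsets.
\<close>

lemma sum_wdeg_subsets:
  assumes V: "finite V" and w: "uniform_weight V r w"
  shows "(\<Sum>\<sigma>\<in>Pow V. wdeg V w \<sigma>) = 2 ^ r * wdeg V w {}"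
proof -
  have "(\<Sum>\<sigma>\<in>Pow V. wdeg V w \<sigma>) = (\<Sum>\<sigma>\<in>Pow V. \<Sum>X\<in>{X\<in>Pow V. \<sigma> \<subseteq> X}. w X)"
    by (simp add: wdeg_def)
  also have "\<dots> = (\<Sum>X\<in>Pow V. \<Sum>\<sigma>\<in>{\<sigma>\<in>Pow V. \<sigma> \<subseteq> X}. w X)"
    by (rule sum.swap_restrict) (use V in auto)
  also have "\<dots> = (\<Sum>X\<in>Pow V. 2 ^ r * w X)"
  proof (rule sum.cong[OF refl])
    fix X assume X: "X \<in> Pow V"
    then have "{\<sigma>\<in>Pow V. \<sigma> \<subseteq> X} = Pow X" by auto
    moreover have "finite X" using X V finite_subset by auto
    ultimately show "(\<Sum>\<sigma>\<in>{\<sigma>\<in>Pow V. \<sigma> \<subseteq> X}. w X) = 2 ^ r * w X"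
      using w by (cases "w X = 0") (auto simp: card_Pow uniform_weight_def)
  qed
  also have "\<dots> = 2 ^ r * wdeg V w {}" by (simp add: wdeg_def sum_distrib_left Pow_def)
  finally show ?thesis .
qed

lemma sum_wdeg_vertices:
  assumes V: "finite V" and w: "uniform_weight V r w"
  shows "(\<Sum>v\<in>V. wdeg V w {v}) = real r * wdeg V w {}"
proof -
  have "(\<Sum>v\<in>V. wdeg V w {v}) = (\<Sum>v\<in>V. \<Sum>X\<in>{X\<in>Pow V. v \<in> X}. w X)"
    by (simp add: wdeg_def)
  also have "\<dots> = (\<Sum>X\<in>Pow V. \<Sum>v\<in>{v\<in>V. v \<in> X}. w X)"
    by (rule sum.swap_restrict) (use V in auto)
  also have "\<dots> = (\<Sum>X\<in>Pow V. real r * w X)"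
  proof (rule sum.cong[OF refl])
    fix X assume X: "X \<in> Pow V"
    then have "{v\<in>V. v \<in> X} = X" by auto
    then show "(\<Sum>v\<in>{v\<in>V. v \<in> X}. w X) = real r * w X"
      using w by (cases "w X = 0") (auto simp: uniform_weight_def)
  qed
  also have "\<dots> = real r * wdeg V w {}" by (simp add: wdeg_def sum_distrib_left Pow_def)
  finally show ?thesis .
qed

lemma wdeg_link:
  assumes V: "finite V" "v \<in> V"
  shows "wdeg V (link v w) \<sigma> = (if v \<in> \<sigma> then 0 else wdeg V w (insert v \<sigma>))"
proof (cases "v \<in> \<sigma>")
  case True
  then show ?thesis unfolding wdeg_def link_def by (auto intro!: sum.neutral)
next
  case False
  have "wdeg V (link v w) \<sigma> = sum (link v w) {X. X \<subseteq> V \<and> \<sigma> \<subseteq> X \<and> v \<notin> X}"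
    unfolding wdeg_def by (rule sum.mono_neutral_right) (use V in \<open>auto simp: link_def\<close>)
  also have "\<dots> = sum w {X. X \<subseteq> V \<and> insert v \<sigma> \<subseteq> X}"
    by (rule sum.reindex_bij_witness[of _ "\<lambda>X. X - {v}" "insert v"])
       (use False V in \<open>auto simp: link_def insert_absorb\<close>)
  finally show ?thesis using False by (simp add: wdeg_def)
qed

lemma wdeg_add_scaled: "wdeg V (\<lambda>X. u X + c * w X) \<sigma> = wdeg V u \<sigma> + c * wdeg V w \<sigma>"
  by (simp add: wdeg_def sum.distrib sum_distrib_left)

definition alive :: "('v set \<Rightarrow> bool) \<Rightarrow> ('v set \<Rightarrow> real) \<Rightarrow> 'v set \<Rightarrow> real" where
  "alive sat w X = (if \<exists>\<sigma>\<subseteq>X. sat \<sigma> then 0 else w X)"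

lemma alive_uniform: "uniform_weight V r w \<Longrightarrow> uniform_weight V r (alive sat w)"
  by (auto simp: uniform_weight_def alive_def)

lemma wdeg_alive_le:
  assumes "uniform_weight V r w"
  shows "wdeg V (alive sat w) \<sigma> \<le> wdeg V w \<sigma>"
  unfolding wdeg_def by (rule sum_mono) (use assms in \<open>auto simp: uniform_weight_def alive_def\<close>)

lemma wdeg_alive_sat:
  assumes "sat \<sigma>" shows "wdeg V (alive sat w) \<sigma> = 0"
  unfolding wdeg_def by (rule sum.neutral) (use assms in \<open>auto simp: alive_def\<close>)

text \<open>
  A union bound over the saturated sets for the weight lost by deleting.
\<close>

lemma wdeg_alive_total:
  assumes V: "finite V" and w: "uniform_weight V r w"
  shows "wdeg V w {} - (\<Sum>\<sigma>\<in>{\<sigma>\<in>Pow V. sat \<sigma>}. wdeg V w \<sigma>) \<le> wdeg V (alive sat w) {}"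
proof -
  have nn: "0 \<le> w X" for X using w by (auto simp: uniform_weight_def)
  have "wdeg V w {} - wdeg V (alive sat w) {} = (\<Sum>X\<in>Pow V. w X - alive sat w X)"
    by (simp add: wdeg_def sum_subtractf Pow_def)
  also have "\<dots> \<le> (\<Sum>X\<in>Pow V. \<Sum>\<sigma>\<in>{\<sigma>\<in>{\<sigma>\<in>Pow V. sat \<sigma>}. \<sigma> \<subseteq> X}. w X)"
  proof (rule sum_mono)
    fix X assume X: "X \<in> Pow V"
    show "w X - alive sat w X \<le> (\<Sum>\<sigma>\<in>{\<sigma>\<in>{\<sigma>\<in>Pow V. sat \<sigma>}. \<sigma> \<subseteq> X}. w X)"
    proof (cases "\<exists>\<sigma>\<subseteq>X. sat \<sigma>")
      case True
      then obtain \<sigma> where s: "\<sigma> \<subseteq> X" "sat \<sigma>" by auto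
      have "w X = (\<Sum>\<sigma>\<in>{\<sigma>}. w X)" by simp
      also have "\<dots> \<le> (\<Sum>\<sigma>\<in>{\<sigma>\<in>{\<sigma>\<in>Pow V. sat \<sigma>}. \<sigma> \<subseteq> X}. w X)"
        by (rule sum_mono2) (use s X V nn in auto)
      finally show ?thesis using True by (simp add: alive_def)
    next
      case False
      then show ?thesis using nn by (auto simp: alive_def intro: sum_nonneg)
    qed
  qed
  also have "\<dots> = (\<Sum>\<sigma>\<in>{\<sigma>\<in>Pow V. sat \<sigma>}. \<Sum>X\<in>{X\<in>Pow V. \<sigma> \<subseteq> X}. w X)"
    by (rule sum.swap_restrict[symmetric]) (use V in auto)
  also have "\<dots> = (\<Sum>\<sigma>\<in>{\<sigma>\<in>Pow V. sat \<sigma>}. wdeg V w \<sigma>)" by (simp add: wdeg_def)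
  finally show ?thesis by simp
qed

text \<open>
  One level of the container algorithm, reducing the uniformity from \<open>r + 1\<close> to \<open>r\<close>. The weight \<open>u\<close>
  collects the links of the vertices of \<open>I\<close> selected so far; since \<open>I\<close> is independent for \<open>w\<close>, it is
  independent for \<open>u\<close>. Edges of \<open>w\<close> containing a set whose codegree in \<open>u\<close> has become too
  large are ignored, which keeps the codegrees of \<open>u\<close> bounded and loses at most half of \<open>w\<close>. Let \<open>B\<close> be
  the set of vertices of remaining degree at least \<open>1 / (4 |V|)\<close>, a fraction of the average; it contains
  at least a proportion \<open>1 / (4 K)\<close> of \<open>V\<close>. If \<open>I\<close> misses \<open>B\<close> then \<open>V - B\<close> is a container. Otherwise one of at most
  \<open>|V|\<close> vertices of \<open>I \<inter> B\<close> is guessed and its link is added to \<open>u\<close>. After \<open>b\<close> guesses \<open>u\<close> has total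
  weight at least 1 and the next level takes over. Since guesses are merely counted, any vertex of
  \<open>I \<inter> B\<close> can serve.
\<close>

lemma container_loop:
  fixes V :: "'v set" and K L :: real
  assumes V: "finite V" "V \<noteq> {}" and b: "b \<ge> 1" and K: "K \<ge> 1"
    and L: "L = 2 ^ (r + 3) * K\<^sup>2"
    and w: "uniform_weight V (Suc r) w" "codeg_bound V K b w" "wdeg V w {} \<ge> 1"
    and g: "real (card V) * (1 - 1 / (4 * K)) \<le> g"
    and next_level: "\<And>u. uniform_weight V r u \<Longrightarrow> codeg_bound V (L + 4 * K) b u \<Longrightarrow> 1 \<le> wdeg V u {} \<Longrightarrow>
             covered V M g (independent u)"
    and u: "uniform_weight V r u" "codeg_bound V (L + 4 * K) b u"
      "real i / real b \<le> wdeg V u {}" "wdeg V u {} \<le> 4 * K * real i / real b"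
    and ik: "i + k = b"
  shows "covered V ((card V + 1) ^ k * (M + 1) - 1) g (\<lambda>I. independent w I \<and> independent u I)"
  using u ik
proof (induction k arbitrary: i u)
  case 0
  then have "1 \<le> wdeg V u {}" using b by auto
  then have "covered V M g (independent u)" using next_level 0 by auto
  then show ?case by (rule covered_mono) auto
next
  case (Suc k)
  define N where "N = real (card V)"
  have N: "N \<ge> 1" using V by (simp add: N_def Suc_leI card_gt_0_iff)
  have b0: "real b \<ge> 1" using b by simp
  have L0: "L > 0" using K L by simp
  \<comment> \<open>The threshold is as large as the final codegree bound on \<open>u\<close> permits; a single link adds at most
    \<open>4 K b^(j-1) / N^j\<close> on top of it.\<close>
  define cap where "cap \<sigma> = L * real b ^ (card \<sigma> - 1) / N ^ card \<sigma>" for \<sigma> :: "'v set"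
  define sat where "sat \<sigma> \<longleftrightarrow> \<sigma> \<noteq> {} \<and> cap \<sigma> \<le> wdeg V u \<sigma>" for \<sigma>
  define a where "a = alive sat w"
  have au: "uniform_weight V (Suc r) a" unfolding a_def using w(1) by (rule alive_uniform)
  have unn: "0 \<le> u X" for X using Suc.prems(1) by (auto simp: uniform_weight_def)
  have degw: "wdeg V w \<sigma> \<le> K * real b ^ (card \<sigma> - 1) / N ^ card \<sigma>" if "\<sigma> \<noteq> {}" "\<sigma> \<subseteq> V" for \<sigma>
    using w(2) that unfolding codeg_bound_def N_def by auto
  have dega: "wdeg V a \<sigma> \<le> K * real b ^ (card \<sigma> - 1) / N ^ card \<sigma>" if "\<sigma> \<noteq> {}" "\<sigma> \<subseteq> V" for \<sigma>
    using degw[OF that] wdeg_alive_le[OF w(1), of sat \<sigma>] unfolding a_def by linarith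
  have ib: "i < b" using Suc.prems by simp
  \<comment> \<open>Every saturated set costs at most \<open>K/L\<close> times its own codegree in \<open>u\<close>, and these codegrees
    sum to at most \<open>2^r * 4 K\<close>.\<close>
  have tot: "wdeg V a {} \<ge> 1/2"
  proof -
    have "(\<Sum>\<sigma>\<in>{\<sigma>\<in>Pow V. sat \<sigma>}. wdeg V w \<sigma>) \<le> (\<Sum>\<sigma>\<in>{\<sigma>\<in>Pow V. sat \<sigma>}. K / L * wdeg V u \<sigma>)"
    proof (rule sum_mono)
      fix \<sigma> assume s: "\<sigma> \<in> {\<sigma>\<in>Pow V. sat \<sigma>}"
      then have "wdeg V w \<sigma> \<le> K / L * cap \<sigma>"
        using degw[of \<sigma>] L0 by (auto simp: sat_def cap_def)
      also have "\<dots> \<le> K / L * wdeg V u \<sigma>" using s K L0 by (intro mult_left_mono) (auto simp: sat_def)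
      finally show "wdeg V w \<sigma> \<le> K / L * wdeg V u \<sigma>" .
    qed
    also have "\<dots> \<le> (\<Sum>\<sigma>\<in>Pow V. K / L * wdeg V u \<sigma>)"
    proof (rule sum_mono2)
      show "0 \<le> K / L * wdeg V u \<sigma>" for \<sigma>
        using wdeg_nonneg[of u V \<sigma>] unn K L0 by simp
    qed (use V in auto)
    also have "\<dots> = K / L * (2 ^ r * wdeg V u {})"
      unfolding sum_wdeg_subsets[OF V(1) Suc.prems(1), symmetric] by (rule sum_distrib_left[symmetric])
    also have "\<dots> \<le> K / L * (2 ^ r * (4 * K))"
    proof -
      have "4 * K * real i / real b \<le> 4 * K" using ib K b0 by (simp add: field_simps)
      then show ?thesis using Suc.prems(4) K L0 by (intro mult_left_mono) auto
    qed
    also have "\<dots> = 1 / 2" using K unfolding L by (simp add: field_simps power2_eq_square power_add)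
    finally show ?thesis using wdeg_alive_total[OF V(1) w(1), of sat] w(3) unfolding a_def by linarith
  qed
  define B where "B = {v\<in>V. wdeg V a {v} \<ge> 1 / (4 * N)}"
  have BV: "B \<subseteq> V" unfolding B_def by auto
  have cardB: "real (card B) \<ge> N / (4 * K)"
  proof -
    have "wdeg V a {} \<le> real (Suc r) * wdeg V a {}" using tot by simp
    then have "1/2 \<le> (\<Sum>v\<in>V. wdeg V a {v})"
      unfolding sum_wdeg_vertices[OF V(1) au] using tot by linarith
    also have "\<dots> = (\<Sum>v\<in>V - B. wdeg V a {v}) + (\<Sum>v\<in>B. wdeg V a {v})"
      using sum.subset_diff[OF BV V(1)] by blast
    also have "\<dots> \<le> (\<Sum>v\<in>V - B. 1 / (4 * N)) + (\<Sum>v\<in>B. K / N)"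
    proof (intro add_mono sum_mono)
      fix v assume "v \<in> B" then show "wdeg V a {v} \<le> K / N" using dega[of "{v}"] by (auto simp: B_def)
    qed (auto simp: B_def)
    also have "\<dots> \<le> N * (1 / (4 * N)) + real (card B) * (K / N)"
    proof -
      have "real (card (V - B)) \<le> N" unfolding N_def using V by (simp add: card_mono)
      then have "real (card (V - B)) * (1 / (4 * N)) \<le> N * (1 / (4 * N))" using N
        by (intro mult_right_mono) auto
      then show ?thesis by simp
    qed
    also have "\<dots> = 1/4 + real (card B) * (K / N)" using N by simp
    finally have "1/4 \<le> real (card B) * (K / N)" by linarith
    then show ?thesis using K N by (simp add: field_simps)
  qed
  \<comment> \<open>Vertices of \<open>B\<close> have degree at least \<open>1 / (4 N)\<close>, so with this scaling each link adds at least \<open>1 / b\<close>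
    to the total weight of \<open>u\<close>.\<close>
  define c where "c = 4 * N / real b"
  define u' where "u' v X = u X + c * link v a X" for v X
  have c0: "c > 0" using N b0 by (simp add: c_def)
  have step: "covered V ((card V + 1) ^ k * (M + 1) - 1) g (\<lambda>I. independent w I \<and> independent (u' v) I)"
    if v: "v \<in> B" for v
  proof (rule Suc.IH[of _ "Suc i"])
    have vV: "v \<in> V" using v BV by auto
    show "uniform_weight V r (u' v)"
      unfolding uniform_weight_def
    proof (intro conjI allI impI)
      fix X
      show "0 \<le> u' v X" using unn au c0 by (auto simp: u'_def link_def uniform_weight_def)
      assume "u' v X \<noteq> 0"
      then consider "u X \<noteq> 0" | "link v a X \<noteq> 0" unfolding u'_def by fastforce
      then have "X \<subseteq> V \<and> card X = r"
      proof cases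
        case 1 then show ?thesis using Suc.prems(1) by (auto simp: uniform_weight_def)
      next
        case 2
        then have "v \<notin> X" "insert v X \<subseteq> V" "card (insert v X) = Suc r"
          using au by (auto simp: link_def uniform_weight_def split: if_splits)
        moreover then have "finite X" using V by (meson finite_insert finite_subset)
        ultimately show ?thesis by auto
      qed
      then show "X \<subseteq> V" "card X = r" by auto
    qed
    have wd: "wdeg V (u' v) \<sigma> = wdeg V u \<sigma> + c * (if v \<in> \<sigma> then 0 else wdeg V a (insert v \<sigma>))" for \<sigma>
      unfolding u'_def wdeg_add_scaled wdeg_link[OF V(1) vV] ..
    show "codeg_bound V (L + 4 * K) b (u' v)"
      unfolding codeg_bound_def
    proof (intro allI impI)
      fix \<sigma> assume s: "\<sigma> \<noteq> {}" "\<sigma> \<subseteq> V"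
      have fs: "finite \<sigma>" using s V finite_subset by auto
      have j: "card \<sigma> \<ge> 1" using s fs by (simp add: Suc_leI card_gt_0_iff)
      show "wdeg V (u' v) \<sigma> \<le> (L + 4 * K) * real b ^ (card \<sigma> - 1) / real (card V) ^ card \<sigma>"
      proof (cases "v \<in> \<sigma> \<or> sat \<sigma>")
        case True
        have "wdeg V a (insert v \<sigma>) = 0" if "v \<notin> \<sigma>"
        proof -
          have "wdeg V a (insert v \<sigma>) \<le> wdeg V a \<sigma>" unfolding wdeg_def
            by (rule sum_mono2) (use V au in \<open>auto simp: uniform_weight_def\<close>)
          also have "\<dots> = 0" using True that by (auto simp: a_def wdeg_alive_sat)
          finally show ?thesis using wdeg_nonneg[of a V "insert v \<sigma>"] au
            by (auto simp: uniform_weight_def)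
        qed
        then have "wdeg V (u' v) \<sigma> = wdeg V u \<sigma>" by (simp add: wd)
        then show ?thesis using Suc.prems(2) s by (auto simp: codeg_bound_def)
      next
        case False
        then have "wdeg V u \<sigma> \<le> cap \<sigma>" using s by (auto simp: sat_def)
        moreover have "c * wdeg V a (insert v \<sigma>) \<le> c * (K * real b ^ card \<sigma> / N ^ (Suc (card \<sigma>)))"
          using dega[of "insert v \<sigma>"] False s vV fs c0 by (intro mult_left_mono) auto
        moreover have "c * (K * real b ^ card \<sigma> / N ^ (Suc (card \<sigma>))) = 4 * K * real b ^ (card \<sigma> - 1) / N ^ card \<sigma>"
          using j N b0 by (cases "card \<sigma>") (auto simp: c_def field_simps)
        ultimately have "wdeg V (u' v) \<sigma> \<le> cap \<sigma> + 4 * K * real b ^ (card \<sigma> - 1) / N ^ card \<sigma>"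
          using False by (simp add: wd)
        also have "\<dots> = (L + 4 * K) * real b ^ (card \<sigma> - 1) / N ^ card \<sigma>"
          by (simp add: cap_def algebra_simps add_divide_distrib)
        finally show ?thesis by (simp add: N_def)
      qed
    qed
    have "c * wdeg V a {v} \<ge> c * (1 / (4 * N))" using v c0 by (intro mult_left_mono) (auto simp: B_def)
    moreover have "c * (1 / (4 * N)) = 1 / real b" using N by (simp add: c_def)
    ultimately show "real (Suc i) / real b \<le> wdeg V (u' v) {}"
      using Suc.prems(3) by (simp add: wd add_divide_distrib)
    have "c * wdeg V a {v} \<le> c * (K / N)" using dega[of "{v}"] vV c0 by (intro mult_left_mono) auto
    moreover have "c * (K / N) = 4 * K / real b" using N by (simp add: c_def)
    ultimately show "wdeg V (u' v) {} \<le> 4 * K * real (Suc i) / real b"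
      using Suc.prems(4) by (simp add: wd add_divide_distrib algebra_simps)
    show "Suc i + k = b" using Suc.prems by simp
  qed
  obtain CC where CC: "\<And>v. v \<in> B \<Longrightarrow> finite (CC v) \<and> card (CC v) \<le> (card V + 1) ^ k * (M + 1) - 1 \<and>
      (\<forall>C\<in>CC v. C \<subseteq> V \<and> real (card C) \<le> g) \<and>
      (\<forall>I\<subseteq>V. independent w I \<and> independent (u' v) I \<longrightarrow> (\<exists>C\<in>CC v. I \<subseteq> C))"
    using step unfolding covered_def by metis
  define \<C> where "\<C> = insert (V - B) (\<Union>v\<in>B. CC v)"
  have fB: "finite B" using BV V finite_subset by auto
  define A where "A = (card V + 1) ^ k * (M + 1)"
  have A1: "A \<ge> 1" by (simp add: A_def Suc_le_eq)
  have "card (\<Union>v\<in>B. CC v) \<le> (\<Sum>v\<in>B. card (CC v))" by (rule card_UN_le[OF fB])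
  also have "\<dots> \<le> (\<Sum>v\<in>B. A - 1)" by (rule sum_mono) (use CC A_def in auto)
  also have "\<dots> \<le> card V * (A - 1)" using card_mono[OF V(1) BV] by simp
  finally have "card \<C> \<le> 1 + card V * (A - 1)"
    unfolding \<C>_def using card_insert_le_m1 fB CC by (simp add: card_insert_if)
  also have "\<dots> \<le> (card V + 1) * A - 1"
  proof -
    obtain a' where "A = Suc a'" using A1 by (cases A) auto
    then show ?thesis using V by (cases "card V") auto
  qed
  finally have cC: "card \<C> \<le> (card V + 1) ^ Suc k * (M + 1) - 1" by (simp add: A_def algebra_simps)
  have "real (card (V - B)) = N - real (card B)"
    using card_Diff_subset[OF fB BV] card_mono[OF V(1) BV] by (simp add: N_def of_nat_diff)
  also have "\<dots> \<le> g" using cardB g by (simp add: N_def algebra_simps)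
  finally have gB: "real (card (V - B)) \<le> g" .
  have "\<exists>C\<in>\<C>. I \<subseteq> C" if I: "I \<subseteq> V" "independent w I" "independent u I" for I
  proof (cases "I \<subseteq> V - B")
    case True then show ?thesis by (auto simp: \<C>_def)
  next
    case False
    then obtain v where v: "v \<in> I" "v \<in> B" using I by auto
    have "independent (u' v) I"
      using I v by (auto simp: independent_def u'_def link_def a_def alive_def)
    then show ?thesis using CC[OF v(2)] I v by (auto simp: \<C>_def)
  qed
  then show ?case unfolding covered_def
    using cC gB fB CC by (intro exI[of _ \<C>]) (auto simp: \<C>_def)
qed

text \<open>
  Induction on the uniformity. At uniformity 0 the empty set carries positive weight, so there are
  no independent sets and nothing has to be covered. Each level replaces \<open>K\<close> by \<open>A K^2\<close>, which turns
  \<open>A K\<close> into its square; this explains the exponent \<open>2 ^ r\<close>.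
\<close>

lemma container_lemma:
  fixes V :: "'v set" and K A :: real
  assumes V: "finite V" "V \<noteq> {}" and b: "b \<ge> 1" and K: "K \<ge> 1" and A: "A \<ge> 2 ^ (r + 3)"
    and w: "uniform_weight V r w" "codeg_bound V K b w" "wdeg V w {} \<ge> 1"
  shows "covered V ((card V + 1) ^ (r * b)) (real (card V) * (1 - 1 / (4 * (A * K) ^ (2 ^ r)))) (independent w)"
proof -
  have "covered V ((card V + 1) ^ (r * b) - 1) (real (card V) * (1 - 1 / (4 * (A * K) ^ (2 ^ r)))) (independent w)"
    using K A w
  proof (induction r arbitrary: K w)
    case 0
    have "wdeg V w {} = w {}"
    proof -
      have "wdeg V w {} = sum w {{}}" unfolding wdeg_def
      proof (rule sum.mono_neutral_right)
        have "X = {}" if "w X \<noteq> 0" for X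
          using that 0 V(1) unfolding uniform_weight_def by (metis card_0_eq finite_subset)
        then show "\<forall>X\<in>{X. X \<subseteq> V \<and> {} \<subseteq> X} - {{}}. w X = 0" by blast
      qed (use V in auto)
      then show ?thesis by simp
    qed
    then have "\<not> independent w I" for I using 0 by (auto simp: independent_def)
    then show ?case by (auto simp: covered_def intro!: exI[of _ "{}"])
  next
    case (Suc r)
    define L where "L = 2 ^ (r + 3) * K\<^sup>2"
    define g where "g = real (card V) * (1 - 1 / (4 * (A * K) ^ (2 ^ Suc r)))"
    have A1: "A \<ge> 1" using Suc.prems(2) one_le_power[of "2::real" "Suc r + 3"] by linarith
    have Ar: "A \<ge> 2 ^ (r + 3)" using Suc.prems(2) by (rule order_trans[rotated]) simp
    have K2: "K \<le> K\<^sup>2" using Suc.prems(1) by (simp add: power2_eq_square)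
    have K': "L + 4 * K \<le> A * K\<^sup>2"
    proof -
      have "4 * K \<le> 2 ^ (r + 3) * K\<^sup>2"
        using power_increasing[of 2 "r + 3" "2::real"] Suc.prems(1)
        by (intro mult_mono K2) simp_all
      moreover have "(2::real) ^ (Suc r + 3) = 2 * 2 ^ (r + 3)" by (simp only: add_Suc power_Suc)
      ultimately have "L + 4 * K \<le> 2 ^ (Suc r + 3) * K\<^sup>2" unfolding L_def
        by (simp only: mult.assoc)
      also have "\<dots> \<le> A * K\<^sup>2" using Suc.prems by (intro mult_right_mono) auto
      finally show ?thesis .
    qed
    have pw: "(A * (A * K\<^sup>2)) ^ (2 ^ r) = (A * K) ^ (2 ^ Suc r)"
    proof -
      have "A * (A * K\<^sup>2) = (A * K) ^ 2" by (simp add: power2_eq_square)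
      then show ?thesis by (simp add: power_mult)
    qed
    have AK: "1 \<le> A * K" using A1 Suc.prems(1) mult_mono[of 1 A 1 K] by simp
    have "K \<le> A * K" using A1 Suc.prems(1) by simp
    also have "\<dots> \<le> (A * K) ^ (2 ^ Suc r)" using AK power_increasing[of 1 "2 ^ Suc r" "A * K"] by simp
    finally have "K \<le> (A * K) ^ (2 ^ Suc r)" .
    then have g1: "real (card V) * (1 - 1 / (4 * K)) \<le> g" unfolding g_def
      using Suc.prems(1) by (intro mult_left_mono) (auto intro!: divide_left_mono)
    have nl: "covered V ((card V + 1) ^ (r * b) - 1) g (independent u)"
      if u: "uniform_weight V r u" "codeg_bound V (L + 4 * K) b u" "1 \<le> wdeg V u {}" for u
    proof -
      have "codeg_bound V (A * K\<^sup>2) b u"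
        using u(2) unfolding codeg_bound_def
        by (meson K' divide_right_mono mult_right_mono of_nat_0_le_iff order_trans zero_le_power)
      moreover have "1 \<le> A * K\<^sup>2" using mult_mono[of 1 A 1 "K\<^sup>2"] A1 Suc.prems(1) by simp
      ultimately show ?thesis using Suc.IH[of "A * K\<^sup>2" u] u Ar unfolding pw g_def by simp
    qed
    have "covered V ((card V + 1) ^ b * ((card V + 1) ^ (r * b) - 1 + 1) - 1) g
        (\<lambda>I. independent w I \<and> independent (\<lambda>_. 0) I)"
      by (rule container_loop[OF V b Suc.prems(1) L_def Suc.prems(3-5) g1 nl, of "\<lambda>_. 0" 0])
         (use Suc.prems(1) in \<open>auto simp: uniform_weight_def codeg_bound_def wdeg_def L_def\<close>)
    then show ?case unfolding g_def
      by (rule covered_mono) (auto simp: independent_def power_add algebra_simps)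
  qed
  then show ?thesis by (rule covered_mono) auto
qed

section \<open>Random stars and random homomorphisms\<close>

text \<open>
  Conditional independence: once the values on \<open>S\<close> are chosen, a weight that is a product over \<open>T\<close> can be
  summed over each coordinate of \<open>T\<close> separately.
\<close>

lemma sum_PiE_Un:
  fixes f :: "('a \<Rightarrow> 'b) \<Rightarrow> real" and g :: "'a \<Rightarrow> ('a \<Rightarrow> 'b) \<Rightarrow> 'b \<Rightarrow> real"
  assumes fin: "finite S" "finite T" "S \<inter> T = {}" "\<And>v. v \<in> T \<Longrightarrow> finite (B v)"
    and f: "\<And>x y. (\<And>s. s \<in> S \<Longrightarrow> x s = y s) \<Longrightarrow> f x = f y"
    and g: "\<And>t x y b. t \<in> T \<Longrightarrow> (\<And>s. s \<in> S \<Longrightarrow> x s = y s) \<Longrightarrow> g t x b = g t y b"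
  shows "(\<Sum>\<phi>\<in>PiE (S \<union> T) B. f \<phi> * (\<Prod>t\<in>T. g t \<phi> (\<phi> t)))
       = (\<Sum>x\<in>PiE S B. f x * (\<Prod>t\<in>T. \<Sum>b\<in>B t. g t x b))"
proof -
  have "(\<Sum>x\<in>PiE S B. f x * (\<Prod>t\<in>T. \<Sum>b\<in>B t. g t x b))
      = (\<Sum>x\<in>PiE S B. \<Sum>y\<in>PiE T B. f x * (\<Prod>t\<in>T. g t x (y t)))"
    by (simp add: prod_sum_PiE[OF fin(2,4)] sum_distrib_left)
  also have "\<dots> = (\<Sum>(x, y)\<in>PiE S B \<times> PiE T B. f x * (\<Prod>t\<in>T. g t x (y t)))"
    by (simp add: sum.cartesian_product)
  also have "\<dots> = (\<Sum>\<phi>\<in>PiE (S \<union> T) B. f \<phi> * (\<Prod>t\<in>T. g t \<phi> (\<phi> t)))"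
  proof (rule sum.reindex_bij_witness[of _ "\<lambda>\<phi>. (restrict \<phi> S, restrict \<phi> T)"
        "\<lambda>(x, y) v. if v \<in> S then x v else y v"])
    fix xy assume "xy \<in> PiE S B \<times> PiE T B"
    then obtain x y where xy: "xy = (x, y)" "x \<in> PiE S B" "y \<in> PiE T B" by auto
    let ?p = "\<lambda>v. if v \<in> S then x v else y v"
    have 1: "(\<lambda>v. if v \<in> S then x v else y v) t = y t" if "t \<in> T" for t using that fin(3) by auto
    have 2: "f ?p = f x" by (rule f) simp
    have 3: "g t ?p b = g t x b" if "t \<in> T" for t b by (rule g[OF that]) simp
    have 4: "restrict ?p S = x" using xy(2) by (auto simp: fun_eq_iff PiE_def extensional_def)
    have 5: "restrict ?p T = y" using xy(3) fin(3) by (auto simp: fun_eq_iff PiE_def extensional_def)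
    show "(restrict ((\<lambda>(x, y) v. if v \<in> S then x v else y v) xy) S,
           restrict ((\<lambda>(x, y) v. if v \<in> S then x v else y v) xy) T) = xy"
      using 4 5 by (simp add: xy(1))
    show "(\<lambda>(x, y) v. if v \<in> S then x v else y v) xy \<in> PiE (S \<union> T) B"
      using xy fin(3) by (auto simp: PiE_def extensional_def)
    have "(\<Prod>t\<in>T. g t ?p (?p t)) = (\<Prod>t\<in>T. g t x (y t))"
      by (rule prod.cong[OF refl]) (use 3 fin(3) in auto)
    then show "f ((\<lambda>(x, y) v. if v \<in> S then x v else y v) xy) *
          (\<Prod>t\<in>T. g t ((\<lambda>(x, y) v. if v \<in> S then x v else y v) xy) (((\<lambda>(x, y) v. if v \<in> S then x v else y v) xy) t))
         = (case xy of (x, y) \<Rightarrow> f x * (\<Prod>t\<in>T. g t x (y t)))"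
      using 2 by (simp add: xy(1))
  next
    fix \<phi> assume p: "\<phi> \<in> PiE (S \<union> T) B"
    then show "(case (restrict \<phi> S, restrict \<phi> T) of (x, y) \<Rightarrow> (\<lambda>v. if v \<in> S then x v else y v)) = \<phi>"
      by (auto simp: fun_eq_iff PiE_def extensional_def)
    show "(restrict \<phi> S, restrict \<phi> T) \<in> PiE S B \<times> PiE T B" using p by auto
  qed
  finally show ?thesis ..
qed

lemma prod_of_bool_if:
  "finite A \<Longrightarrow> (\<Prod>s\<in>A. of_bool (P s)) = (of_bool (\<forall>s\<in>A. P s) :: real)"
  by (induction A rule: finite_induct) auto

locale host_graph =
  fixes n :: nat and G :: "nat set set"
  assumes G_sub: "G \<subseteq> all_edges n" and G_ne: "G \<noteq> {}"
begin

text \<open>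
  Vertices of degree below half the average, \<open>m / n\<close>, are excluded from being centres of stars. They
  account for at most half of all edge ends, and without them a centre with given leaves is never
  too likely. The number \<open>wt a u\<close> equals \<open>dg u powr (1 - a)\<close>, which is the weight of a
  star with centre \<open>u\<close> and \<open>a\<close> given leaves when the centre is weighted by its degree and the leaves are uniform
  neighbours; \<open>D A x\<close> is the total weight of stars with leaf \<open>x s\<close> for each \<open>s\<close> in \<open>A\<close>, and \<open>Z\<close> is
  that of all stars.
\<close>

definition nb :: "nat \<Rightarrow> nat set" where "nb u = {v. {u, v} \<in> G}"
definition dg :: "nat \<Rightarrow> real" where "dg u = real (card (nb u))"
definition m :: real where "m = real (card G)"
definition high :: "nat set" where "high = {u. u < n \<and> m / n \<le> dg u}"
definition wt :: "nat \<Rightarrow> nat \<Rightarrow> real" where "wt a u = dg u / dg u ^ a"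
definition D :: "'a set \<Rightarrow> ('a \<Rightarrow> nat) \<Rightarrow> real" where
  "D A x = (\<Sum>u\<in>high. wt (card A) u * (\<Prod>s\<in>A. of_bool (x s \<in> nb u)))"
definition Z :: real where "Z = (\<Sum>u\<in>high. dg u)"

lemma finite_G: "finite G"
  using G_sub by (rule finite_subset) (auto simp: all_edges_def)

lemma m_pos: "m > 0" using finite_G G_ne by (simp add: m_def card_gt_0_iff)

lemma edgeD: "{u, v} \<in> G \<Longrightarrow> u < n \<and> v < n \<and> u \<noteq> v"
proof -
  assume "{u, v} \<in> G"
  then have "{u, v} \<subseteq> {..<n}" "card {u, v} = 2" using G_sub by (auto simp: all_edges_def)
  then show ?thesis by (cases "u = v") auto
qed

lemma n_pos: "n > 0"
proof -
  obtain e where "e \<in> G" using G_ne by auto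
  then have "e \<subseteq> {..<n}" "card e = 2" using G_sub by (auto simp: all_edges_def)
  then show ?thesis by (cases n) auto
qed

lemma nb_sub: "nb u \<subseteq> {..<n}" by (auto simp: nb_def dest: edgeD)
lemma finite_nb: "finite (nb u)" using nb_sub finite_subset by blast
lemma dg_nonneg: "dg u \<ge> 0" by (simp add: dg_def)
lemma wt_nonneg: "wt a u \<ge> 0" by (simp add: wt_def dg_nonneg)
lemma high_pos: "u \<in> high \<Longrightarrow> dg u > 0"
  unfolding high_def using m_pos n_pos by (auto intro: less_le_trans[of 0 "m / n"])

lemma D_nonneg: "D A x \<ge> 0"
  unfolding D_def by (intro sum_nonneg mult_nonneg_nonneg wt_nonneg prod_nonneg) auto

lemma D_cong: "(\<And>s. s \<in> A \<Longrightarrow> x s = y s) \<Longrightarrow> D A x = D A y"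
  unfolding D_def by (auto intro!: sum.cong prod.cong)

lemma D_restrict: "D A (restrict x A) = D A x" by (rule D_cong) simp

lemma D_empty: "D {} x = Z" by (simp add: D_def wt_def Z_def)

lemma handshake: "(\<Sum>u<n. dg u) = 2 * m"
proof -
  have nbc: "card (nb u) = card {e\<in>G. u \<in> e}" if "u < n" for u
  proof (rule bij_betw_same_card[of "\<lambda>v. {u, v}"])
    show "bij_betw (\<lambda>v. {u, v}) (nb u) {e \<in> G. u \<in> e}"
      unfolding bij_betw_def
    proof (intro conjI)
      show "inj_on (\<lambda>v. {u, v}) (nb u)" by (auto simp: inj_on_def doubleton_eq_iff)
      show "(\<lambda>v. {u, v}) ` nb u = {e \<in> G. u \<in> e}"
      proof (intro equalityI subsetI)
        fix e assume e: "e \<in> {e \<in> G. u \<in> e}"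
        then have "card e = 2" using G_sub by (auto simp: all_edges_def)
        then obtain v where "e = {u, v}" using e by (auto simp: card_2_iff)
        then show "e \<in> (\<lambda>v. {u, v}) ` nb u" using e by (auto simp: nb_def)
      qed (auto simp: nb_def)
    qed
  qed
  have "(\<Sum>u<n. dg u) = real (\<Sum>u<n. card {e\<in>G. u \<in> e})"
    by (simp add: dg_def nbc)
  also have "(\<Sum>u<n. card {e\<in>G. u \<in> e}) = (\<Sum>u<n. \<Sum>e\<in>{e\<in>G. u \<in> e}. 1)" by simp
  also have "\<dots> = (\<Sum>e\<in>G. \<Sum>u\<in>{u\<in>{..<n}. u \<in> e}. 1)"
    by (rule sum.swap_restrict) (use finite_G in auto)
  also have "\<dots> = (\<Sum>e\<in>G. 2)"
  proof (rule sum.cong[OF refl])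
    fix e assume "e \<in> G"
    then have "{u\<in>{..<n}. u \<in> e} = e" "card e = 2" using G_sub by (auto simp: all_edges_def)
    then show "(\<Sum>u\<in>{u\<in>{..<n}. u \<in> e}. 1) = (2::nat)" by simp
  qed
  finally show ?thesis by (simp add: m_def)
qed

lemma Z_ge: "Z \<ge> m"
proof -
  have "2 * m = (\<Sum>u\<in>{..<n} - high. dg u) + (\<Sum>u\<in>high. dg u)"
    unfolding handshake[symmetric] by (rule sum.subset_diff) (auto simp: high_def)
  also have "(\<Sum>u\<in>{..<n} - high. dg u) \<le> (\<Sum>u\<in>{..<n} - high. m / n)"
    by (rule sum_mono) (auto simp: high_def)
  also have "\<dots> \<le> real n * (m / n)"
  proof -
    have "real (card ({..<n} - high)) \<le> real n" using card_mono[of "{..<n}" "{..<n} - high"] by simp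
    then show ?thesis using m_pos n_pos by (simp only: sum_constant) (intro mult_right_mono, auto)
  qed
  also have "\<dots> = m" using n_pos by simp
  finally show ?thesis by (simp add: Z_def)
qed

lemma Z_pos: "Z > 0" using Z_ge m_pos by linarith

text \<open>
  Discarding some leaves of a random star with leaf set \<open>S\<close> yields a random star with leaf set \<open>A\<close>, as the
  leaves are independent given the centre.
\<close>

lemma D_fiber:
  assumes S: "finite S" and A: "A \<subseteq> S" and z: "\<And>s. s \<in> A \<Longrightarrow> z s < n"
  shows "(\<Sum>x\<in>PiE S (\<lambda>s. if s \<in> A then {z s} else {..<n}). D S x) = D A z"
proof -
  let ?B = "\<lambda>s. if s \<in> A then {z s} else {..<n}"
  have fA: "finite A" using A S finite_subset by auto
  have "(\<Sum>x\<in>PiE S ?B. D S x)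
      = (\<Sum>u\<in>high. wt (card S) u * (\<Sum>x\<in>PiE S ?B. \<Prod>s\<in>S. of_bool (x s \<in> nb u)))"
    unfolding D_def by (subst sum.swap) (simp add: sum_distrib_left)
  also have "\<dots> = (\<Sum>u\<in>high. wt (card A) u * (\<Prod>s\<in>A. of_bool (z s \<in> nb u)))"
  proof (rule sum.cong[OF refl])
    fix u assume u: "u \<in> high"
    have "(\<Sum>x\<in>PiE S ?B. \<Prod>s\<in>S. of_bool (x s \<in> nb u)) = (\<Prod>s\<in>S. \<Sum>y\<in>?B s. of_bool (y \<in> nb u) :: real)"
      by (rule prod_sum_PiE[symmetric]) (use S in auto)
    also have "\<dots> = (\<Prod>s\<in>S - A. \<Sum>y\<in>?B s. of_bool (y \<in> nb u)) * (\<Prod>s\<in>A. \<Sum>y\<in>?B s. of_bool (y \<in> nb u))"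
      by (rule prod.subset_diff[OF A S])
    also have "(\<Prod>s\<in>A. \<Sum>y\<in>?B s. of_bool (y \<in> nb u)) = (\<Prod>s\<in>A. of_bool (z s \<in> nb u) :: real)"
      by (rule prod.cong) simp_all
    also have "(\<Prod>s\<in>S - A. \<Sum>y\<in>?B s. of_bool (y \<in> nb u)) = (\<Prod>s\<in>S - A. dg u)"
    proof (rule prod.cong[OF refl])
      fix s assume "s \<in> S - A"
      moreover have "{..<n} \<inter> nb u = nb u" using nb_sub by auto
      ultimately show "(\<Sum>y\<in>?B s. of_bool (y \<in> nb u)) = dg u"
        by (simp add: dg_def of_bool_def sum.If_cases)
    qed
    also have "\<dots> = dg u ^ (card S - card A)" using A S fA by (simp add: card_Diff_subset)
    also have "wt (card S) u * (dg u ^ (card S - card A) * (\<Prod>s\<in>A. of_bool (z s \<in> nb u)))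
       = wt (card A) u * (\<Prod>s\<in>A. of_bool (z s \<in> nb u))"
    proof -
      have "card A \<le> card S" by (rule card_mono[OF S A])
      then have "dg u ^ card S = dg u ^ (card S - card A) * dg u ^ card A"
        by (simp add: power_add[symmetric])
      then have "wt (card S) u * dg u ^ (card S - card A) = wt (card A) u"
        using high_pos[OF u] by (simp add: wt_def)
      then show ?thesis by (simp add: mult.assoc[symmetric])
    qed
    finally show "wt (card S) u * (\<Sum>x\<in>PiE S ?B. \<Prod>s\<in>S. of_bool (x s \<in> nb u))
       = wt (card A) u * (\<Prod>s\<in>A. of_bool (z s \<in> nb u))" .
  qed
  finally show ?thesis by (simp add: D_def)
qed

text \<open>
  The same marginal property for the expectation of a function of the leaves in \<open>A\<close>.
\<close>

lemma D_fibers: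
  fixes g :: "('a \<Rightarrow> nat) \<Rightarrow> real"
  assumes S: "finite S" and A: "A \<subseteq> S"
  shows "(\<Sum>x\<in>S \<rightarrow>\<^sub>E {..<n}. D S x * g (restrict x A)) = (\<Sum>z\<in>A \<rightarrow>\<^sub>E {..<n}. D A z * g z)"
proof -
  have fA: "finite A" using A S finite_subset by auto
  have "(\<Sum>x\<in>S \<rightarrow>\<^sub>E {..<n}. D S x * g (restrict x A))
     = (\<Sum>z\<in>A \<rightarrow>\<^sub>E {..<n}. \<Sum>x\<in>{x\<in>S \<rightarrow>\<^sub>E {..<n}. restrict x A = z}. D S x * g (restrict x A))"
    by (rule sum.group[symmetric]) (use S A fA in \<open>auto intro!: finite_PiE\<close>)
  also have "\<dots> = (\<Sum>z\<in>A \<rightarrow>\<^sub>E {..<n}. D A z * g z)"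
  proof (rule sum.cong[OF refl])
    fix z assume z: "z \<in> A \<rightarrow>\<^sub>E {..<n}"
    have eq: "{x\<in>S \<rightarrow>\<^sub>E {..<n}. restrict x A = z} = PiE S (\<lambda>s. if s \<in> A then {z s} else {..<n})"
    proof (intro equalityI subsetI)
      fix x assume "x \<in> PiE S (\<lambda>s. if s \<in> A then {z s} else {..<n})"
      then have x: "x \<in> extensional S" "\<And>s. s \<in> S \<Longrightarrow> x s \<in> (if s \<in> A then {z s} else {..<n})"
        unfolding PiE_def Pi_def by blast+
      have xA: "x s = z s" if "s \<in> A" for s using x(2)[of s] that A by auto
      have "restrict x A = z" using xA z by (auto simp: fun_eq_iff PiE_def extensional_def)
      moreover have "x s < n" if "s \<in> S" for s
        using x(2)[OF that] xA z by (cases "s \<in> A") (auto simp: PiE_def Pi_def)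
      ultimately show "x \<in> {x\<in>S \<rightarrow>\<^sub>E {..<n}. restrict x A = z}" using x(1) by (auto simp: PiE_def)
    qed (auto simp: PiE_def)
    have "(\<Sum>x\<in>{x\<in>S \<rightarrow>\<^sub>E {..<n}. restrict x A = z}. D S x * g (restrict x A))
        = (\<Sum>x\<in>{x\<in>S \<rightarrow>\<^sub>E {..<n}. restrict x A = z}. D S x) * g z"
      by (simp add: sum_distrib_right)
    also have "\<dots> = D A z * g z" unfolding eq
      by (subst D_fiber[OF S A]) (use z in \<open>auto simp: PiE_def Pi_def\<close>)
    finally show "(\<Sum>x\<in>{x\<in>S \<rightarrow>\<^sub>E {..<n}. restrict x A = z}. D S x * g (restrict x A)) = D A z * g z" .
  qed
  finally show ?thesis .
qed

lemma D_total:
  assumes "finite S" shows "(\<Sum>x\<in>S \<rightarrow>\<^sub>E {..<n}. D S x) = Z"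
  using D_fibers[OF assms, of "{}" "\<lambda>_. 1"] by (simp add: D_empty)

lemma wt_le:
  assumes u: "u \<in> high" and a: "a \<ge> 1"
  shows "wt a u \<le> (n / m) ^ (a - 1)"
proof -
  have d: "dg u > 0" "m / n \<le> dg u" using high_pos u by (auto simp: high_def)
  have "wt a u = (1 / dg u) ^ (a - 1)"
    using d a by (cases a) (auto simp: wt_def power_one_over divide_simps)
  also have "\<dots> \<le> (n / m) ^ (a - 1)"
    by (rule power_mono) (use d m_pos n_pos in \<open>auto simp: divide_simps mult.commute\<close>)
  finally show ?thesis .
qed

end

text \<open>
  A bipartite graph on \<open>S \<union> T\<close>, given by the neighbourhoods of the vertices of \<open>T\<close>.
\<close>

locale pattern =
  fixes S T :: "'a set" and N :: "'a \<Rightarrow> 'a set"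
  assumes fin: "finite S" "finite T" and disj: "S \<inter> T = {}" and S_ne: "S \<noteq> {}"
    and N_sub: "\<And>t. t \<in> T \<Longrightarrow> N t \<subseteq> S"

locale pattern_in_host = host_graph n G + pattern S T N
  for n :: nat and G :: "nat set set" and S T :: "'a set" and N :: "'a \<Rightarrow> 'a set"
begin

text \<open>
  The law of the random homomorphism is \<open>pr\<close>, a measure of total mass at most 1. The images of \<open>S\<close> are the leaves of a random
  star; given these, \<open>\<kappa> t\<close> is the conditional law of the centre of a star having the images of \<open>N t\<close> as
  leaves. A configuration is discarded unless it is \<open>good\<close>: for each neighbourhood, the stars on its image
  should have at least a \<open>\<theta>\<close> fraction of the weight \<open>m / n ^ card (N t)\<close>, which is the average up to a
  factor 2. An isolated \<open>t\<close> is placed uniformly.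
\<close>

definition \<theta> :: real where "\<theta> = 1 / (2 * real (card (S \<union> T)))"

definition good :: "('a \<Rightarrow> nat) \<Rightarrow> bool" where
  "good x \<longleftrightarrow> (\<forall>t\<in>T. N t \<noteq> {} \<longrightarrow> \<theta> * m / real n ^ card (N t) \<le> D (N t) x)"

definition \<kappa> :: "'a \<Rightarrow> ('a \<Rightarrow> nat) \<Rightarrow> nat \<Rightarrow> real" where
  "\<kappa> t x b = (if N t = {} then 1 / n else if b \<in> high
     then wt (card (N t)) b * (\<Prod>s\<in>N t. of_bool (x s \<in> nb b)) / D (N t) x else 0)"

definition pr :: "('a \<Rightarrow> nat) \<Rightarrow> real" where
  "pr \<phi> = of_bool (good \<phi>) * (D S \<phi> / Z) * (\<Prod>t\<in>T. \<kappa> t \<phi> (\<phi> t))"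

lemma theta: "0 < \<theta>" "\<theta> \<le> 1"
proof -
  have "card (S \<union> T) \<ge> 1" using fin S_ne by (simp add: Suc_leI card_gt_0_iff)
  then show "0 < \<theta>" "\<theta> \<le> 1" by (auto simp: \<theta>_def)
qed

lemma good_cong: "(\<And>s. s \<in> S \<Longrightarrow> x s = y s) \<Longrightarrow> good x = good y"
proof -
  assume a: "\<And>s. s \<in> S \<Longrightarrow> x s = y s"
  have "D (N t) x = D (N t) y" if "t \<in> T" for t by (rule D_cong) (use a N_sub[OF that] in auto)
  then show ?thesis by (auto simp: good_def)
qed

lemma kappa_cong: "t \<in> T \<Longrightarrow> (\<And>s. s \<in> N t \<Longrightarrow> x s = y s) \<Longrightarrow> \<kappa> t x b = \<kappa> t y b"
proof -
  assume t: "t \<in> T" and a: "\<And>s. s \<in> N t \<Longrightarrow> x s = y s"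
  have "D (N t) x = D (N t) y" by (rule D_cong) (use a in auto)
  then show ?thesis using a by (auto simp: \<kappa>_def)
qed

lemma kappa_nonneg: "\<kappa> t x b \<ge> 0"
  by (auto simp: \<kappa>_def intro!: divide_nonneg_nonneg mult_nonneg_nonneg wt_nonneg prod_nonneg D_nonneg)

lemma pr_nonneg: "pr \<phi> \<ge> 0"
  unfolding pr_def using Z_pos by (intro mult_nonneg_nonneg prod_nonneg kappa_nonneg divide_nonneg_nonneg D_nonneg) auto

lemma sum_kappa: "(\<Sum>b<n. \<kappa> t x b) = (if N t \<noteq> {} \<and> D (N t) x = 0 then 0 else 1)"
proof (cases "N t = {}")
  case True then show ?thesis using n_pos by (simp add: \<kappa>_def)
next
  case False
  have "(\<Sum>b<n. \<kappa> t x b) = (\<Sum>b\<in>high. wt (card (N t)) b * (\<Prod>s\<in>N t. of_bool (x s \<in> nb b)) / D (N t) x)"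
    using False by (intro sum.mono_neutral_cong_right) (auto simp: \<kappa>_def high_def)
  also have "\<dots> = D (N t) x / D (N t) x" by (simp add: sum_divide_distrib[symmetric] D_def)
  finally show ?thesis using False by auto
qed

lemma sum_kappa_le: "finite B \<Longrightarrow> B \<subseteq> {..<n} \<Longrightarrow> (\<Sum>b\<in>B. \<kappa> t x b) \<le> 1"
  using sum_mono2[of "{..<n}" B "\<kappa> t x"] sum_kappa[of t x] kappa_nonneg[of t x]
  by (auto split: if_splits)

lemma sum_pr_PiE:
  assumes "\<And>v. v \<in> T \<Longrightarrow> finite (B v)"
  shows "(\<Sum>\<phi>\<in>PiE (S \<union> T) B. pr \<phi>)
    = (\<Sum>x\<in>PiE S B. of_bool (good x) * (D S x / Z) * (\<Prod>t\<in>T. \<Sum>b\<in>B t. \<kappa> t x b))"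
  unfolding pr_def
proof (rule sum_PiE_Un[OF fin disj assms])
  fix x y :: "'a \<Rightarrow> nat" assume a: "\<And>s. s \<in> S \<Longrightarrow> x s = y s"
  show "of_bool (good x) * (D S x / Z) = of_bool (good y) * (D S y / Z)"
    using good_cong[of x y] D_cong[of S x y] a by simp
  fix t b assume t: "t \<in> T"
  show "\<kappa> t x b = \<kappa> t y b" using kappa_cong[OF t, of x y b] N_sub[OF t] a by auto
qed auto

text \<open>
  For fixed \<open>t\<close>, the leaf tuples indexed by \<open>N t\<close> that violate goodness have weight at most \<open>\<theta> * m\<close>
  altogether, simply because there are only \<open>n ^ card (N t)\<close> of them. The choice of \<open>\<theta>\<close> makes
  the union over \<open>t\<close> at most half.
\<close>

lemma total_ge_half: "(\<Sum>\<phi>\<in>(S \<union> T) \<rightarrow>\<^sub>E {..<n}. pr \<phi>) \<ge> 1/2"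
proof -
  define bad where "bad t x \<longleftrightarrow> N t \<noteq> {} \<and> D (N t) x < \<theta> * m / real n ^ card (N t)" for t and x :: "'a \<Rightarrow> nat"
  \<comment> \<open>The marginal on \<open>N t\<close> of a random star on \<open>S\<close> is a random star on \<open>N t\<close>.\<close>
  have badt: "(\<Sum>x\<in>S \<rightarrow>\<^sub>E {..<n}. D S x * of_bool (bad t x)) \<le> \<theta> * m" if t: "t \<in> T" for t
  proof (cases "N t = {}")
    case True then show ?thesis using theta m_pos by (simp add: bad_def)
  next
    case False
    have bx: "bad t x = bad t (restrict x (N t))" for x unfolding bad_def D_restrict ..
    have fN: "finite (N t)" using N_sub[OF t] fin finite_subset by auto
    have "(\<Sum>x\<in>S \<rightarrow>\<^sub>E {..<n}. D S x * of_bool (bad t x))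
        = (\<Sum>x\<in>S \<rightarrow>\<^sub>E {..<n}. D S x * of_bool (bad t (restrict x (N t))))"
      by (subst bx) (rule refl)
    also have "\<dots> = (\<Sum>z\<in>N t \<rightarrow>\<^sub>E {..<n}. D (N t) z * of_bool (bad t z))"
      by (rule D_fibers[OF fin(1) N_sub[OF t]])
    also have "\<dots> \<le> (\<Sum>z\<in>N t \<rightarrow>\<^sub>E {..<n}. \<theta> * m / real n ^ card (N t))"
      by (rule sum_mono) (use theta m_pos in \<open>auto simp: bad_def\<close>)
    also have "\<dots> = \<theta> * m" using fN n_pos by (simp add: card_PiE)
    finally show ?thesis .
  qed
  have tcard: "real (card T) * \<theta> \<le> 1 / 2"
  proof -
    have "card T \<le> card (S \<union> T)" "card (S \<union> T) \<ge> 1"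
      using fin S_ne by (auto intro!: card_mono simp: Suc_leI card_gt_0_iff)
    then show ?thesis by (simp add: \<theta>_def)
  qed
  have "(\<Sum>x\<in>S \<rightarrow>\<^sub>E {..<n}. D S x) \<le> (\<Sum>x\<in>S \<rightarrow>\<^sub>E {..<n}. of_bool (good x) * D S x + (\<Sum>t\<in>T. D S x * of_bool (bad t x)))"
  proof (rule sum_mono)
    fix x :: "'a \<Rightarrow> nat"
    show "D S x \<le> of_bool (good x) * D S x + (\<Sum>t\<in>T. D S x * of_bool (bad t x))"
    proof (cases "good x")
      case True then show ?thesis using D_nonneg by (auto intro!: sum_nonneg mult_nonneg_nonneg)
    next
      case False
      then obtain t where t: "t \<in> T" "bad t x" by (auto simp: good_def bad_def not_le)
      have "D S x = (\<Sum>t\<in>{t}. D S x * of_bool (bad t x))" using t by simp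
      also have "\<dots> \<le> (\<Sum>t\<in>T. D S x * of_bool (bad t x))"
        by (rule sum_mono2) (use t fin D_nonneg in auto)
      finally show ?thesis using D_nonneg[of S x] by simp
    qed
  qed
  also have "\<dots> = (\<Sum>x\<in>S \<rightarrow>\<^sub>E {..<n}. of_bool (good x) * D S x) + (\<Sum>t\<in>T. \<Sum>x\<in>S \<rightarrow>\<^sub>E {..<n}. D S x * of_bool (bad t x))"
    unfolding sum.distrib by (subst (2) sum.swap) simp
  also have "(\<Sum>t\<in>T. \<Sum>x\<in>S \<rightarrow>\<^sub>E {..<n}. D S x * of_bool (bad t x)) \<le> (\<Sum>t\<in>T. \<theta> * m)"
    by (rule sum_mono) (rule badt)
  also have "\<dots> \<le> 1/2 * m" using tcard mult_right_mono[OF tcard, of m] m_pos by (simp add: mult.assoc)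
  also have "\<dots> \<le> 1/2 * Z" using Z_ge by simp
  finally have "Z \<le> (\<Sum>x\<in>S \<rightarrow>\<^sub>E {..<n}. of_bool (good x) * D S x) + 1/2 * Z" by (simp add: D_total fin)
  then have "1/2 \<le> (\<Sum>x\<in>S \<rightarrow>\<^sub>E {..<n}. of_bool (good x) * D S x) / Z" using Z_pos by (simp add: field_simps)
  also have "\<dots> = (\<Sum>x\<in>S \<rightarrow>\<^sub>E {..<n}. of_bool (good x) * (D S x / Z) * (\<Prod>t\<in>T. \<Sum>b<n. \<kappa> t x b))"
    unfolding sum_divide_distrib
  proof (rule sum.cong[OF refl])
    fix x :: "'a \<Rightarrow> nat"
    have "(\<Sum>b<n. \<kappa> t x b) = 1" if "t \<in> T" "good x" for t
    proof -
      have "N t \<noteq> {} \<Longrightarrow> 0 < \<theta> * m / real n ^ card (N t)" using theta m_pos n_pos by simp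
      then show ?thesis using that by (fastforce simp: sum_kappa good_def)
    qed
    then show "of_bool (good x) * D S x / Z = of_bool (good x) * (D S x / Z) * (\<Prod>t\<in>T. \<Sum>b<n. \<kappa> t x b)"
      by (cases "good x") auto
  qed
  also have "\<dots> = (\<Sum>\<phi>\<in>(S \<union> T) \<rightarrow>\<^sub>E {..<n}. pr \<phi>)" by (rule sum_pr_PiE[symmetric]) auto
  finally show ?thesis .
qed

definition mass :: "'a set \<Rightarrow> ('a \<Rightarrow> nat) \<Rightarrow> real" where
  "mass \<nu> \<psi> = (\<Sum>\<phi>\<in>{\<phi>\<in>(S \<union> T) \<rightarrow>\<^sub>E {..<n}. \<forall>v\<in>\<nu>. \<phi> v = \<psi> v}. pr \<phi>)"

lemma mass_le:
  assumes "\<nu> \<subseteq> S \<union> T"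
  shows "mass \<nu> \<psi> \<le> (\<Sum>\<phi>\<in>PiE (S \<union> T) (\<lambda>v. if v \<in> \<nu> then {\<psi> v} else {..<n}). pr \<phi>)"
  unfolding mass_def by (rule sum_mono2) (use assms fin pr_nonneg in \<open>auto intro!: finite_PiE\<close>)

text \<open>
  Before discarding, the image of \<open>t\<close> together with those of \<open>N t\<close> is distributed as a random star. The
  centre of a random star and one of its leaves form a pair that is uniform on the at least \<open>m\<close> ordered adjacent
  pairs with admissible centre.
\<close>

lemma mass_edge:
  assumes t: "t \<in> T" and s: "s \<in> N t" and b: "\<psi> s < n" "\<psi> t < n"
  shows "mass {s, t} \<psi> \<le> 1 / m"
proof -
  define \<nu> where "\<nu> = {s, t}"
  have sS: "s \<in> S" using s N_sub[OF t] by auto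
  have sT: "s \<notin> T" "t \<notin> S" using sS t disj by auto
  have nsub: "\<nu> \<subseteq> S \<union> T" using sS t by (auto simp: \<nu>_def)
  have fN: "finite (N t)" using N_sub[OF t] fin finite_subset by auto
  let ?B = "\<lambda>v. if v \<in> \<nu> then {\<psi> v} else {..<n}"
  have "mass \<nu> \<psi> \<le> (\<Sum>\<phi>\<in>PiE (S \<union> T) ?B. pr \<phi>)"
    by (rule mass_le[OF nsub])
  also have "\<dots> = (\<Sum>x\<in>PiE S ?B. of_bool (good x) * (D S x / Z) * (\<Prod>t\<in>T. \<Sum>b\<in>?B t. \<kappa> t x b))"
    by (rule sum_pr_PiE) auto
  also have "\<dots> \<le> (\<Sum>x\<in>PiE S ?B. (D S x / Z) * \<kappa> t x (\<psi> t))"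
  proof (rule sum_mono)
    fix x :: "'a \<Rightarrow> nat"
    have "(\<Prod>t\<in>T. \<Sum>b\<in>?B t. \<kappa> t x b) = (\<Sum>b\<in>?B t. \<kappa> t x b) * (\<Prod>t\<in>T - {t}. \<Sum>b\<in>?B t. \<kappa> t x b)"
      by (rule prod.remove[OF fin(2) t])
    also have "(\<Sum>b\<in>?B t. \<kappa> t x b) = \<kappa> t x (\<psi> t)" by (simp add: \<nu>_def)
    also have "\<kappa> t x (\<psi> t) * (\<Prod>t\<in>T - {t}. \<Sum>b\<in>?B t. \<kappa> t x b) \<le> \<kappa> t x (\<psi> t) * 1"
    proof (rule mult_left_mono[OF _ kappa_nonneg], rule prod_le_1)
      fix t' assume "t' \<in> T - {t}"
      then have "?B t' = {..<n}" using sT by (auto simp: \<nu>_def)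
      then show "0 \<le> (\<Sum>b\<in>?B t'. \<kappa> t' x b) \<and> (\<Sum>b\<in>?B t'. \<kappa> t' x b) \<le> 1"
        using sum_kappa_le[of "{..<n}" t' x] by (auto intro: sum_nonneg kappa_nonneg)
    qed
    finally have "(\<Prod>t\<in>T. \<Sum>b\<in>?B t. \<kappa> t x b) \<le> \<kappa> t x (\<psi> t)" by simp
    moreover have "0 \<le> (\<Prod>t\<in>T. \<Sum>b\<in>?B t. \<kappa> t x b)" by (intro prod_nonneg sum_nonneg kappa_nonneg)
    ultimately show "of_bool (good x) * (D S x / Z) * (\<Prod>t\<in>T. \<Sum>b\<in>?B t. \<kappa> t x b) \<le> (D S x / Z) * \<kappa> t x (\<psi> t)"
      using D_nonneg[of S x] Z_pos kappa_nonneg[of t x "\<psi> t"]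
      by (cases "good x") (simp_all only: of_bool_eq mult_1 mult_left_mono divide_nonneg_pos, simp)
  qed
  also have "\<dots> = (\<Sum>x\<in>{x\<in>S \<rightarrow>\<^sub>E {..<n}. x s = \<psi> s}. (D S x / Z) * \<kappa> t x (\<psi> t))"
  proof (rule sum.cong[OF _ refl], intro equalityI subsetI)
    fix x assume x: "x \<in> PiE S ?B"
    have "x s \<in> ?B s" by (rule PiE_mem[OF x sS])
    then have xs: "x s = \<psi> s" by (simp add: \<nu>_def)
    have "x v < n" if "v \<in> S" for v
    proof (cases "v = s")
      case False
      then have "v \<notin> \<nu>" using that sT by (auto simp: \<nu>_def)
      moreover have "x v \<in> ?B v" by (rule PiE_mem[OF x that])
      ultimately show ?thesis by simp
    qed (use xs b in auto)
    then show "x \<in> {x\<in>S \<rightarrow>\<^sub>E {..<n}. x s = \<psi> s}" using xs x by (auto simp: PiE_def)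
  next
    fix x assume "x \<in> {x\<in>S \<rightarrow>\<^sub>E {..<n}. x s = \<psi> s}"
    then show "x \<in> PiE S ?B" using sT by (auto simp: \<nu>_def PiE_def Pi_def)
  qed
  also have "\<dots> = (\<Sum>x\<in>S \<rightarrow>\<^sub>E {..<n}. D S x * (of_bool (restrict x (N t) s = \<psi> s) * \<kappa> t (restrict x (N t)) (\<psi> t) / Z))"
  proof (rule sum.mono_neutral_cong_left)
    fix x assume "x \<in> {x\<in>S \<rightarrow>\<^sub>E {..<n}. x s = \<psi> s}"
    moreover have "\<kappa> t (restrict x (N t)) (\<psi> t) = \<kappa> t x (\<psi> t)" by (rule kappa_cong[OF t]) simp
    ultimately show "(D S x / Z) * \<kappa> t x (\<psi> t) = D S x * (of_bool (restrict x (N t) s = \<psi> s) * \<kappa> t (restrict x (N t)) (\<psi> t) / Z)"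
      using s by simp
  qed (use fin s in \<open>auto intro: finite_PiE\<close>)
  also have "\<dots> = (\<Sum>z\<in>N t \<rightarrow>\<^sub>E {..<n}. D (N t) z * (of_bool (z s = \<psi> s) * \<kappa> t z (\<psi> t) / Z))"
    by (rule D_fibers[OF fin(1) N_sub[OF t]])
  \<comment> \<open>The factor \<open>D (N t) z\<close> cancels against the denominator in \<open>\<kappa>\<close>.\<close>
  also have "\<dots> \<le> (\<Sum>z\<in>N t \<rightarrow>\<^sub>E {..<n}. of_bool (\<psi> t \<in> high) * wt (card (N t)) (\<psi> t) / Z *
       of_bool (z s = \<psi> s \<and> (\<forall>s'\<in>N t. z s' \<in> nb (\<psi> t))))"
  proof (rule sum_mono)
    fix z :: "'a \<Rightarrow> nat"
    show "D (N t) z * (of_bool (z s = \<psi> s) * \<kappa> t z (\<psi> t) / Z) \<le> of_bool (\<psi> t \<in> high) * wt (card (N t)) (\<psi> t) / Z *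
       of_bool (z s = \<psi> s \<and> (\<forall>s'\<in>N t. z s' \<in> nb (\<psi> t)))"
      using s wt_nonneg[of "card (N t)" "\<psi> t"] Z_pos
      by (cases "D (N t) z = 0") (auto simp: \<kappa>_def prod_of_bool_if[OF fN])
  qed
  also have "\<dots> = of_bool (\<psi> t \<in> high) * wt (card (N t)) (\<psi> t) / Z *
       real (card {z\<in>N t \<rightarrow>\<^sub>E {..<n}. z s = \<psi> s \<and> (\<forall>s'\<in>N t. z s' \<in> nb (\<psi> t))})"
    unfolding sum_distrib_left[symmetric] using fN by (subst sum_of_bool_eq) (auto simp: Int_def intro: finite_PiE)
  also have "\<dots> \<le> of_bool (\<psi> t \<in> high) * wt (card (N t)) (\<psi> t) / Z * dg (\<psi> t) ^ (card (N t) - 1)"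
  proof (rule mult_left_mono)
    have "card {z\<in>N t \<rightarrow>\<^sub>E {..<n}. z s = \<psi> s \<and> (\<forall>s'\<in>N t. z s' \<in> nb (\<psi> t))}
       \<le> card (PiE (N t) (\<lambda>s'. if s' = s then {\<psi> s} else nb (\<psi> t)))"
      by (rule card_mono) (use fN finite_nb in \<open>auto intro!: finite_PiE\<close>)
    also have "\<dots> = (\<Prod>s'\<in>N t. card (if s' = s then {\<psi> s} else nb (\<psi> t)))" by (rule card_PiE[OF fN])
    also have "\<dots> = (\<Prod>s'\<in>N t - {s}. card (nb (\<psi> t)))"
      by (subst prod.remove[OF fN s]) (auto intro: prod.cong)
    also have "\<dots> = card (nb (\<psi> t)) ^ (card (N t) - 1)" using fN s by (simp add: card_Diff_singleton)
    finally show "real (card {z\<in>N t \<rightarrow>\<^sub>E {..<n}. z s = \<psi> s \<and> (\<forall>s'\<in>N t. z s' \<in> nb (\<psi> t))}) \<le> dg (\<psi> t) ^ (card (N t) - 1)"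
      unfolding dg_def of_nat_power[symmetric] by (rule of_nat_mono)
  qed (use wt_nonneg Z_pos in auto)
  also have "\<dots> \<le> 1 / Z"
  proof (cases "\<psi> t \<in> high")
    case True
    have "card (N t) \<ge> 1" using fN s by (auto simp: Suc_le_eq card_gt_0_iff)
    then have "wt (card (N t)) (\<psi> t) * dg (\<psi> t) ^ (card (N t) - 1) = 1"
      using high_pos[OF True] by (cases "card (N t)") (auto simp: wt_def)
    then show ?thesis using True by simp
  qed (use Z_pos in auto)
  also have "\<dots> \<le> 1 / m" using Z_ge m_pos by (simp add: frac_le)
  finally show ?thesis by (simp add: \<nu>_def)
qed

end

section \<open>Probability of prescribed values on a set of vertices\<close>

context pattern_in_host begin

text \<open>
  The inverse of the edge density \<open>m / n^2\<close> of the host graph.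
\<close>

definition q_inv :: real where "q_inv = (real n)\<^sup>2 / m"

lemma q_inv_pos: "q_inv > 0" using n_pos m_pos by (simp add: q_inv_def)

text \<open>
  Up to the factor \<open>\<theta>\<close>, this is one over the number of common neighbours that \<open>card (N t)\<close>
  vertices would have in a random graph. Goodness bounds the denominator of \<open>\<kappa>\<close> from below, and the minimum
  degree of centres bounds its numerator from above.
\<close>

lemma kappa_le:
  assumes t: "t \<in> T" and x: "good x"
  shows "\<kappa> t x b \<le> q_inv ^ card (N t) / (\<theta> * n)"
proof (cases "N t = {}")
  case True
  then show ?thesis using theta n_pos by (simp add: \<kappa>_def divide_simps)
next
  case False
  define a where "a = card (N t)"
  have fN: "finite (N t)" using N_sub[OF t] fin finite_subset by auto
  have a1: "a \<ge> 1" using False fN by (simp add: a_def Suc_le_eq card_gt_0_iff)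
  have rhs: "q_inv ^ a / (\<theta> * n) = (n / m) ^ (a - 1) / (\<theta> * m / real n ^ a)"
    using a1 n_pos m_pos theta
    by (cases a) (auto simp: q_inv_def power_divide field_simps power2_eq_square power_mult_distrib)
  have "0 \<le> q_inv ^ a / (\<theta> * n)" using q_inv_pos theta n_pos by simp
  moreover have "wt a b * (\<Prod>s\<in>N t. of_bool (x s \<in> nb b)) / D (N t) x \<le> (n / m) ^ (a - 1) / (\<theta> * m / real n ^ a)"
    if "b \<in> high"
  proof (rule frac_le)
    have "wt a b * (\<Prod>s\<in>N t. of_bool (x s \<in> nb b)) \<le> wt a b * 1"
      using wt_nonneg by (intro mult_left_mono) (auto simp: prod_of_bool_if[OF fN])
    also have "\<dots> \<le> (n / m) ^ (a - 1)" using wt_le[OF that a1] by simp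
    finally show "wt a b * (\<Prod>s\<in>N t. of_bool (x s \<in> nb b)) \<le> (n / m) ^ (a - 1)" .
    show "0 < \<theta> * m / real n ^ a" using theta m_pos n_pos by simp
    show "\<theta> * m / real n ^ a \<le> D (N t) x" using x t False by (auto simp: good_def a_def)
  qed (use n_pos m_pos in auto)
  ultimately show ?thesis using False by (auto simp: \<kappa>_def a_def[symmetric] rhs)
qed

text \<open>
  With all of \<open>S\<close> prescribed, the law factorises. The vertex \<open>t0\<close> is what makes the
  bound sharp: the weight of the star leaves \<open>D S \<psi>\<close> may be large, but it is exactly the normalisation of the
  conditional law of \<open>t0\<close>, so the two cancel and only the weight of a single star is left.
\<close>

lemma mass_containing_S:
  assumes \<nu>: "S \<subseteq> \<nu>" "\<nu> \<subseteq> S \<union> T" and t0: "t0 \<in> \<nu>" "t0 \<in> T" "N t0 = S"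
    and b: "\<And>v. v \<in> \<nu> \<Longrightarrow> \<psi> v < n"
  shows "mass \<nu> \<psi> \<le> q_inv ^ (\<Sum>t\<in>\<nu> \<inter> T. card (N t)) / (\<theta> ^ card (S \<union> T) * real n ^ card \<nu>)"
proof -
  let ?B = "\<lambda>v. if v \<in> \<nu> then {\<psi> v} else {..<n}"
  define x where "x = restrict \<psi> S"
  define W where "W = \<nu> \<inter> T - {t0}"
  define c where "c t = q_inv ^ card (N t) / (\<theta> * n)" for t
  define first where "first = q_inv ^ card S / real n ^ (card S + 1)"
  have fnu: "finite \<nu>" using \<nu> fin finite_subset by (metis finite_Un)
  have PS: "PiE S ?B = {x}"
  proof (intro equalityI subsetI)
    fix z assume z: "z \<in> PiE S ?B"
    have "z s = \<psi> s" if "s \<in> S" for s using PiE_mem[OF z that] \<nu> that by auto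
    moreover have "z s = undefined" if "s \<notin> S" for s using z that by (auto simp: PiE_def extensional_def)
    ultimately show "z \<in> {x}" by (auto simp: x_def fun_eq_iff)
  qed (use \<nu> in \<open>auto simp: x_def\<close>)
  \<comment> \<open>The images of \<open>S\<close> and of \<open>t0\<close> together form one star.\<close>
  have first_le: "D S x / Z * \<kappa> t0 x (\<psi> t0) \<le> first"
  proof (cases "\<psi> t0 \<in> high \<and> D S x \<noteq> 0")
    case True
    have k1: "card S \<ge> 1" using fin S_ne by (simp add: Suc_le_eq card_gt_0_iff)
    have "D S x / Z * \<kappa> t0 x (\<psi> t0) = wt (card S) (\<psi> t0) * (\<Prod>s\<in>S. of_bool (x s \<in> nb (\<psi> t0))) / Z"
      using True t0 S_ne by (simp add: \<kappa>_def)
    also have "\<dots> \<le> wt (card S) (\<psi> t0) * 1 / Z"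
      using wt_nonneg Z_pos by (intro divide_right_mono mult_left_mono) (auto simp: prod_of_bool_if fin)
    also have "\<dots> \<le> (n / m) ^ (card S - 1) / m"
      using wt_le[of "\<psi> t0" "card S"] True k1 Z_ge m_pos wt_nonneg by (simp add: frac_le)
    also have "\<dots> = first" using k1 n_pos m_pos
      by (cases "card S") (auto simp: first_def q_inv_def field_simps power_divide power2_eq_square power_mult_distrib)
    finally show ?thesis .
  next
    case False
    then have "D S x / Z * \<kappa> t0 x (\<psi> t0) = 0" using t0 S_ne by (auto simp: \<kappa>_def)
    moreover have "0 \<le> first" using q_inv_pos by (simp add: first_def)
    ultimately show ?thesis by (simp only:)
  qed
  have c0: "c t \<ge> 0" for t using q_inv_pos theta by (simp add: c_def)
  have first0: "first \<ge> 0" using q_inv_pos by (simp add: first_def)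
  have "mass \<nu> \<psi> \<le> (\<Sum>\<phi>\<in>PiE (S \<union> T) ?B. pr \<phi>)" by (rule mass_le[OF \<nu>(2)])
  also have "\<dots> = of_bool (good x) * (D S x / Z) * (\<Prod>t\<in>T. \<Sum>b\<in>?B t. \<kappa> t x b)"
    by (subst sum_pr_PiE) (auto simp: PS)
  also have "(\<Prod>t\<in>T. \<Sum>b\<in>?B t. \<kappa> t x b) = \<kappa> t0 x (\<psi> t0) * (\<Prod>t\<in>T - {t0}. \<Sum>b\<in>?B t. \<kappa> t x b)"
    by (subst prod.remove[OF fin(2) t0(2)]) (use t0 in simp)
  also have "of_bool (good x) * (D S x / Z) * (\<kappa> t0 x (\<psi> t0) * (\<Prod>t\<in>T - {t0}. \<Sum>b\<in>?B t. \<kappa> t x b))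
      \<le> first * (\<Prod>t\<in>W. c t)"
  proof (cases "good x")
    case True
    have "(\<Prod>t\<in>T - {t0}. \<Sum>b\<in>?B t. \<kappa> t x b) \<le> (\<Prod>t\<in>T - {t0}. if t \<in> \<nu> then c t else 1)"
      using kappa_le[OF _ True] sum_kappa_le[of "{..<n}"] kappa_nonneg c0
      by (intro prod_mono) (auto simp: c_def intro!: sum_nonneg)
    also have "\<dots> = (\<Prod>t\<in>W. c t)"
      using fin by (intro prod.mono_neutral_cong_right) (auto simp: W_def)
    finally have "(D S x / Z * \<kappa> t0 x (\<psi> t0)) * (\<Prod>t\<in>T - {t0}. \<Sum>b\<in>?B t. \<kappa> t x b) \<le> first * (\<Prod>t\<in>W. c t)"
      using first_le first0 by (intro mult_mono) (auto intro!: prod_nonneg sum_nonneg kappa_nonneg)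
    then show ?thesis using True by (simp add: mult.assoc)
  next
    case False
    then show ?thesis using first0 c0 by (simp add: prod_nonneg)
  qed
  also have "first * (\<Prod>t\<in>W. c t) = q_inv ^ (\<Sum>t\<in>\<nu> \<inter> T. card (N t)) / (\<theta> ^ card W * real n ^ card \<nu>)"
  proof -
    have fW: "finite (\<nu> \<inter> T)" using fnu by auto
    have s: "(\<Sum>t\<in>\<nu> \<inter> T. card (N t)) = card S + (\<Sum>t\<in>W. card (N t))"
      unfolding W_def using t0 fW by (subst sum.remove[of _ t0]) auto
    have "\<nu> = S \<union> insert t0 W" using \<nu> t0 by (auto simp: W_def)
    moreover have "card (S \<union> insert t0 W) = card S + card (insert t0 W)"
      by (rule card_Un_disjoint) (use fin fW disj t0 in \<open>auto simp: W_def\<close>)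
    moreover have "card (insert t0 W) = Suc (card W)"
      by (rule card_insert_disjoint) (use fW in \<open>auto simp: W_def\<close>)
    ultimately have cn: "card \<nu> = card S + 1 + card W" by simp
    have "(\<Prod>t\<in>W. c t) = q_inv ^ (\<Sum>t\<in>W. card (N t)) / (\<theta> * n) ^ card W"
      unfolding c_def by (simp add: prod_dividef power_sum)
    then show ?thesis unfolding first_def s cn by (simp add: power_add power_mult_distrib)
  qed
  also have "\<dots> \<le> q_inv ^ (\<Sum>t\<in>\<nu> \<inter> T. card (N t)) / (\<theta> ^ card (S \<union> T) * real n ^ card \<nu>)"
  proof -
    have "card W \<le> card (S \<union> T)" by (rule card_mono) (use fin in \<open>auto simp: W_def\<close>)
    then have "\<theta> ^ card (S \<union> T) \<le> \<theta> ^ card W" using theta by (intro power_decreasing) auto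
    then show ?thesis using theta n_pos q_inv_pos by (intro divide_left_mono) (auto intro!: mult_right_mono)
  qed
  finally show ?thesis .
qed

lemma pr_le:
  assumes t0: "t0 \<in> T" "N t0 = S" and \<phi>: "\<phi> \<in> (S \<union> T) \<rightarrow>\<^sub>E {..<n}"
  shows "pr \<phi> \<le> q_inv ^ (\<Sum>t\<in>T. card (N t)) / (\<theta> ^ card (S \<union> T) * real n ^ card (S \<union> T))"
proof -
  have "{\<phi>'\<in>(S \<union> T) \<rightarrow>\<^sub>E {..<n}. \<forall>v\<in>S \<union> T. \<phi>' v = \<phi> v} = {\<phi>}"
    using \<phi> by (auto intro: PiE_ext)
  then have "pr \<phi> = mass (S \<union> T) \<phi>" by (simp add: mass_def)
  also have "\<dots> \<le> q_inv ^ (\<Sum>t\<in>(S \<union> T) \<inter> T. card (N t)) / (\<theta> ^ card (S \<union> T) * real n ^ card (S \<union> T))"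
    by (rule mass_containing_S) (use t0 \<phi> in \<open>auto simp: PiE_def Pi_def\<close>)
  also have "(S \<union> T) \<inter> T = T" by auto
  finally show ?thesis .
qed

text \<open>
  The crude bound: sum the bound for a single homomorphism over all extensions of \<open>\<psi>\<close>. It loses
  one factor \<open>q_inv\<close> for every edge of the pattern not inside \<open>\<nu>\<close>.
\<close>

lemma mass_any:
  assumes t0: "t0 \<in> T" "N t0 = S" and \<nu>: "\<nu> \<subseteq> S \<union> T"
  shows "mass \<nu> \<psi> \<le> q_inv ^ (\<Sum>t\<in>T. card (N t)) / (\<theta> ^ card (S \<union> T) * real n ^ card \<nu>)"
proof -
  define c where "c = q_inv ^ (\<Sum>t\<in>T. card (N t)) / (\<theta> ^ card (S \<union> T) * real n ^ card (S \<union> T))"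
  have fV: "finite (S \<union> T)" using fin by auto
  have c0: "c \<ge> 0" using q_inv_pos theta by (simp add: c_def)
  let ?X = "{\<phi>\<in>(S \<union> T) \<rightarrow>\<^sub>E {..<n}. \<forall>v\<in>\<nu>. \<phi> v = \<psi> v}"
  have "mass \<nu> \<psi> \<le> (\<Sum>\<phi>\<in>?X. c)"
    unfolding mass_def c_def by (rule sum_mono) (use pr_le[OF t0] in auto)
  also have "\<dots> = real (card ?X) * c" by simp
  also have "\<dots> \<le> real (n ^ (card (S \<union> T) - card \<nu>)) * c"
  proof (intro mult_right_mono of_nat_mono c0)
    have "card ?X \<le> card (PiE (S \<union> T) (\<lambda>v. if v \<in> \<nu> then {\<psi> v} else {..<n}))"
      by (rule card_mono) (use fV in \<open>auto intro!: finite_PiE\<close>)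
    also have "\<dots> = (\<Prod>v\<in>S \<union> T. if v \<in> \<nu> then 1 else n)"
      by (subst card_PiE[OF fV]) (auto intro!: prod.cong)
    also have "\<dots> = (\<Prod>v\<in>(S \<union> T) - \<nu>. n)"
      by (rule prod.mono_neutral_cong_right) (use fV in auto)
    also have "\<dots> = n ^ (card (S \<union> T) - card \<nu>)"
      using \<nu> fV by (simp add: card_Diff_subset finite_subset)
    finally show "card ?X \<le> n ^ (card (S \<union> T) - card \<nu>)" .
  qed
  also have "\<dots> = q_inv ^ (\<Sum>t\<in>T. card (N t)) / (\<theta> ^ card (S \<union> T) * real n ^ card \<nu>)"
  proof -
    have "card \<nu> \<le> card (S \<union> T)" by (rule card_mono[OF fV \<nu>])
    then have "real n ^ card (S \<union> T) = real n ^ (card (S \<union> T) - card \<nu>) * real n ^ card \<nu>"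
      by (simp add: power_add[symmetric])
    then show ?thesis using n_pos by (simp add: c_def)
  qed
  finally show ?thesis .
qed

lemma pr_hom:
  assumes "pr \<phi> > 0" "t \<in> T" "s \<in> N t"
  shows "{\<phi> s, \<phi> t} \<in> G"
proof -
  have "(\<Prod>t\<in>T. \<kappa> t \<phi> (\<phi> t)) \<noteq> 0" using assms(1) by (auto simp: pr_def)
  then have "\<kappa> t \<phi> (\<phi> t) \<noteq> 0" using assms(2) fin by (auto simp: prod_zero_iff)
  moreover have "finite (N t)" using N_sub[OF assms(2)] fin finite_subset by auto
  ultimately have "\<phi> s \<in> nb (\<phi> t)" using assms(3) by (auto simp: \<kappa>_def prod_of_bool_if split: if_splits)
  then show ?thesis by (simp add: nb_def insert_commute)
qed

text \<open>
  There are fewer non-injective maps than maps by a factor of order \<open>n\<close>, and no single map is much too likely.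
\<close>

lemma noninjective_mass:
  assumes t0: "t0 \<in> T" "N t0 = S"
  shows "(\<Sum>\<phi>\<in>{\<phi>\<in>(S \<union> T) \<rightarrow>\<^sub>E {..<n}. \<not> inj_on \<phi> (S \<union> T)}. pr \<phi>)
    \<le> (real (card (S \<union> T)))\<^sup>2 * (q_inv ^ (\<Sum>t\<in>T. card (N t)) / (\<theta> ^ card (S \<union> T) * n))"
proof -
  define V where "V = S \<union> T"
  define c where "c = q_inv ^ (\<Sum>t\<in>T. card (N t)) / (\<theta> ^ card V * real n ^ card V)"
  have fV: "finite V" using fin by (auto simp: V_def)
  have c0: "c \<ge> 0" using q_inv_pos theta by (simp add: c_def)
  have Vne: "card V \<ge> 1" using fV S_ne by (simp add: Suc_le_eq card_gt_0_iff V_def)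
  let ?X = "{\<phi>\<in>V \<rightarrow>\<^sub>E {..<n}. \<not> inj_on \<phi> V}"
  define Y where "Y = (\<lambda>(a, b). {\<phi>\<in>V \<rightarrow>\<^sub>E {..<n}. a \<noteq> b \<and> \<phi> a = \<phi> b})"
  have fP: "finite (V \<rightarrow>\<^sub>E {..<n})" using fV by (auto intro: finite_PiE)
  have cY: "card (Y ab) \<le> n ^ (card V - 1)" if ab: "ab \<in> V \<times> V" for ab
  proof -
    obtain a b where ab': "ab = (a, b)" "a \<in> V" "b \<in> V" using ab by auto
    have "card (Y (a, b)) \<le> card (V - {a} \<rightarrow>\<^sub>E {..<n})"
    proof (rule card_inj_on_le[of "\<lambda>\<phi>. restrict \<phi> (V - {a})"])
      show "inj_on (\<lambda>\<phi>. restrict \<phi> (V - {a})) (Y (a, b))"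
      proof (rule inj_onI)
        fix \<phi> \<phi>' assume p: "\<phi> \<in> Y (a, b)" "\<phi>' \<in> Y (a, b)" and e: "restrict \<phi> (V - {a}) = restrict \<phi>' (V - {a})"
        have 1: "\<phi> v = \<phi>' v" if "v \<in> V" "v \<noteq> a" for v using fun_cong[OF e, of v] that by simp
        have "\<phi> a = \<phi>' a" using p 1[of b] ab' by (auto simp: Y_def)
        moreover have "\<phi> v = \<phi>' v" if "v \<notin> V" for v using p that by (auto simp: Y_def PiE_def extensional_def)
        ultimately show "\<phi> = \<phi>'" using 1 by (metis ext)
      qed
      show "(\<lambda>\<phi>. restrict \<phi> (V - {a})) ` Y (a, b) \<subseteq> V - {a} \<rightarrow>\<^sub>E {..<n}"
        unfolding Y_def PiE_def Pi_def by (auto simp: extensional_def)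
      show "finite (V - {a} \<rightarrow>\<^sub>E {..<n})" using fV by (intro finite_PiE) auto
    qed
    also have "\<dots> = n ^ (card V - 1)" using fV ab' by (simp add: card_PiE)
    finally show ?thesis by (simp add: ab')
  qed
  have "card ?X \<le> card (\<Union>ab\<in>V \<times> V. Y ab)"
    by (rule card_mono) (use fV fP in \<open>auto simp: Y_def inj_on_def\<close>)
  also have "\<dots> \<le> (\<Sum>ab\<in>V \<times> V. card (Y ab))" by (rule card_UN_le) (use fV in auto)
  also have "\<dots> \<le> (\<Sum>ab\<in>V \<times> V. n ^ (card V - 1))" by (rule sum_mono) (rule cY)
  also have "\<dots> = (card V)\<^sup>2 * n ^ (card V - 1)" by (simp add: card_cartesian_product power2_eq_square)
  finally have cX: "card ?X \<le> (card V)\<^sup>2 * n ^ (card V - 1)" .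
  have "(\<Sum>\<phi>\<in>?X. pr \<phi>) \<le> (\<Sum>\<phi>\<in>?X. c)"
    by (rule sum_mono) (use pr_le[OF t0] in \<open>auto simp: c_def V_def\<close>)
  also have "\<dots> = real (card ?X) * c" by simp
  also have "\<dots> \<le> real ((card V)\<^sup>2 * n ^ (card V - 1)) * c"
    by (intro mult_right_mono of_nat_mono c0 cX)
  also have "\<dots> = (real (card V))\<^sup>2 * (q_inv ^ (\<Sum>t\<in>T. card (N t)) / (\<theta> ^ card V * n))"
    using Vne n_pos by (cases "card V") (auto simp: c_def)
  finally show ?thesis by (simp add: V_def)
qed

end

section \<open>Tight vertex sets of the forbidden graph\<close>

lemma finite_edges: "simple_graph H \<Longrightarrow> finite (edges H)"
  unfolding simple_graph_def by (metis (no_types, lifting) Collect_mono finite_Collect_subsets finite_subset mem_Collect_eq subset_iff)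

lemma two_elements:
  assumes "card A \<ge> 2" obtains x y where "x \<in> A" "y \<in> A" "x \<noteq> y"
proof -
  have "finite A" using assms by (metis card.infinite not_numeral_le_zero)
  then show ?thesis using assms that card_le_Suc0_iff_eq[of A] by fastforce
qed

lemma finite_densities:
  assumes "simple_graph F"
  shows "finite {(real (num_edges F') - 1) / (real (num_verts F') - 2) | F'. subgraph F' F \<and> num_verts F' \<ge> 3}"
proof -
  have "finite (Pow (verts F) \<times> Pow (edges F))"
    using assms finite_edges[OF assms] by (auto simp: simple_graph_def)
  then have "finite ((\<lambda>(A, B). (real (card B) - 1) / (real (card A) - 2)) ` (Pow (verts F) \<times> Pow (edges F)))"
    by (rule finite_imageI)
  then show ?thesis by (rule rev_finite_subset) (auto simp: subgraph_def)
qed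

lemma density_le:
  assumes "simple_graph F" "subgraph F' F" "num_verts F' \<ge> 3"
  shows "real (num_edges F') - 1 \<le> two_density F * (real (num_verts F') - 2)"
proof -
  have "(real (num_edges F') - 1) / (real (num_verts F') - 2) \<le> two_density F"
    unfolding two_density_def by (rule Max_ge[OF finite_densities[OF assms(1)]]) (use assms in auto)
  then show ?thesis using assms(3) by (simp add: divide_simps split: if_splits)
qed

lemma density_attained:
  assumes "simple_graph F" "num_verts F \<ge> 3"
  obtains F' where "subgraph F' F" "num_verts F' \<ge> 3"
    "real (num_edges F') - 1 = two_density F * (real (num_verts F') - 2)"
proof -
  have "subgraph F F" using assms by (simp add: subgraph_def)
  then have "two_density F \<in> {(real (num_edges F') - 1) / (real (num_verts F') - 2) | F'. subgraph F' F \<and> num_verts F' \<ge> 3}"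
    unfolding two_density_def using assms by (intro Max_in finite_densities) auto
  then obtain F' where "subgraph F' F" "num_verts F' \<ge> 3"
    "two_density F = (real (num_edges F') - 1) / (real (num_verts F') - 2)" by blast
  then show ?thesis using that by simp
qed

locale forbidden_graph =
  fixes F :: "'a ugraph" and S T :: "'a set" and apex :: 'a
  assumes simple: "simple_graph F" and two_edges: "num_edges F \<ge> 2"
    and bip: "bipartition F S T" and apex: "apex \<in> T" "\<And>s. s \<in> S \<Longrightarrow> {apex, s} \<in> edges F"
    and tight: "\<And>\<nu>. \<nu> \<subseteq> verts F \<Longrightarrow> card \<nu> \<ge> 3 \<Longrightarrow>
       (real (num_edges (induced_subgraph F \<nu>)) - 1) / (real (card \<nu>) - 2) = two_density F \<Longrightarrow> S \<subseteq> \<nu>"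
begin

abbreviation m2 :: real where "m2 \<equiv> two_density F"
abbreviation E :: nat where "E \<equiv> num_edges F"
abbreviation V :: "'a set" where "V \<equiv> verts F"

definition N :: "'a \<Rightarrow> 'a set" where "N t = {s\<in>S. {s, t} \<in> edges F}"

lemma V_eq: "V = S \<union> T" and S_T: "S \<inter> T = {}"
  and edgeE: "e \<in> edges F \<Longrightarrow> \<exists>s\<in>S. \<exists>t\<in>T. e = {s, t}"
  using bip by (auto simp: bipartition_def)

lemma fin_V: "finite V" using simple by (simp add: simple_graph_def)
lemma fin_E: "finite (edges F)" using simple by (rule finite_edges)
lemma edge_sub: "e \<in> edges F \<Longrightarrow> e \<subseteq> V \<and> card e = 2" using simple by (auto simp: simple_graph_def)
lemma fin_S: "finite S" and fin_T: "finite T" using fin_V V_eq by auto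

lemma S_ne: "S \<noteq> {}"
proof
  assume "S = {}"
  then have "edges F = {}" using edgeE by blast
  then show False using two_edges by simp
qed

lemma N_apex: "N apex = S" using apex(2) by (auto simp: N_def insert_commute)

sublocale pattern S T N
  by unfold_locales (use fin_S fin_T S_T S_ne in \<open>auto simp: N_def\<close>)

lemma degree_sum:
  "card {e\<in>edges F. e \<subseteq> \<nu>} = (\<Sum>t\<in>\<nu> \<inter> T. card (N t \<inter> \<nu>))"
proof -
  have "{e\<in>edges F. e \<subseteq> \<nu>} = (\<Union>t\<in>\<nu> \<inter> T. (\<lambda>s. {s, t}) ` (N t \<inter> \<nu>))"
  proof (intro equalityI subsetI)
    fix e assume "e \<in> {e\<in>edges F. e \<subseteq> \<nu>}"
    moreover then obtain s t where "s \<in> S" "t \<in> T" "e = {s, t}" using edgeE by blast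
    ultimately show "e \<in> (\<Union>t\<in>\<nu> \<inter> T. (\<lambda>s. {s, t}) ` (N t \<inter> \<nu>))" by (auto simp: N_def)
  qed (auto simp: N_def)
  also have "card \<dots> = (\<Sum>t\<in>\<nu> \<inter> T. card ((\<lambda>s. {s, t}) ` (N t \<inter> \<nu>)))"
  proof (rule card_UN_disjoint)
    show "\<forall>t\<in>\<nu> \<inter> T. \<forall>t'\<in>\<nu> \<inter> T. t \<noteq> t' \<longrightarrow> (\<lambda>s. {s, t}) ` (N t \<inter> \<nu>) \<inter> (\<lambda>s. {s, t'}) ` (N t' \<inter> \<nu>) = {}"
      using S_T by (auto simp: N_def doubleton_eq_iff)
  qed (use fin_S fin_T in \<open>auto simp: N_def\<close>)
  also have "\<dots> = (\<Sum>t\<in>\<nu> \<inter> T. card (N t \<inter> \<nu>))"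
    by (rule sum.cong[OF refl], rule card_image) (auto simp: inj_on_def doubleton_eq_iff)
  finally show ?thesis .
qed

lemma degree_sum_full: "S \<subseteq> \<nu> \<Longrightarrow> card {e\<in>edges F. e \<subseteq> \<nu>} = (\<Sum>t\<in>\<nu> \<inter> T. card (N t))"
  unfolding degree_sum by (rule sum.cong) (auto simp: N_def intro: arg_cong[where f = card])

lemma E_eq: "E = (\<Sum>t\<in>T. card (N t))"
proof -
  have "{e\<in>edges F. e \<subseteq> V} = edges F" using edge_sub by auto
  moreover have "V \<inter> T = T" using V_eq by auto
  ultimately show ?thesis using degree_sum_full[of V] V_eq by auto
qed

lemma card_Union_edges:
  assumes "\<sigma> \<subseteq> edges F" "card \<sigma> \<ge> 2" shows "card (\<Union>\<sigma>) \<ge> 3"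
proof -
  obtain e e' where e: "e \<in> \<sigma>" "e' \<in> \<sigma>" "e \<noteq> e'"
    by (rule two_elements[OF assms(2)])
  have f: "finite (e \<union> e')" using e assms edge_sub fin_V finite_subset by (metis finite_Un subsetD)
  have "card (e \<union> e') \<ge> 3"
  proof (rule ccontr)
    assume "\<not> card (e \<union> e') \<ge> 3"
    then have c: "card (e \<union> e') \<le> 2" by simp
    have "e = e \<union> e'" by (rule card_seteq) (use c f e assms edge_sub in auto)
    moreover have "e' = e \<union> e'" by (rule card_seteq) (use c f e assms edge_sub in auto)
    ultimately show False using e by simp
  qed
  also have "card (e \<union> e') \<le> card (\<Union>\<sigma>)"
  proof (rule card_mono)
    have "\<Union>\<sigma> \<subseteq> V" using assms edge_sub by blast
    then show "finite (\<Union>\<sigma>)" using fin_V by (rule finite_subset)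
  qed (use e in auto)
  finally show ?thesis .
qed

lemma subgraph_of_edges: "\<sigma> \<subseteq> edges F \<Longrightarrow> subgraph (Graph (\<Union>\<sigma>) \<sigma>) F"
  using edge_sub fin_V by (auto simp: subgraph_def simple_graph_def intro: finite_subset[of _ V])

lemma V_ge3: "card V \<ge> 3"
proof -
  have "card (\<Union>(edges F)) \<ge> 3" using card_Union_edges two_edges by auto
  also have "card (\<Union>(edges F)) \<le> card V" by (rule card_mono[OF fin_V]) (use edge_sub in auto)
  finally show ?thesis .
qed

lemma m2_pos: "m2 > 0"
proof -
  have "real E - 1 \<le> m2 * (real (card V) - 2)"
    using density_le[OF simple, of F] V_ge3 simple by (simp add: subgraph_def)
  then have "m2 * (real (card V) - 2) > 0" using two_edges by linarith
  then show ?thesis using V_ge3 by (simp add: zero_less_mult_iff)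
qed

text \<open>
  \<open>F\<close> contains a path with two edges, through the apex if \<open>S\<close> has at least two elements and through the only element
  of \<open>S\<close> otherwise. This makes \<open>P\<close> at least \<open>n\<close>.
\<close>

lemma m2_ge1: "m2 \<ge> 1"
proof -
  have "\<exists>\<sigma>\<subseteq>edges F. card \<sigma> = 2 \<and> card (\<Union>\<sigma>) \<le> 3"
  proof (cases "card S \<ge> 2")
    case True
    then obtain s s' where s: "s \<in> S" "s' \<in> S" "s \<noteq> s'"
      using two_elements by metis
    have "card (\<Union>{{apex, s}, {apex, s'}}) \<le> 3" by (auto simp: card_insert_if)
    moreover have "{apex, s} \<noteq> {apex, s'}" using s by (auto simp: doubleton_eq_iff)
    ultimately show ?thesis using s apex(2) by (intro exI[of _ "{{apex, s}, {apex, s'}}"]) auto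
  next
    case False
    moreover have "card S > 0" using S_ne fin_S by (simp add: card_gt_0_iff)
    ultimately have "card S = 1" by linarith
    then obtain s where s: "S = {s}" by (rule card_1_singletonE)
    obtain e e' where e: "e \<in> edges F" "e' \<in> edges F" "e \<noteq> e'"
      by (rule two_elements[OF two_edges])
    obtain t t' where "e = {s, t}" "e' = {s, t'}" using edgeE e s by (metis singletonD)
    then show ?thesis using e by (intro exI[of _ "{e, e'}"]) (auto simp: card_insert_if)
  qed
  then obtain \<sigma> where \<sigma>: "\<sigma> \<subseteq> edges F" "card \<sigma> = 2" "card (\<Union>\<sigma>) \<le> 3" by auto
  then have "card (\<Union>\<sigma>) = 3" using card_Union_edges[of \<sigma>] by simp
  then show ?thesis using density_le[OF simple subgraph_of_edges[OF \<sigma>(1)]] \<sigma> by simp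
qed

text \<open>
  The codegree condition for a set \<open>\<sigma>\<close> of edges compares \<open>(card \<sigma> - 1) / m2\<close> with \<open>card (\<Union>\<sigma>) - 2\<close>. Since \<open>m2\<close> is
  a fraction with numerator less than \<open>E\<close>, the two either agree or differ by at least \<open>1 / E\<close>. If they
  agree, \<open>\<sigma>\<close> consists of all edges inside \<open>\<Union>\<sigma>\<close> and this vertex set is tight, so it contains \<open>S\<close>. It then
  also contains a vertex complete to \<open>S\<close>: otherwise every vertex of its \<open>T\<close>-part sees at most \<open>card S - 1\<close>
  vertices of \<open>S\<close>, and adding the apex to the set would raise the density above \<open>m2\<close>.
\<close>

lemma tight_or_slack:
  assumes \<sigma>: "\<sigma> \<subseteq> edges F" "card \<sigma> \<ge> 2"
  shows "(real (card (\<Union>\<sigma>)) - 2) - (real (card \<sigma>) - 1) / m2 \<ge> 1 / real E \<or>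
    ((real (card (\<Union>\<sigma>)) - 2) = (real (card \<sigma>) - 1) / m2 \<and> S \<subseteq> \<Union>\<sigma> \<and>
      card \<sigma> = (\<Sum>t\<in>\<Union>\<sigma> \<inter> T. card (N t)) \<and> (\<exists>t\<in>\<Union>\<sigma> \<inter> T. N t = S))"
proof -
  define \<nu> where "\<nu> = \<Union>\<sigma>"
  define j where "j = card \<sigma>"
  have \<nu>V: "\<nu> \<subseteq> V" using \<sigma> edge_sub by (auto simp: \<nu>_def)
  have f\<nu>: "finite \<nu>" using \<nu>V fin_V finite_subset by blast
  have \<nu>3: "card \<nu> \<ge> 3" using card_Union_edges[OF \<sigma>] by (simp add: \<nu>_def)
  have le: "real j - 1 \<le> m2 * (real (card \<nu>) - 2)"
    using density_le[OF simple subgraph_of_edges[OF \<sigma>(1)]] \<nu>3 by (simp add: \<nu>_def j_def)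
  show ?thesis
  proof (cases "real j - 1 = m2 * (real (card \<nu>) - 2)")
    case False
    obtain F' where F': "subgraph F' F" "num_verts F' \<ge> 3"
      "real (num_edges F') - 1 = m2 * (real (num_verts F') - 2)"
      using density_attained[OF simple] V_ge3 by auto
    define e where "e = int (num_edges F') - 1"
    define v where "v = int (num_verts F') - 2"
    define x where "x = (int (card \<nu>) - 2) * e - (int j - 1) * v"
    have v1: "v \<ge> 1" using F' by (simp add: v_def)
    have ev: "real_of_int e = m2 * real_of_int v" using F'(3) by (simp add: e_def v_def)
    have e1: "real_of_int e > 0" using ev m2_pos v1 by simp
    have eE: "real_of_int e \<le> real E"
      using card_mono[OF fin_E, of "edges F'"] F'(1) by (auto simp: e_def subgraph_def)
    \<comment> \<open>The gap, multiplied by the numerator \<open>e\<close> of \<open>m2 = e / v\<close>, is a positive integer.\<close>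
    have "real_of_int x = real_of_int v * (m2 * (real (card \<nu>) - 2) - (real j - 1))"
      by (simp add: x_def ev algebra_simps)
    also have "\<dots> > 0" using le False v1 by simp
    finally have "x \<ge> 1" by simp
    have "1 / real E \<le> 1 / real_of_int e" using e1 eE by (simp add: frac_le)
    also have "\<dots> \<le> real_of_int x / real_of_int e" using \<open>x \<ge> 1\<close> e1 by (intro divide_right_mono) auto
    also have "\<dots> = (real (card \<nu>) - 2) - (real j - 1) * (v / e)"
      using e1 by (simp add: x_def diff_divide_distrib)
    also have "v / e = 1 / m2" using ev v1 m2_pos by simp
    finally show ?thesis by (simp add: \<nu>_def j_def)
  next
    case True
    define I where "I = {e\<in>edges F. e \<subseteq> \<nu>}"
    have fI: "finite I" using fin_E by (simp add: I_def)
    have \<sigma>I: "\<sigma> \<subseteq> I" using \<sigma> by (auto simp: I_def \<nu>_def)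
    have indsub: "subgraph (induced_subgraph F \<nu>) F"
      using simple fin_V by (auto simp: subgraph_def simple_graph_def induced_subgraph_def)
    have Vn: "V \<inter> \<nu> = \<nu>" using \<nu>V by auto
    have "real (card I) - 1 \<le> m2 * (real (card \<nu>) - 2)"
      using density_le[OF simple indsub] \<nu>3 by (simp add: induced_subgraph_def Vn I_def)
    moreover have "j \<le> card I" unfolding j_def by (rule card_mono[OF fI \<sigma>I])
    ultimately have cI: "card I = j" using True by simp
    have "(real (num_edges (induced_subgraph F \<nu>)) - 1) / (real (card \<nu>) - 2) = m2"
      using True \<nu>3 cI by (simp add: induced_subgraph_def I_def field_simps)
    then have S\<nu>: "S \<subseteq> \<nu>" using tight \<nu>V \<nu>3 by blast
    have js: "j = (\<Sum>t\<in>\<nu> \<inter> T. card (N t))" using degree_sum_full[OF S\<nu>] cI by (simp add: I_def)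
    have "\<exists>t\<in>\<nu> \<inter> T. N t = S"
    proof (rule ccontr)
      assume no: "\<not> (\<exists>t\<in>\<nu> \<inter> T. N t = S)"
      define k where "k = card S"
      have k1: "k \<ge> 1" using fin_S S_ne by (simp add: k_def Suc_le_eq card_gt_0_iff)
      have ap: "apex \<notin> \<nu>" using no N_apex apex by auto
      define \<nu>' where "\<nu>' = insert apex \<nu>"
      have \<nu>'V: "\<nu>' \<subseteq> V" using \<nu>V apex V_eq by (auto simp: \<nu>'_def)
      have c\<nu>': "card \<nu>' = card \<nu> + 1" using ap f\<nu> by (simp add: \<nu>'_def)
      have "card {e\<in>edges F. e \<subseteq> \<nu>'} = (\<Sum>t\<in>\<nu>' \<inter> T. card (N t))"
        by (rule degree_sum_full) (use S\<nu> in \<open>auto simp: \<nu>'_def\<close>)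
      also have "\<nu>' \<inter> T = insert apex (\<nu> \<inter> T)" using apex by (auto simp: \<nu>'_def)
      also have "(\<Sum>t\<in>insert apex (\<nu> \<inter> T). card (N t)) = k + j"
        using ap f\<nu> N_apex by (simp add: js k_def)
      finally have c': "card {e\<in>edges F. e \<subseteq> \<nu>'} = k + j" .
      have indsub': "subgraph (induced_subgraph F \<nu>') F"
        using simple fin_V by (auto simp: subgraph_def simple_graph_def induced_subgraph_def)
      have Vn': "V \<inter> \<nu>' = \<nu>'" using \<nu>'V by auto
      have "real (k + j) - 1 \<le> m2 * (real (card \<nu> + 1) - 2)"
        using density_le[OF simple indsub'] \<nu>3 c\<nu>' c' by (simp add: induced_subgraph_def Vn')
      \<comment> \<open>The apex adds \<open>k\<close> edges and one vertex to a set already attaining \<open>m2\<close>.\<close>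
      then have km: "real k \<le> m2" using True by (simp add: algebra_simps)
      have "real k * (real (card \<nu>) - 2) \<le> m2 * (real (card \<nu>) - 2)"
        using km \<nu>3 by (intro mult_right_mono) auto
      then have 1: "real k * (real (card \<nu>) - 2) \<le> real j - 1" using True by simp
      have "j \<le> (\<Sum>t\<in>\<nu> \<inter> T. k - 1)"
        unfolding js
      proof (rule sum_mono)
        fix t assume t: "t \<in> \<nu> \<inter> T"
        then have "N t \<subset> S" using no N_sub[of t] by auto
        then have "card (N t) < k" unfolding k_def by (rule psubset_card_mono[OF fin_S])
        then show "card (N t) \<le> k - 1" by simp
      qed
      also have "\<dots> = card (\<nu> \<inter> T) * (k - 1)" by simp
      finally have 2: "real j \<le> real (card (\<nu> \<inter> T)) * (real k - 1)"
        using k1 by (metis of_nat_1 of_nat_diff of_nat_le_iff of_nat_mult)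
      have "\<nu> = S \<union> (\<nu> \<inter> T)" using S\<nu> \<nu>V V_eq by auto
      moreover have "card (S \<union> (\<nu> \<inter> T)) = card S + card (\<nu> \<inter> T)"
        by (rule card_Un_disjoint) (use fin_S fin_T S_T in auto)
      ultimately have c: "card \<nu> = k + card (\<nu> \<inter> T)" by (simp add: k_def)
      have "real (card (\<nu> \<inter> T)) * (real k - 1) \<le> (real (card \<nu>) - 2) * (real k - 1)"
      proof (cases "k = 1")
        case False
        then show ?thesis using k1 c by (intro mult_right_mono) auto
      qed simp
      then show False using 1 2 \<nu>3 by (simp add: algebra_simps)
    qed
    then show ?thesis using True S\<nu> js m2_pos by (auto simp: \<nu>_def j_def)
  qed
qed

end

section \<open>A spread weight on the copies of the forbidden graph\<close>

definition embedded_copies :: "'a ugraph \<Rightarrow> nat \<Rightarrow> nat set set set" where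
  "embedded_copies F n = {(`) \<phi> ` edges F | \<phi>. \<phi> \<in> verts F \<rightarrow>\<^sub>E {..<n} \<and> inj_on \<phi> (verts F)}"

lemma inj_image_edges:
  assumes "simple_graph F" "inj_on \<phi> (verts F)"
  shows "inj_on ((`) \<phi>) (edges F)"
  using assms by (auto simp: inj_on_def simple_graph_def subset_iff inj_on_image_eq_iff)

lemma sum_UN_le:
  fixes f :: "'b \<Rightarrow> real"
  assumes "finite I" "\<And>i. i \<in> I \<Longrightarrow> finite (A i)" "\<And>x. 0 \<le> f x"
  shows "sum f (\<Union>i\<in>I. A i) \<le> (\<Sum>i\<in>I. sum f (A i))"
  using assms
proof (induction I rule: finite_induct)
  case (insert i I)
  have "sum f (\<Union>i\<in>insert i I. A i) \<le> sum f (A i) + sum f (\<Union>i\<in>I. A i)"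
    using insert.prems insert.hyps
    by (simp add: sum_Un sum_nonneg)
  also have "\<dots> \<le> sum f (A i) + (\<Sum>i\<in>I. sum f (A i))" using insert by auto
  finally show ?case using insert.hyps by simp
qed simp

context forbidden_graph begin

definition spread_const :: real where
  "spread_const = 4 * (2 ^ E * ((2 * real E) ^ card V * (2 * real (card V)) ^ card V))"

lemma spread_const_ge_1: "spread_const \<ge> 1"
proof -
  have "1 \<le> (2::real) ^ E" "1 \<le> (2 * real E) ^ card V" "1 \<le> (2 * real (card V)) ^ card V"
    using two_edges V_ge3 by (intro one_le_power; linarith)+
  then have "1 * (1 * (1 * 1)) \<le> spread_const" unfolding spread_const_def by (intro mult_mono) auto
  then show ?thesis by simp
qed

end

text \<open>
  A dense host graph. The bound on \<open>n\<close> ensures that non-injective homomorphisms are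
  rare.
\<close>

locale forbidden_in_host = forbidden_graph F S T apex + host_graph n G
  for F :: "'a ugraph" and S T :: "'a set" and apex :: 'a and n :: nat and G :: "nat set set" +
  assumes dense: "real n powr (2 - 1 / (real (num_edges F))\<^sup>2) \<le> real (card G)"
    and large: "(4 * (real (card (verts F)))\<^sup>2 * (2 * real (card (verts F))) ^ card (verts F))\<^sup>2 \<le> real n"
begin

sublocale pattern_in_host n G S T N by unfold_locales

abbreviation P :: real where "P \<equiv> real n powr (2 - 1 / m2)"

text \<open>
  The law of the edge set of a random copy, restricted to injective homomorphisms. The factor 4
  compensates for the homomorphisms discarded as not good (at most half) or as not injective (at most
  a quarter).
\<close>

definition weight :: "nat set set \<Rightarrow> real" where
  "weight X = 4 * (\<Sum>\<phi>\<in>{\<phi>\<in>V \<rightarrow>\<^sub>E {..<n}. inj_on \<phi> V \<and> (`) \<phi> ` edges F = X}. pr \<phi>)"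

lemma n1: "real n \<ge> 1" using n_pos by simp

lemma card_V_pos: "real (card V) \<ge> 1" using V_ge3 by simp

lemma theta_power: "1 / \<theta> ^ card (S \<union> T) = (2 * real (card V)) ^ card V"
  by (simp add: \<theta>_def V_eq power_divide)

lemma m_dense: "m \<ge> real n powr (2 - 1 / (real E)\<^sup>2)" using dense by (simp add: m_def)

text \<open>
  For a single edge this is uniformity on edges. For a tight vertex set the random-graph bound
  \<open>mass_containing_S\<close> equals \<open>P ^ (card \<sigma> - 1) / m ^ card \<sigma>\<close> up to the constant. For the remaining sets the
  crude bound loses \<open>(n^2 / m)^(E - card \<sigma>)\<close>, at most \<open>n powr (1/E)\<close> by density of the host, and this is
  covered by the slack.
\<close>

lemma mass_bound:
  assumes \<sigma>: "\<sigma> \<subseteq> edges F" "\<sigma> \<noteq> {}" and b: "\<And>v. v \<in> \<Union>\<sigma> \<Longrightarrow> \<psi> v < n"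
  shows "mass (\<Union>\<sigma>) \<psi> \<le> (2 * real (card V)) ^ card V * P ^ (card \<sigma> - 1) / m ^ card \<sigma>"
proof -
  define c where "c = (2 * real (card V)) ^ card V"
  have c1: "c \<ge> 1" unfolding c_def using card_V_pos by (intro one_le_power) linarith
  have fs: "finite \<sigma>" using \<sigma> fin_E finite_subset by blast
  define j where "j = card \<sigma>"
  define \<nu> where "\<nu> = \<Union>\<sigma>"
  have \<nu>V: "\<nu> \<subseteq> S \<union> T" using \<sigma> edge_sub V_eq by (auto simp: \<nu>_def)
  have j1: "j \<ge> 1" using \<sigma> fs by (simp add: j_def Suc_le_eq card_gt_0_iff)
  show ?thesis
  proof (cases "j = 1")
    case True
    then obtain e where e: "\<sigma> = {e}" unfolding j_def by (rule card_1_singletonE)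
    then have "e \<in> edges F" using \<sigma> by simp
    then obtain s t where st: "s \<in> S" "t \<in> T" "e = {s, t}" using edgeE by blast
    then have "s \<in> N t" using e \<sigma> by (auto simp: N_def)
    then have "mass \<nu> \<psi> \<le> 1 / m" using mass_edge[OF st(2), of s \<psi>] b e st by (auto simp: \<nu>_def)
    also have "\<dots> \<le> c / m" using c1 m_pos by (simp add: divide_right_mono)
    finally show ?thesis using True by (simp add: \<nu>_def j_def c_def)
  next
    case False
    then have j2: "j \<ge> 2" using j1 by simp
    have np: "real n > 0" using n_pos by simp
    have Pp: "P ^ (j - 1) = real n powr ((2 - 1 / m2) * (real j - 1))"
      using powr_power[of "real n" "2 - 1 / m2" "j - 1"] np j1 by (simp only: of_nat_diff mult.commute) simp
    from tight_or_slack[OF \<sigma>(1)] j2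
    consider (slack) "(real (card \<nu>) - 2) - (real j - 1) / m2 \<ge> 1 / real E"
      | (tight) "(real (card \<nu>) - 2) = (real j - 1) / m2" "S \<subseteq> \<nu>"
          "j = (\<Sum>t\<in>\<nu> \<inter> T. card (N t))" "\<exists>t\<in>\<nu> \<inter> T. N t = S"
      unfolding j_def \<nu>_def by blast
    then show ?thesis
    proof cases
      case tight
      then obtain t0 where t0: "t0 \<in> \<nu>" "t0 \<in> T" "N t0 = S" by auto
      have "mass \<nu> \<psi> \<le> q_inv ^ j / (\<theta> ^ card (S \<union> T) * real n ^ card \<nu>)"
        using mass_containing_S[OF tight(2) \<nu>V t0] b tight(3) by (auto simp: \<nu>_def)
      also have "\<dots> = c * (q_inv ^ j / real n ^ card \<nu>)"
        unfolding c_def theta_power[symmetric] by simp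
      also have "q_inv ^ j / real n ^ card \<nu> = P ^ (j - 1) / m ^ j"
      proof -
        have "P ^ (j - 1) = real n powr (2 * real j - real (card \<nu>))"
          unfolding Pp using tight(1) by (simp add: algebra_simps)
        also have "\<dots> = real n ^ (2 * j) / real n ^ card \<nu>"
          using np powr_realpow[OF np, of "2 * j"] powr_realpow[OF np, of "card \<nu>"] by (simp add: powr_diff)
        finally show ?thesis by (simp add: q_inv_def power_divide power_mult)
      qed
      finally show ?thesis by (simp add: \<nu>_def j_def c_def)
    next
      case slack
      have jE: "j \<le> E" unfolding j_def by (rule card_mono[OF fin_E \<sigma>(1)])
      have "mass \<nu> \<psi> \<le> q_inv ^ E / (\<theta> ^ card (S \<union> T) * real n ^ card \<nu>)"
        unfolding E_eq by (rule mass_any[OF apex(1) N_apex \<nu>V])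
      also have "\<dots> = c * (q_inv ^ E / real n ^ card \<nu>)"
        unfolding c_def theta_power[symmetric] by simp
      also have "q_inv ^ E / real n ^ card \<nu> \<le> P ^ (j - 1) / m ^ j"
      proof -
        define \<epsilon> where "\<epsilon> = 1 / (real E)\<^sup>2"
        have eE: "\<epsilon> * (real E - real j) \<le> 1 / real E"
        proof -
          have "\<epsilon> * (real E - real j) \<le> \<epsilon> * real E" by (intro mult_left_mono) (auto simp: \<epsilon>_def)
          also have "\<dots> = 1 / real E" using two_edges by (simp add: \<epsilon>_def power2_eq_square)
          finally show ?thesis .
        qed
        have "real n powr ((2 - \<epsilon>) * (real E - real j)) = (real n powr (2 - \<epsilon>)) ^ (E - j)"
          using powr_power[of "real n" "2 - \<epsilon>" "E - j"] np jE by (simp add: of_nat_diff mult.commute)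
        also have "\<dots> \<le> m ^ (E - j)" by (rule power_mono) (use m_dense in \<open>auto simp: \<epsilon>_def\<close>)
        finally have mE: "real n powr ((2 - \<epsilon>) * (real E - real j)) \<le> m ^ (E - j)" .
        have "real n ^ (2 * E) = real n powr (2 * real E)" using powr_realpow[OF np, of "2 * E"] by simp
        also have "\<dots> \<le> real n powr (((2 - 1 / m2) * (real j - 1) + real (card \<nu>)) + (2 - \<epsilon>) * (real E - real j))"
        proof (rule powr_mono[OF _ n1])
          have "(2 - 1 / m2) * (real j - 1) = 2 * real j - 2 - (real j - 1) / m2"
            by (simp add: algebra_simps diff_divide_distrib)
          moreover have "(2 - \<epsilon>) * (real E - real j) = 2 * real E - 2 * real j - \<epsilon> * (real E - real j)"
            by (simp add: algebra_simps)
          ultimately show "2 * real E \<le> (2 - 1 / m2) * (real j - 1) + real (card \<nu>) + (2 - \<epsilon>) * (real E - real j)"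
            using slack eE by linarith
        qed
        also have "\<dots> = P ^ (j - 1) * real n ^ card \<nu> * real n powr ((2 - \<epsilon>) * (real E - real j))"
          unfolding Pp using np by (simp add: powr_add powr_realpow)
        also have "\<dots> \<le> P ^ (j - 1) * real n ^ card \<nu> * m ^ (E - j)"
          by (rule mult_left_mono[OF mE]) simp
        finally have main: "real n ^ (2 * E) \<le> P ^ (j - 1) * real n ^ card \<nu> * m ^ (E - j)" .
        have "m ^ E = m ^ (E - j) * m ^ j" using jE by (simp add: power_add[symmetric])
        then have "q_inv ^ E / real n ^ card \<nu> = real n ^ (2 * E) / (m ^ (E - j) * m ^ j * real n ^ card \<nu>)"
          by (simp add: q_inv_def power_divide power_mult)
        also have "\<dots> \<le> (P ^ (j - 1) * real n ^ card \<nu> * m ^ (E - j)) / (m ^ (E - j) * m ^ j * real n ^ card \<nu>)"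
          by (rule divide_right_mono[OF main]) (use m_pos in simp)
        also have "\<dots> = P ^ (j - 1) / m ^ j" using m_pos np by simp
        finally show ?thesis .
      qed
      finally show ?thesis using c1 by (simp add: \<nu>_def j_def c_def mult_left_mono)
    qed
  qed
qed

lemma weight_sum:
  assumes "finite A"
  shows "sum weight A = 4 * (\<Sum>\<phi>\<in>{\<phi>\<in>V \<rightarrow>\<^sub>E {..<n}. inj_on \<phi> V \<and> (`) \<phi> ` edges F \<in> A}. pr \<phi>)"
proof -
  define \<Phi> where "\<Phi> = {\<phi>\<in>V \<rightarrow>\<^sub>E {..<n}. inj_on \<phi> V}"
  have f: "finite \<Phi>" unfolding \<Phi>_def
    by (rule finite_subset[of _ "V \<rightarrow>\<^sub>E {..<n}"]) (use fin_V in \<open>auto intro!: finite_PiE\<close>)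
  have "sum weight A = 4 * (\<Sum>X\<in>A. \<Sum>\<phi>\<in>{\<phi>\<in>\<Phi>. (`) \<phi> ` edges F = X}. pr \<phi>)"
    unfolding weight_def \<Phi>_def by (simp add: sum_distrib_left conj_assoc)
  also have "(\<Sum>X\<in>A. \<Sum>\<phi>\<in>{\<phi>\<in>\<Phi>. (`) \<phi> ` edges F = X}. pr \<phi>)
      = (\<Sum>\<phi>\<in>\<Phi>. \<Sum>X\<in>{X\<in>A. (`) \<phi> ` edges F = X}. pr \<phi>)"
    by (rule sum.swap_restrict[OF assms f])
  also have "\<dots> = (\<Sum>\<phi>\<in>\<Phi>. if (`) \<phi> ` edges F \<in> A then pr \<phi> else 0)"
  proof (rule sum.cong[OF refl])
    fix \<phi>
    have "{X\<in>A. (`) \<phi> ` edges F = X} = (if (`) \<phi> ` edges F \<in> A then {(`) \<phi> ` edges F} else {})" by auto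
    then show "(\<Sum>X\<in>{X\<in>A. (`) \<phi> ` edges F = X}. pr \<phi>) = (if (`) \<phi> ` edges F \<in> A then pr \<phi> else 0)" by simp
  qed
  also have "\<dots> = (\<Sum>\<phi>\<in>{\<phi>\<in>\<Phi>. (`) \<phi> ` edges F \<in> A}. pr \<phi>)" using f by (simp add: sum.inter_filter)
  finally show ?thesis by (simp add: \<Phi>_def conj_assoc)
qed

lemma pr_image_in_G:
  assumes "pr \<phi> \<noteq> 0" shows "(`) \<phi> ` edges F \<subseteq> G"
proof
  fix e assume "e \<in> (`) \<phi> ` edges F"
  then obtain d where d: "d \<in> edges F" "e = \<phi> ` d" by auto
  then obtain s t where st: "s \<in> S" "t \<in> T" "d = {s, t}" using edgeE by blast
  then have "s \<in> N t" using d by (auto simp: N_def)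
  then have "{\<phi> s, \<phi> t} \<in> G" using pr_hom[of \<phi> t s] assms pr_nonneg[of \<phi>] st by auto
  then show "e \<in> G" using d st by simp
qed

lemma weight_nonneg: "weight X \<ge> 0"
  unfolding weight_def by (auto intro!: sum_nonneg pr_nonneg)

lemma weight_nonzeroE:
  assumes "weight X \<noteq> 0"
  obtains \<phi> where "\<phi> \<in> V \<rightarrow>\<^sub>E {..<n}" "inj_on \<phi> V" "(`) \<phi> ` edges F = X" "pr \<phi> \<noteq> 0"
proof -
  have "\<exists>\<phi>\<in>{\<phi>\<in>V \<rightarrow>\<^sub>E {..<n}. inj_on \<phi> V \<and> (`) \<phi> ` edges F = X}. pr \<phi> \<noteq> 0"
    using assms sum.neutral unfolding weight_def by (metis (no_types, lifting) mult_zero_right)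
  then show ?thesis using that by auto
qed

lemma weight_copy: "weight X \<noteq> 0 \<Longrightarrow> X \<in> embedded_copies F n"
  by (erule weight_nonzeroE) (auto simp: embedded_copies_def)

lemma weight_uniform: "uniform_weight G E weight"
  unfolding uniform_weight_def
proof (intro conjI allI impI weight_nonneg)
  fix X assume "weight X \<noteq> 0"
  then obtain \<phi> where p: "\<phi> \<in> V \<rightarrow>\<^sub>E {..<n}" "inj_on \<phi> V" "(`) \<phi> ` edges F = X" "pr \<phi> \<noteq> 0"
    by (rule weight_nonzeroE)
  show "X \<subseteq> G" using pr_image_in_G[OF p(4)] p(3) by simp
  show "card X = E" unfolding p(3)[symmetric] by (rule card_image) (rule inj_image_edges[OF simple p(2)])
qed

lemma weight_total: "wdeg G weight {} \<ge> 1"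
proof -
  let ?\<Omega> = "V \<rightarrow>\<^sub>E {..<n}"
  have f\<Omega>: "finite ?\<Omega>" using fin_V by (auto intro: finite_PiE)
  have "wdeg G weight {} = 4 * (\<Sum>\<phi>\<in>{\<phi>\<in>?\<Omega>. inj_on \<phi> V \<and> (`) \<phi> ` edges F \<in> Pow G}. pr \<phi>)"
    using weight_sum[of "Pow G"] finite_G by (simp add: wdeg_def Pow_def)
  also have "(\<Sum>\<phi>\<in>{\<phi>\<in>?\<Omega>. inj_on \<phi> V \<and> (`) \<phi> ` edges F \<in> Pow G}. pr \<phi>) = (\<Sum>\<phi>\<in>{\<phi>\<in>?\<Omega>. inj_on \<phi> V}. pr \<phi>)"
    by (rule sum.mono_neutral_left) (use f\<Omega> pr_image_in_G in auto)
  finally have 1: "wdeg G weight {} = 4 * (\<Sum>\<phi>\<in>{\<phi>\<in>?\<Omega>. inj_on \<phi> V}. pr \<phi>)" .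
  have "(\<Sum>\<phi>\<in>?\<Omega>. pr \<phi>) = (\<Sum>\<phi>\<in>{\<phi>\<in>?\<Omega>. inj_on \<phi> V}. pr \<phi>) + (\<Sum>\<phi>\<in>{\<phi>\<in>?\<Omega>. \<not> inj_on \<phi> V}. pr \<phi>)"
  proof -
    have "?\<Omega> = {\<phi>\<in>?\<Omega>. inj_on \<phi> V} \<union> {\<phi>\<in>?\<Omega>. \<not> inj_on \<phi> V}" by auto
    then show ?thesis by (metis (no_types, lifting) f\<Omega> finite_Un mem_Collect_eq sum.union_disjoint disjoint_iff)
  qed
  moreover have "(\<Sum>\<phi>\<in>{\<phi>\<in>?\<Omega>. \<not> inj_on \<phi> V}. pr \<phi>) \<le> 1/4"
  proof -
    define v where "v = real (card V)"
    define c where "c = 4 * v\<^sup>2 * (2 * v) ^ card V"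
    have c0: "c \<ge> 0" by (simp add: c_def v_def)
    have "q_inv ^ E \<le> (real n powr (1 / (real E)\<^sup>2)) ^ E"
    proof (rule power_mono)
      have "q_inv \<le> (real n)\<^sup>2 / real n powr (2 - 1 / (real E)\<^sup>2)"
        unfolding q_inv_def using m_dense n_pos m_pos by (intro divide_left_mono mult_pos_pos) auto
      also have "\<dots> = real n powr (1 / (real E)\<^sup>2)"
        using n_pos powr_realpow[of "real n" 2] by (simp add: powr_diff)
      finally show "q_inv \<le> real n powr (1 / (real E)\<^sup>2)" .
    qed (use q_inv_pos in auto)
    also have "\<dots> = real n powr (1 / real E)"
      using n_pos two_edges by (subst powr_power) (auto simp: power2_eq_square)
    also have "\<dots> \<le> real n powr (1 / 2)" using two_edges n1 by (intro powr_mono) (auto simp: divide_simps)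
    finally have q: "q_inv ^ E \<le> sqrt (real n)" by (simp add: powr_half_sqrt)
    have "(\<Sum>\<phi>\<in>{\<phi>\<in>?\<Omega>. \<not> inj_on \<phi> V}. pr \<phi>) \<le> v\<^sup>2 * (q_inv ^ E / (\<theta> ^ card V * n))"
      using noninjective_mass[OF apex(1) N_apex] by (simp add: V_eq E_eq v_def)
    also have "\<dots> = v\<^sup>2 * (1 / \<theta> ^ card V) * (q_inv ^ E / n)" by simp
    also have "1 / \<theta> ^ card V = (2 * v) ^ card V" using theta_power by (simp add: V_eq v_def)
    also have "v\<^sup>2 * (2 * v) ^ card V * (q_inv ^ E / n) = c / 4 * (q_inv ^ E / n)" by (simp add: c_def)
    also have "\<dots> \<le> c / 4 * (sqrt (real n) / n)" using q c0 by (intro mult_left_mono divide_right_mono) auto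
    also have "sqrt (real n) / n = 1 / sqrt (real n)" using n_pos by (simp add: field_simps)
    also have "c / 4 * (1 / sqrt (real n)) \<le> 1 / 4"
    proof -
      have "c \<le> sqrt (real n)" using large by (intro real_le_rsqrt) (simp add: c_def v_def)
      then show ?thesis using n_pos by (simp add: field_simps)
    qed
    finally show ?thesis .
  qed
  moreover have "(\<Sum>\<phi>\<in>?\<Omega>. pr \<phi>) \<ge> 1/2" using total_ge_half by (simp add: V_eq)
  ultimately show ?thesis unfolding 1 by linarith
qed

text \<open>
  A copy containing \<open>\<sigma>\<close> sends some set \<open>\<tau>\<close> of edges of \<open>F\<close> onto \<open>\<sigma>\<close>. There are at most \<open>2 ^ E\<close> choices
  of \<open>\<tau>\<close>, and at most \<open>(2 E) ^ card V\<close> ways to map its vertices into those of \<open>\<sigma>\<close>; each of these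
  is controlled by \<open>mass_bound\<close>.
\<close>

lemma weight_codegree: "codeg_bound G spread_const (nat \<lceil>P\<rceil>) weight"
  unfolding codeg_bound_def
proof (intro allI impI)
  fix \<sigma> assume \<sigma>: "\<sigma> \<noteq> {}" "\<sigma> \<subseteq> G"
  let ?\<Omega> = "V \<rightarrow>\<^sub>E {..<n}"
  have f\<Omega>: "finite ?\<Omega>" using fin_V by (auto intro: finite_PiE)
  have f\<sigma>: "finite \<sigma>" using \<sigma> finite_G finite_subset by blast
  define j where "j = card \<sigma>"
  define U where "U = \<Union>\<sigma>"
  have Un: "U \<subseteq> {..<n}" using \<sigma> G_sub by (auto simp: U_def all_edges_def)
  have j1: "j \<ge> 1" using \<sigma> f\<sigma> by (simp add: j_def Suc_le_eq card_gt_0_iff)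
  have fU: "finite U" using Un finite_subset by blast
  have cU: "card U \<le> 2 * j"
  proof -
    have "card U \<le> (\<Sum>e\<in>\<sigma>. card e)" unfolding U_def by (rule card_Union_le_sum_card)
    also have "\<dots> = (\<Sum>e\<in>\<sigma>. 2)" by (rule sum.cong) (use \<sigma> G_sub in \<open>auto simp: all_edges_def\<close>)
    finally show ?thesis by (simp add: j_def)
  qed
  define Q where "Q = {\<tau>\<in>Pow (edges F). card \<tau> = j}"
  have fQ: "finite Q" using fin_E by (simp add: Q_def)
  define B where "B = (2 * real (card V)) ^ card V * P ^ (j - 1) / m ^ j"
  have B0: "B \<ge> 0" using m_pos by (simp add: B_def)
  have "wdeg G weight \<sigma> = 4 * (\<Sum>\<phi>\<in>{\<phi>\<in>?\<Omega>. inj_on \<phi> V \<and> (`) \<phi> ` edges F \<in> {X. X \<subseteq> G \<and> \<sigma> \<subseteq> X}}. pr \<phi>)"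
    unfolding wdeg_def by (rule weight_sum) (use finite_G in auto)
  also have "(\<Sum>\<phi>\<in>{\<phi>\<in>?\<Omega>. inj_on \<phi> V \<and> (`) \<phi> ` edges F \<in> {X. X \<subseteq> G \<and> \<sigma> \<subseteq> X}}. pr \<phi>)
     \<le> (\<Sum>\<phi>\<in>(\<Union>\<tau>\<in>Q. \<Union>\<psi>\<in>\<Union>\<tau> \<rightarrow>\<^sub>E U. {\<phi>\<in>?\<Omega>. \<forall>v\<in>\<Union>\<tau>. \<phi> v = \<psi> v}). pr \<phi>)"
  proof (rule sum_mono2)
    show "finite (\<Union>\<tau>\<in>Q. \<Union>\<psi>\<in>\<Union>\<tau> \<rightarrow>\<^sub>E U. {\<phi>\<in>?\<Omega>. \<forall>v\<in>\<Union>\<tau>. \<phi> v = \<psi> v})"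
      by (rule finite_subset[OF _ f\<Omega>]) auto
    show "{\<phi>\<in>?\<Omega>. inj_on \<phi> V \<and> (`) \<phi> ` edges F \<in> {X. X \<subseteq> G \<and> \<sigma> \<subseteq> X}}
      \<subseteq> (\<Union>\<tau>\<in>Q. \<Union>\<psi>\<in>\<Union>\<tau> \<rightarrow>\<^sub>E U. {\<phi>\<in>?\<Omega>. \<forall>v\<in>\<Union>\<tau>. \<phi> v = \<psi> v})"
    proof
      fix \<phi> assume "\<phi> \<in> {\<phi>\<in>?\<Omega>. inj_on \<phi> V \<and> (`) \<phi> ` edges F \<in> {X. X \<subseteq> G \<and> \<sigma> \<subseteq> X}}"
      then have p: "\<phi> \<in> ?\<Omega>" "inj_on \<phi> V" "\<sigma> \<subseteq> (`) \<phi> ` edges F" by auto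
      define \<tau> where "\<tau> = {e\<in>edges F. \<phi> ` e \<in> \<sigma>}"
      have im: "(`) \<phi> ` \<tau> = \<sigma>" using p(3) by (auto simp: \<tau>_def)
      have "inj_on ((`) \<phi>) \<tau>" by (rule inj_on_subset[OF inj_image_edges[OF simple p(2)]]) (auto simp: \<tau>_def)
      then have "card \<tau> = j" using card_image im unfolding j_def by metis
      then have "\<tau> \<in> Q" by (auto simp: Q_def \<tau>_def)
      moreover have "restrict \<phi> (\<Union>\<tau>) \<in> \<Union>\<tau> \<rightarrow>\<^sub>E U"
        by (auto simp: U_def \<tau>_def)
      ultimately show "\<phi> \<in> (\<Union>\<tau>\<in>Q. \<Union>\<psi>\<in>\<Union>\<tau> \<rightarrow>\<^sub>E U. {\<phi>\<in>?\<Omega>. \<forall>v\<in>\<Union>\<tau>. \<phi> v = \<psi> v})"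
        using p(1) by (intro UN_I[of \<tau>] UN_I[of "restrict \<phi> (\<Union>\<tau>)"]) auto
    qed
  qed (rule pr_nonneg)
  also have "\<dots> \<le> (\<Sum>\<tau>\<in>Q. \<Sum>\<phi>\<in>(\<Union>\<psi>\<in>\<Union>\<tau> \<rightarrow>\<^sub>E U. {\<phi>\<in>?\<Omega>. \<forall>v\<in>\<Union>\<tau>. \<phi> v = \<psi> v}). pr \<phi>)"
    by (rule sum_UN_le[OF fQ])
       (auto simp: pr_nonneg intro: finite_subset[OF _ f\<Omega>])
  also have "\<dots> \<le> (\<Sum>\<tau>\<in>Q. \<Sum>\<psi>\<in>\<Union>\<tau> \<rightarrow>\<^sub>E U. mass (\<Union>\<tau>) \<psi>)"
  proof (rule sum_mono)
    fix \<tau> assume "\<tau> \<in> Q"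
    then have "finite (\<Union>\<tau>)" using edge_sub fin_V by (auto simp: Q_def intro: finite_subset[of _ V])
    then have "finite (\<Union>\<tau> \<rightarrow>\<^sub>E U)" using fU by (intro finite_PiE) auto
    then show "(\<Sum>\<phi>\<in>(\<Union>\<psi>\<in>\<Union>\<tau> \<rightarrow>\<^sub>E U. {\<phi>\<in>?\<Omega>. \<forall>v\<in>\<Union>\<tau>. \<phi> v = \<psi> v}). pr \<phi>) \<le> (\<Sum>\<psi>\<in>\<Union>\<tau> \<rightarrow>\<^sub>E U. mass (\<Union>\<tau>) \<psi>)"
      unfolding mass_def V_eq[symmetric]
      by (rule sum_UN_le) (auto simp: pr_nonneg intro: finite_subset[OF _ f\<Omega>])
  qed
  also have "\<dots> \<le> (\<Sum>\<tau>\<in>Q. (2 * real E) ^ card V * B)"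
  proof (rule sum_mono)
    fix \<tau> assume t: "\<tau> \<in> Q"
    then have \<tau>: "\<tau> \<subseteq> edges F" "card \<tau> = j" by (auto simp: Q_def)
    have UV: "\<Union>\<tau> \<subseteq> V" using \<tau> edge_sub by blast
    have fUt: "finite (\<Union>\<tau>)" using UV fin_V finite_subset by blast
    have jE: "j \<le> E" using card_mono[OF fin_E \<tau>(1)] \<tau> by simp
    have "(\<Sum>\<psi>\<in>\<Union>\<tau> \<rightarrow>\<^sub>E U. mass (\<Union>\<tau>) \<psi>) \<le> (\<Sum>\<psi>\<in>\<Union>\<tau> \<rightarrow>\<^sub>E U. B)"
    proof (rule sum_mono)
      fix \<psi> assume p: "\<psi> \<in> \<Union>\<tau> \<rightarrow>\<^sub>E U"
      show "mass (\<Union>\<tau>) \<psi> \<le> B" unfolding B_def \<tau>(2)[symmetric]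
      proof (rule mass_bound[OF \<tau>(1)])
        show "\<tau> \<noteq> {}" using \<tau> j1 by auto
        show "\<psi> v < n" if "v \<in> \<Union>\<tau>" for v using PiE_mem[OF p that] Un by auto
      qed
    qed
    also have "\<dots> = real (card U) ^ card (\<Union>\<tau>) * B" using fUt by (simp add: card_PiE)
    also have "\<dots> \<le> (2 * real E) ^ card V * B"
    proof (rule mult_right_mono[OF _ B0])
      have "real (card U) \<le> 2 * real E" using cU jE by simp
      then have "real (card U) ^ card (\<Union>\<tau>) \<le> (2 * real E) ^ card (\<Union>\<tau>)" by (intro power_mono) auto
      also have "\<dots> \<le> (2 * real E) ^ card V"
        using two_edges card_mono[OF fin_V UV] by (intro power_increasing) auto
      finally show "real (card U) ^ card (\<Union>\<tau>) \<le> (2 * real E) ^ card V" .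
    qed
    finally show "(\<Sum>\<psi>\<in>\<Union>\<tau> \<rightarrow>\<^sub>E U. mass (\<Union>\<tau>) \<psi>) \<le> (2 * real E) ^ card V * B" .
  qed
  also have "\<dots> = real (card Q) * ((2 * real E) ^ card V * B)" by simp
  also have "\<dots> \<le> 2 ^ E * ((2 * real E) ^ card V * B)"
  proof (rule mult_right_mono)
    have "card Q \<le> card (Pow (edges F))" by (rule card_mono) (use fin_E in \<open>auto simp: Q_def\<close>)
    then show "real (card Q) \<le> 2 ^ E" using fin_E by (simp add: card_Pow)
  qed (use B0 in auto)
  also have "\<dots> = spread_const / 4 * (P ^ (j - 1) / m ^ j)" by (simp add: spread_const_def B_def)
  also have "\<dots> \<le> spread_const / 4 * (real (nat \<lceil>P\<rceil>) ^ (j - 1) / m ^ j)"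
  proof -
    have "P \<le> real (nat \<lceil>P\<rceil>)" by linarith
    then have "P ^ (j - 1) \<le> real (nat \<lceil>P\<rceil>) ^ (j - 1)" by (intro power_mono) auto
    then show ?thesis using spread_const_ge_1 m_pos by (intro mult_left_mono divide_right_mono) auto
  qed
  finally show "wdeg G weight \<sigma> \<le> spread_const * real (nat \<lceil>P\<rceil>) ^ (card \<sigma> - 1) / real (card G) ^ card \<sigma>"
    by (simp add: j_def m_def)
qed

end

section \<open>Containers for graphs without copies of the forbidden graph\<close>

definition avoids :: "'v set set \<Rightarrow> 'v set \<Rightarrow> bool" where
  "avoids \<K> I \<longleftrightarrow> (\<forall>X\<in>\<K>. \<not> X \<subseteq> I)"

text \<open>
  Containers inside containers: as long as a container has at least \<open>l\<close> elements it is covered again, so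
  after \<open>i\<close> rounds sizes have dropped by \<open>\<gamma> ^ i\<close> while counts have multiplied.
\<close>

lemma iterated_containers:
  fixes U :: "'v set"
  assumes U: "finite U" and M: "M \<ge> 1" and \<gamma>: "0 \<le> \<gamma>"
    and step: "\<And>G. G \<subseteq> U \<Longrightarrow> l \<le> real (card G) \<Longrightarrow> covered G M (\<gamma> * real (card G)) Q"
  shows "G \<subseteq> U \<Longrightarrow> covered G (M ^ i) (max l (\<gamma> ^ i * real (card G))) Q"
proof (induction i arbitrary: G)
  case 0
  show ?case unfolding covered_def by (rule exI[of _ "{G}"]) auto
next
  case (Suc i)
  show ?case
  proof (cases "l \<le> real (card G)")
    case False
    then show ?thesis unfolding covered_def using M by (intro exI[of _ "{G}"]) auto
  next
    case True
    obtain \<C> where C: "finite \<C>" "card \<C> \<le> M" "\<And>C. C \<in> \<C> \<Longrightarrow> C \<subseteq> G \<and> real (card C) \<le> \<gamma> * real (card G)"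
      "\<And>I. I \<subseteq> G \<Longrightarrow> Q I \<Longrightarrow> \<exists>C\<in>\<C>. I \<subseteq> C"
      using step[OF Suc.prems True] unfolding covered_def by metis
    have "covered C (M ^ i) (max l (\<gamma> ^ Suc i * real (card G))) Q" if "C \<in> \<C>" for C
    proof (rule covered_mono[OF Suc.IH[of C]])
      show "C \<subseteq> U" using C(3)[OF that] Suc.prems by auto
      have "\<gamma> ^ i * real (card C) \<le> \<gamma> ^ i * (\<gamma> * real (card G))"
        using C(3)[OF that] \<gamma> by (intro mult_left_mono) auto
      then show "max l (\<gamma> ^ i * real (card C)) \<le> max l (\<gamma> ^ Suc i * real (card G))"
        by (simp add: mult_ac)
    qed auto
    then obtain DD where D: "\<And>C. C \<in> \<C> \<Longrightarrow> finite (DD C) \<and> card (DD C) \<le> M ^ i \<and>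
        (\<forall>D\<in>DD C. D \<subseteq> C \<and> real (card D) \<le> max l (\<gamma> ^ Suc i * real (card G))) \<and>
        (\<forall>I\<subseteq>C. Q I \<longrightarrow> (\<exists>D\<in>DD C. I \<subseteq> D))"
      unfolding covered_def by metis
    have "card (\<Union>C\<in>\<C>. DD C) \<le> (\<Sum>C\<in>\<C>. card (DD C))" by (rule card_UN_le[OF C(1)])
    also have "\<dots> \<le> (\<Sum>C\<in>\<C>. M ^ i)" by (rule sum_mono) (use D in auto)
    also have "\<dots> \<le> M ^ Suc i" using C(2) by simp
    finally have c: "card (\<Union>C\<in>\<C>. DD C) \<le> M ^ Suc i" .
    show ?thesis unfolding covered_def
    proof (intro exI[of _ "\<Union>C\<in>\<C>. DD C"] conjI ballI allI impI c)
      show "finite (\<Union>C\<in>\<C>. DD C)" using C D by auto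
      fix X assume "X \<in> (\<Union>C\<in>\<C>. DD C)"
      then obtain C where X: "C \<in> \<C>" "X \<in> DD C" by auto
      show "X \<subseteq> G" using D[OF X(1)] X(2) C(3)[OF X(1)] by blast
      show "real (card X) \<le> max l (\<gamma> ^ Suc i * real (card G))" using D[OF X(1)] X(2) by blast
    next
      fix I assume "I \<subseteq> G" "Q I"
      then show "\<exists>X\<in>\<Union>C\<in>\<C>. DD C. I \<subseteq> X" using C(4) D by (metis UN_I)
    qed
  qed
qed

lemma finite_all_edges: "finite (all_edges n)"
  by (rule finite_subset[of _ "Pow {..<n}"]) (auto simp: all_edges_def)

lemma card_all_edges: "card (all_edges n) = n choose 2"
  unfolding all_edges_def using n_subsets[of "{..<n}" 2] by simp

lemma card_all_edges_real: "real (card (all_edges n)) = real n * (real n - 1) / 2"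
proof -
  have "even (n * (n - 1))" by (cases n) auto
  then have "real (n * (n - 1) div 2) = real (n * (n - 1)) / 2" by (simp add: real_of_nat_div)
  then show ?thesis by (cases n) (simp_all add: card_all_edges choose_two ring_distribs)
qed

context forbidden_graph begin

text \<open>
  The fingerprint length \<open>\<lceil>P\<rceil>\<close> is the same for all host graphs, because the codegree bound
  is normalised by the number of edges of the host.
\<close>

lemma one_step_containers:
  defines "A \<equiv> (2::real) ^ (E + 3)"
  assumes G: "G \<subseteq> all_edges n" and n: "n \<ge> 1"
    and dense: "real n powr (2 - 1 / (real E)\<^sup>2) \<le> real (card G)"
    and large: "(4 * (real (card V))\<^sup>2 * (2 * real (card V)) ^ card V)\<^sup>2 \<le> real n"
  shows "covered G ((n\<^sup>2) ^ (E * nat \<lceil>real n powr (2 - 1 / m2)\<rceil>))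
     ((1 - 1 / (4 * (A * spread_const) ^ (2 ^ E))) * real (card G)) (avoids (embedded_copies F n))"
proof -
  have "0 < real n powr (2 - 1 / (real E)\<^sup>2)" using n by simp
  then have ne: "G \<noteq> {}" using dense by auto
  interpret forbidden_in_host F S T apex n G
    by unfold_locales (use G ne dense large in auto)
  have "1 \<le> nat \<lceil>P\<rceil>" using n by (simp add: Suc_le_eq)
  then have "covered G ((card G + 1) ^ (E * nat \<lceil>P\<rceil>)) (real (card G) * (1 - 1 / (4 * (A * spread_const) ^ (2 ^ E)))) (independent weight)"
    using container_lemma[OF finite_G G_ne, of "nat \<lceil>P\<rceil>" spread_const E A weight]
      spread_const_ge_1 weight_uniform weight_codegree weight_total by (simp add: A_def)
  then show ?thesis
  proof (rule covered_mono)
    have "real (card G) \<le> real n * (real n - 1) / 2"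
      using card_mono[OF finite_all_edges G] unfolding card_all_edges_real[symmetric] by simp
    also have "\<dots> \<le> real n * real n - 1"
    proof -
      have "0 \<le> (real n - 1) * (real n + 2)" using n by simp
      then show ?thesis by (simp add: field_simps)
    qed
    finally have "real (card G + 1) \<le> real (n\<^sup>2)" by (simp add: power2_eq_square)
    then have "card G + 1 \<le> n\<^sup>2" by (simp only: of_nat_le_iff)
    then show "(card G + 1) ^ (E * nat \<lceil>P\<rceil>) \<le> (n\<^sup>2) ^ (E * nat \<lceil>P\<rceil>)" by (rule power_mono) simp
    show "independent weight I" if "avoids (embedded_copies F n) I" for I
      using that weight_copy by (auto simp: avoids_def independent_def)
  qed (simp add: mult.commute)
qed

text \<open>
  About \<open>ln n / \<delta>\<close> rounds reduce the number of edges by a factor \<open>n\<close>, which is more than enough; each round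
  multiplies the number of containers by \<open>exp (O(P ln n))\<close>.
\<close>

lemma containers:
  obtains c :: real and n0 where "c > 0"
    "\<And>n. n \<ge> n0 \<Longrightarrow> \<exists>\<C>. finite \<C> \<and>
       real (card \<C>) \<le> exp (c * real n powr (2 - 1 / m2) * (ln (real n))\<^sup>2) \<and>
       (\<forall>C\<in>\<C>. C \<subseteq> all_edges n \<and> real (card C) \<le> real n powr (2 - 1 / (real E)\<^sup>2)) \<and>
       (\<forall>I\<subseteq>all_edges n. avoids (embedded_copies F n) I \<longrightarrow> (\<exists>C\<in>\<C>. I \<subseteq> C))"
proof -
  define A where "A = (2::real) ^ (E + 3)"
  define \<delta> where "\<delta> = 1 / (4 * (A * spread_const) ^ (2 ^ E))"
  define c where "c = 8 * real E / \<delta>"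
  have "A \<ge> 1" unfolding A_def by (rule one_le_power) simp
  then have "A * spread_const \<ge> 1" using spread_const_ge_1 mult_mono[of 1 A 1 spread_const] by simp
  then have "(A * spread_const) ^ (2 ^ E) \<ge> 1" by (rule one_le_power)
  then have \<delta>: "0 < \<delta>" "\<delta> \<le> 1" by (auto simp: \<delta>_def divide_simps)
  have c0: "c > 0" using \<delta> two_edges by (simp add: c_def)
  \<comment> \<open>The summand 3 gives \<open>ln n \<ge> 1\<close>.\<close>
  define n0 where "n0 = nat \<lceil>(4 * (real (card V))\<^sup>2 * (2 * real (card V)) ^ card V)\<^sup>2\<rceil> + 3"
  show thesis
  proof (rule that[OF c0, of n0])
    fix n assume n: "n \<ge> n0"
    have large: "(4 * (real (card V))\<^sup>2 * (2 * real (card V)) ^ card V)\<^sup>2 \<le> real n"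
      using n unfolding n0_def by linarith
    have n3: "n \<ge> 3" using n by (simp add: n0_def)
    have ln1: "ln (real n) \<ge> 1"
    proof -
      have "exp 1 \<le> real n" using exp_le n3 by linarith
      then show ?thesis using n3 by (simp add: ln_ge_iff)
    qed
    define P where "P = real n powr (2 - 1 / m2)"
    define l where "l = real n powr (2 - 1 / (real E)\<^sup>2)"
    define b where "b = nat \<lceil>P\<rceil>"
    define i where "i = nat \<lceil>ln (real n) / \<delta>\<rceil>"
    have P1: "P \<ge> 1" unfolding P_def
      by (rule ge_one_powr_ge_zero) (use n3 m2_ge1 in \<open>auto simp: divide_simps\<close>)
    have b2: "real b \<le> 2 * P" using P1 unfolding b_def by linarith
    have li: "ln (real n) / \<delta> \<ge> 1" using ln1 \<delta> by (simp add: divide_simps)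
    then have i2: "real i \<le> 2 * (ln (real n) / \<delta>)" unfolding i_def by linarith
    have i1: "real i \<ge> ln (real n) / \<delta>" unfolding i_def by linarith
    define M where "M = (n\<^sup>2) ^ (E * b)"
    have M1: "M \<ge> 1" using n3 by (simp add: M_def)
    have "covered (all_edges n) (M ^ i) (max l ((1 - \<delta>) ^ i * real (card (all_edges n)))) (avoids (embedded_copies F n))"
    proof (rule iterated_containers[OF finite_all_edges M1])
      fix G assume G: "G \<subseteq> all_edges n" "l \<le> real (card G)"
      show "covered G M ((1 - \<delta>) * real (card G)) (avoids (embedded_copies F n))"
        unfolding M_def b_def P_def \<delta>_def A_def
        by (rule one_step_containers) (use G n3 large in \<open>auto simp: l_def\<close>)
    qed (use \<delta> in auto)
    moreover have "max l ((1 - \<delta>) ^ i * real (card (all_edges n))) \<le> l"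
    proof -
      have "(1 - \<delta>) ^ i \<le> exp (- \<delta>) ^ i" using \<delta> exp_ge_add_one_self[of "- \<delta>"] by (intro power_mono) auto
      also have "\<dots> = exp (- (\<delta> * real i))" by (simp add: exp_of_nat_mult[symmetric] mult.commute)
      also have "\<dots> \<le> exp (- ln (real n))" using i1 \<delta> by (simp add: field_simps)
      also have "\<dots> = 1 / real n" using n3 by (simp add: exp_minus inverse_eq_divide)
      finally have 1: "(1 - \<delta>) ^ i \<le> 1 / real n" .
      have "real (card (all_edges n)) \<le> real n * real n"
        unfolding card_all_edges_real using n3 by (simp add: mult_left_mono field_simps)
      then have "(1 - \<delta>) ^ i * real (card (all_edges n)) \<le> 1 / real n * (real n * real n)"
        using 1 \<delta> by (intro mult_mono) auto
      also have "\<dots> = real n powr 1" using n3 by simp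
      also have "\<dots> \<le> l" unfolding l_def
      proof (rule powr_mono)
        have "1 \<le> (real E)\<^sup>2" using two_edges by (intro one_le_power) auto
        then show "1 \<le> 2 - 1 / (real E)\<^sup>2" by (simp add: divide_simps)
      qed (use n3 in auto)
      finally show ?thesis by simp
    qed
    ultimately have "covered (all_edges n) (M ^ i) l (avoids (embedded_copies F n))"
      by (elim covered_mono) auto
    then obtain \<C> where C: "finite \<C>" "card \<C> \<le> M ^ i"
      "\<forall>C\<in>\<C>. C \<subseteq> all_edges n \<and> real (card C) \<le> l"
      "\<forall>I\<subseteq>all_edges n. avoids (embedded_copies F n) I \<longrightarrow> (\<exists>C\<in>\<C>. I \<subseteq> C)"
      unfolding covered_def by blast
    have "real (card \<C>) \<le> real (M ^ i)" using C(2) by (rule of_nat_mono)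
    also have "\<dots> = exp (ln (real n)) ^ (2 * (E * b) * i)"
      using n3 by (simp add: M_def power_mult[symmetric])
    also have "\<dots> = exp (2 * real E * real b * real i * ln (real n))"
      by (simp only: exp_of_nat_mult[symmetric]) (simp add: mult_ac)
    also have "\<dots> \<le> exp (c * P * (ln (real n))\<^sup>2)"
    proof -
      have "real b * real i \<le> (2 * P) * (2 * (ln (real n) / \<delta>))"
        using b2 i2 P1 by (intro mult_mono) auto
      then have "(2 * real E * ln (real n)) * (real b * real i) \<le> (2 * real E * ln (real n)) * ((2 * P) * (2 * (ln (real n) / \<delta>)))"
        using ln1 by (intro mult_left_mono) auto
      then show ?thesis by (simp add: c_def power2_eq_square mult_ac)
    qed
    finally show "\<exists>\<C>. finite \<C> \<and>
       real (card \<C>) \<le> exp (c * real n powr (2 - 1 / m2) * (ln (real n))\<^sup>2) \<and>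
       (\<forall>C\<in>\<C>. C \<subseteq> all_edges n \<and> real (card C) \<le> real n powr (2 - 1 / (real E)\<^sup>2)) \<and>
       (\<forall>I\<subseteq>all_edges n. avoids (embedded_copies F n) I \<longrightarrow> (\<exists>C\<in>\<C>. I \<subseteq> C))"
      using C by (auto simp: P_def l_def)
  qed
qed

end

section \<open>Tail bounds for binomial random sets\<close>

abbreviation bern_set :: "'v set \<Rightarrow> real \<Rightarrow> ('v \<Rightarrow> bool) pmf" where
  "bern_set U p \<equiv> Pi_pmf U False (\<lambda>_. bernoulli_pmf p)"

lemma pmf_markov:
  fixes f :: "'v \<Rightarrow> real"
  assumes "finite (set_pmf M)" "\<And>x. 0 \<le> f x" "c > 0"
  shows "measure_pmf.prob M {x. c \<le> f x} \<le> measure_pmf.expectation M f / c"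
proof -
  have "measure (measure_pmf M) {x\<in>space (measure_pmf M). c \<le> f x} \<le> (\<integral>x. f x \<partial>measure_pmf M) / c"
    by (rule integral_Markov_inequality_measure[where A = "{}"])
       (use assms in \<open>auto intro: integrable_measure_pmf_finite\<close>)
  then show ?thesis by simp
qed

lemma finite_set_bern: "finite U \<Longrightarrow> finite (set_pmf (bern_set U p))"
  by (simp add: set_Pi_pmf finite_PiE_dflt)

text \<open>
  All tail bounds below are Markov's inequality for this exponential moment, with base \<open>exp 1\<close> or
  \<open>exp (-1)\<close>.
\<close>

lemma bern_set_moment:
  assumes U: "finite U" "C \<subseteq> U" and p: "0 \<le> p" "p \<le> 1" and s: "s > 0"
  shows "measure_pmf.expectation (bern_set U p) (\<lambda>X. s ^ card {e\<in>C. X e}) = (1 + p * (s - 1)) ^ card C"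
proof -
  define f where "f e y = (if e \<in> C \<and> y then s else 1)" for e and y :: bool
  have "s ^ card {e\<in>C. X e} = (\<Prod>e\<in>U. f e (X e))" for X
  proof -
    have "(\<Prod>e\<in>U. f e (X e)) = (\<Prod>e\<in>{e\<in>C. X e}. s)"
      by (rule prod.mono_neutral_cong_right) (use U in \<open>auto simp: f_def\<close>)
    then show ?thesis by simp
  qed
  then have "measure_pmf.expectation (bern_set U p) (\<lambda>X. s ^ card {e\<in>C. X e})
     = (\<Prod>e\<in>U. measure_pmf.expectation (bernoulli_pmf p) (f e))"
    by (simp, subst expectation_prod_Pi_pmf)
       (use U s in \<open>auto simp: f_def intro: integrable_measure_pmf_finite\<close>)
  also have "\<dots> = (\<Prod>e\<in>C. 1 + p * (s - 1))"
    by (rule prod.mono_neutral_cong_right) (use U p in \<open>auto simp: f_def algebra_simps\<close>)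
  finally show ?thesis by simp
qed

lemma bern_set_contains:
  assumes U: "finite U" "C \<subseteq> U" and p: "0 \<le> p" "p \<le> 1"
  shows "measure_pmf.prob (bern_set U p) {X. \<forall>e\<in>C. X e} = p ^ card C"
proof -
  define B where "B e = (if e \<in> C then {True} else UNIV)" for e
  have "{X. \<forall>e\<in>C. X e} = Pi U B" using U by (auto simp: B_def Pi_def)
  then have "measure_pmf.prob (bern_set U p) {X. \<forall>e\<in>C. X e} = (\<Prod>e\<in>U. measure_pmf.prob (bernoulli_pmf p) (B e))"
    by (simp add: measure_Pi_pmf_Pi[OF U(1)])
  also have "\<dots> = (\<Prod>e\<in>C. p)"
    by (rule prod.mono_neutral_cong_right) (use U p in \<open>auto simp: B_def measure_pmf_single\<close>)
  finally show ?thesis by simp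
qed

lemma bern_set_upper_tail:
  assumes U: "finite U" "C \<subseteq> U" and p: "0 \<le> p" "p \<le> 1"
  shows "measure_pmf.prob (bern_set U p) {X. t \<le> real (card {e\<in>C. X e})} \<le> exp (2 * p * real (card C) - t)"
proof -
  have e3: "exp 1 - 1 \<le> (2::real)" using exp_le by simp
  have "measure_pmf.prob (bern_set U p) {X. t \<le> real (card {e\<in>C. X e})}
     = measure_pmf.prob (bern_set U p) {X. exp t \<le> exp 1 ^ card {e\<in>C. X e}}"
    by (simp add: exp_of_nat_mult[symmetric])
  also have "\<dots> \<le> measure_pmf.expectation (bern_set U p) (\<lambda>X. exp 1 ^ card {e\<in>C. X e}) / exp t"
    by (rule pmf_markov) (use finite_set_bern U in auto)
  also have "\<dots> = (1 + p * (exp 1 - 1)) ^ card C / exp t"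
    by (subst bern_set_moment[OF U p]) auto
  also have "\<dots> \<le> exp (p * 2) ^ card C / exp t"
  proof (intro divide_right_mono power_mono)
    have "1 + p * (exp 1 - 1) \<le> 1 + p * 2" using e3 p by (intro add_left_mono mult_left_mono) auto
    also have "\<dots> \<le> exp (p * 2)" by (rule exp_ge_add_one_self)
    finally show "1 + p * (exp 1 - 1) \<le> exp (p * 2)" .
    show "0 \<le> 1 + p * (exp 1 - 1)" using p by simp
  qed simp
  also have "\<dots> = exp (2 * p * real (card C) - t)"
    by (simp add: exp_of_nat_mult[symmetric] exp_diff mult_ac)
  finally show ?thesis .
qed

lemma bern_set_lower_tail:
  assumes U: "finite U" and p: "0 \<le> p" "p \<le> 1"
  shows "measure_pmf.prob (bern_set U p) {X. real (card {e\<in>U. X e}) \<le> t} \<le> exp (t - p * real (card U) / 2)"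
proof -
  have e2: "exp (- 1) - 1 \<le> - (1 / 2 :: real)"
    using exp_ge_add_one_self[of "1::real"] by (simp add: exp_minus inverse_eq_divide divide_simps)
  have "measure_pmf.prob (bern_set U p) {X. real (card {e\<in>U. X e}) \<le> t}
     = measure_pmf.prob (bern_set U p) {X. exp (- t) \<le> exp (- 1) ^ card {e\<in>U. X e}}"
    by (simp add: exp_of_nat_mult[symmetric])
  also have "\<dots> \<le> measure_pmf.expectation (bern_set U p) (\<lambda>X. exp (- 1) ^ card {e\<in>U. X e}) / exp (- t)"
    by (rule pmf_markov) (use finite_set_bern U in auto)
  also have "\<dots> = (1 + p * (exp (- 1) - 1)) ^ card U / exp (- t)"
    by (subst bern_set_moment[OF U _ p]) auto
  also have "\<dots> \<le> exp (- (p / 2)) ^ card U / exp (- t)"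
  proof (intro divide_right_mono power_mono)
    have "1 + p * (exp (- 1) - 1) \<le> 1 + p * (- (1 / 2))" using e2 p by (intro add_left_mono mult_left_mono) auto
    also have "\<dots> \<le> exp (- (p / 2))" using exp_ge_add_one_self[of "- (p / 2)"] by simp
    finally show "1 + p * (exp (- 1) - 1) \<le> exp (- (p / 2))" .
    have "p * (1 - exp (- 1)) \<le> 1 * 1" using p by (intro mult_mono) auto
    then show "0 \<le> 1 + p * (exp (- 1) - 1)" by (simp add: algebra_simps)
  qed simp
  also have "\<dots> = exp (t - p * real (card U) / 2)"
    by (simp add: exp_of_nat_mult[symmetric] exp_diff[symmetric] mult_ac)
  finally show ?thesis .
qed

section \<open>Freeness, embedded copies and the extremal number\<close>

lemma prob_random_graph:
  "measure_pmf.prob (random_graph n p) {G. Q G}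
    = measure_pmf.prob (bern_set (all_edges n) p) {X. Q (Graph {..<n} {e \<in> all_edges n. X e})}"
  by (simp add: random_graph_def vimage_def)

lemma finite_extremal_set:
  assumes "finite (edges G)"
  shows "finite {num_edges H | H. subgraph H G \<and> graph_free F H}"
proof (rule finite_subset[of _ "{..card (edges G)}"])
  show "{num_edges H | H. subgraph H G \<and> graph_free F H} \<subseteq> {..card (edges G)}"
    using assms by (auto simp: subgraph_def intro: card_mono)
qed simp

lemma ex_number_ge:
  assumes "finite (edges G)" "subgraph H G" "graph_free F H"
  shows "num_edges H \<le> ex_number G F"
  unfolding ex_number_def by (rule Max_ge[OF finite_extremal_set[OF assms(1)]]) (use assms in auto)

lemma ex_number_le:
  assumes "finite (edges G)" "verts F \<noteq> {}"
    and "\<And>H. subgraph H G \<Longrightarrow> graph_free F H \<Longrightarrow> real (num_edges H) \<le> k"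
  shows "real (ex_number G F) \<le> k"
proof -
  have "graph_free F (Graph {} {} :: 'a ugraph)"
    using assms(2) by (auto simp: graph_free_def subgraph_def graph_iso_def bij_betw_def)
  moreover have "subgraph (Graph {} {}) G" by (simp add: subgraph_def simple_graph_def)
  ultimately have "{num_edges H | H. subgraph H G \<and> graph_free F H} \<noteq> {}" by blast
  then have "ex_number G F \<in> {num_edges H | H. subgraph H G \<and> graph_free F H}"
    unfolding ex_number_def by (intro Max_in finite_extremal_set assms)
  then show ?thesis using assms(3) by auto
qed

lemma embedded_copies_props:
  assumes F: "simple_graph F" and X: "X \<in> embedded_copies F n"
  shows "X \<subseteq> all_edges n" "card X = num_edges F"
proof -
  obtain \<phi> where p: "\<phi> \<in> verts F \<rightarrow>\<^sub>E {..<n}" "inj_on \<phi> (verts F)" "X = (`) \<phi> ` edges F"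
    using X by (auto simp: embedded_copies_def)
  show "card X = num_edges F" unfolding p(3) by (rule card_image[OF inj_image_edges[OF F p(2)]])
  show "X \<subseteq> all_edges n"
  proof
    fix e assume "e \<in> X"
    then obtain d where d: "d \<in> edges F" "e = \<phi> ` d" using p by auto
    have dV: "d \<subseteq> verts F" "card d = 2" using d F by (auto simp: simple_graph_def)
    have "card e = 2" using d dV card_image[OF inj_on_subset[OF p(2) dV(1)]] by simp
    moreover have "e \<subseteq> {..<n}" using d(2) dV(1) PiE_mem[OF p(1)] by blast
    ultimately show "e \<in> all_edges n" by (simp add: all_edges_def)
  qed
qed

lemma card_embedded_copies:
  assumes "simple_graph F"
  shows "finite (embedded_copies F n)" "card (embedded_copies F n) \<le> n ^ num_verts F"
proof -
  have f: "finite (verts F)" using assms by (simp add: simple_graph_def)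
  let ?\<Omega> = "verts F \<rightarrow>\<^sub>E {..<n}"
  have f\<Omega>: "finite ?\<Omega>" using f by (intro finite_PiE) auto
  have sub: "embedded_copies F n \<subseteq> (\<lambda>\<phi>. (`) \<phi> ` edges F) ` ?\<Omega>"
    unfolding embedded_copies_def by blast
  show "finite (embedded_copies F n)" by (rule finite_subset[OF sub finite_imageI[OF f\<Omega>]])
  have "card (embedded_copies F n) \<le> card ((\<lambda>\<phi>. (`) \<phi> ` edges F) ` ?\<Omega>)"
    by (rule card_mono[OF finite_imageI[OF f\<Omega>] sub])
  also have "\<dots> \<le> card ?\<Omega>" by (rule card_image_le[OF f\<Omega>])
  also have "\<dots> = n ^ num_verts F" using f by (simp add: card_PiE)
  finally show "card (embedded_copies F n) \<le> n ^ num_verts F" .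
qed

text \<open>
  A copy of the edges of \<open>F\<close> in \<open>H\<close> may have its isolated vertices placed outside of \<open>H\<close>. They can be moved
  into \<open>H\<close> if it has enough vertices.
\<close>

lemma free_avoids_copies:
  fixes F :: "'a ugraph" and H :: "nat ugraph"
  assumes F: "simple_graph F" and H: "simple_graph H"
    and free: "graph_free F H" and c: "num_verts F \<le> num_verts H"
  shows "avoids (embedded_copies F n) (edges H)"
  unfolding avoids_def
proof (intro ballI notI)
  fix X assume X: "X \<in> embedded_copies F n" and XH: "X \<subseteq> edges H"
  obtain \<phi> where p: "inj_on \<phi> (verts F)" "X = (`) \<phi> ` edges F"
    using X by (auto simp: embedded_copies_def)
  define V0 where "V0 = \<Union>(edges F)"
  have fV: "finite (verts F)" using F by (simp add: simple_graph_def)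
  have fW: "finite (verts H)" using H by (simp add: simple_graph_def)
  have V0: "V0 \<subseteq> verts F" using F by (auto simp: V0_def simple_graph_def)
  have im: "\<phi> ` V0 \<subseteq> verts H"
    using XH H unfolding p(2) V0_def simple_graph_def by blast
  have inj0: "inj_on \<phi> V0" using p(1) V0 by (rule inj_on_subset)
  have f0: "finite V0" using V0 fV finite_subset by blast
  have "card (verts F - V0) \<le> card (verts H - \<phi> ` V0)"
    using c f0 V0 im by (simp add: card_Diff_subset card_image[OF inj0])
  then obtain g where g: "g ` (verts F - V0) \<subseteq> verts H - \<phi> ` V0" "inj_on g (verts F - V0)"
    using card_le_inj[of "verts F - V0" "verts H - \<phi> ` V0"] fV fW by auto
  define \<psi> where "\<psi> v = (if v \<in> V0 then \<phi> v else g v)" for v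
  have inj: "inj_on \<psi> (verts F)"
  proof (rule inj_onI)
    fix x y assume xy: "x \<in> verts F" "y \<in> verts F" "\<psi> x = \<psi> y"
    consider "x \<in> V0" "y \<in> V0" | "x \<in> V0" "y \<notin> V0" | "x \<notin> V0" "y \<in> V0" | "x \<notin> V0" "y \<notin> V0" by blast
    then show "x = y"
    proof cases
      case 1 then show ?thesis using xy inj0 by (auto simp: \<psi>_def dest: inj_onD)
    next
      case 2
      then have "g y \<in> verts H - \<phi> ` V0" "\<phi> x \<in> \<phi> ` V0" using g xy by blast+
      then have "\<phi> x \<noteq> g y" by (metis DiffD2)
      then show ?thesis using 2 xy by (simp add: \<psi>_def)
    next
      case 3
      then have "g x \<in> verts H - \<phi> ` V0" "\<phi> y \<in> \<phi> ` V0" using g xy by blast+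
      then have "g x \<noteq> \<phi> y" by (metis DiffD2)
      then show ?thesis using 3 xy by (simp add: \<psi>_def)
    next
      case 4 then show ?thesis using xy g(2) by (auto simp: \<psi>_def dest: inj_onD)
    qed
  qed
  have imV: "\<psi> ` verts F \<subseteq> verts H" using g im by (auto simp: \<psi>_def)
  have eqX: "X = (`) \<psi> ` edges F"
    unfolding p(2) by (rule image_cong[OF refl], rule image_cong[OF refl]) (auto simp: \<psi>_def V0_def)
  have "subgraph (Graph (\<psi> ` verts F) X) H"
    unfolding subgraph_def simple_graph_def ugraph.sel
  proof (intro conjI imV XH subsetI)
    show "finite (\<psi> ` verts F)" using fV by simp
    fix e assume e: "e \<in> X"
    then have "e \<subseteq> \<psi> ` verts F" unfolding eqX using F by (auto simp: simple_graph_def)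
    moreover have "card e = 2" using e XH H by (auto simp: simple_graph_def)
    ultimately show "e \<in> {e. e \<subseteq> \<psi> ` verts F \<and> card e = 2}" by simp
  qed
  moreover have "graph_iso F (Graph (\<psi> ` verts F) X)"
    unfolding graph_iso_def using inj eqX by (auto simp: bij_betw_def intro!: exI[of _ \<psi>])
  ultimately show False using free by (auto simp: graph_free_def)
qed

lemma avoids_copies_free:
  fixes F F' :: "'a ugraph"
  assumes F': "subgraph F' F" and I: "avoids (embedded_copies F' n) I"
  shows "graph_free F (Graph {..<n} I)"
  unfolding graph_free_def
proof
  assume "\<exists>H. subgraph H (Graph {..<n} I) \<and> graph_iso F H"
  then obtain H f where H: "subgraph H (Graph {..<n} I)" "bij_betw f (verts F) (verts H)"
    "edges H = (`) f ` edges F" by (auto simp: graph_iso_def)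
  define \<phi> where "\<phi> = restrict f (verts F')"
  have sub: "verts F' \<subseteq> verts F" "edges F' \<subseteq> edges F" "simple_graph F'" using F' by (auto simp: subgraph_def)
  have "\<phi> \<in> verts F' \<rightarrow>\<^sub>E {..<n}"
  proof -
    have "f ` verts F \<subseteq> {..<n}" using H by (auto simp: bij_betw_def subgraph_def)
    then show ?thesis using sub(1) by (auto simp: \<phi>_def)
  qed
  moreover have "inj_on f (verts F')" using H(2) sub(1) by (auto simp: bij_betw_def intro: inj_on_subset)
  then have "inj_on \<phi> (verts F')" by (auto simp: \<phi>_def inj_on_def)
  ultimately have "(`) \<phi> ` edges F' \<in> embedded_copies F' n" by (auto simp: embedded_copies_def)
  moreover have "(`) \<phi> ` edges F' = (`) f ` edges F'"
    by (rule image_cong[OF refl], rule image_cong[OF refl]) (use sub(3) in \<open>auto simp: \<phi>_def simple_graph_def\<close>)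
  moreover have "(`) f ` edges F' \<subseteq> I"
  proof -
    have "(`) f ` edges F \<subseteq> I" using H by (simp add: subgraph_def)
    then show ?thesis using sub(2) by blast
  qed
  ultimately show False using I by (auto simp: avoids_def)
qed

section \<open>The two bounds\<close>

text \<open>
  The deletion method: keep every element with probability \<open>q\<close>, then remove one element of each surviving
  member of \<open>\<K>\<close>. The expected number of elements left is at least \<open>q * card R - q ^ k * card \<K>\<close>.
\<close>

lemma random_deletion:
  assumes R: "finite R" and K: "finite \<K>" "\<And>X. X \<in> \<K> \<Longrightarrow> X \<subseteq> R \<and> card X = k" and k: "k \<ge> 1"
    and q: "0 \<le> q" "q \<le> 1"
  obtains I where "I \<subseteq> R" "avoids \<K> I" "q * real (card R) - q ^ k * real (card \<K>) \<le> real (card I)"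
proof -
  define f :: "('a \<Rightarrow> bool) \<Rightarrow> real" where "f Y = (\<Sum>e\<in>R. indicator {Y. \<forall>d\<in>{e}. Y d} Y) - (\<Sum>X\<in>\<K>. indicator {Y. \<forall>d\<in>X. Y d} Y)"
    for Y :: "'a \<Rightarrow> bool"
  let ?M = "bern_set R q"
  have fin: "finite (set_pmf ?M)" by (rule finite_set_bern[OF R])
  have int: "integrable (measure_pmf ?M) g" for g :: "_ \<Rightarrow> real"
    by (rule integrable_measure_pmf_finite[OF fin])
  have "measure_pmf.expectation ?M f
     = (\<Sum>e\<in>R. measure_pmf.prob ?M {Y. \<forall>d\<in>{e}. Y d}) - (\<Sum>X\<in>\<K>. measure_pmf.prob ?M {Y. \<forall>d\<in>X. Y d})"
    unfolding f_def by (subst Bochner_Integration.integral_diff[OF int int])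
      (simp add: Bochner_Integration.integral_sum[OF int])
  also have "(\<Sum>e\<in>R. measure_pmf.prob ?M {Y. \<forall>d\<in>{e}. Y d}) = (\<Sum>e\<in>R. q)"
    by (rule sum.cong[OF refl], subst bern_set_contains) (use R q in auto)
  also have "(\<Sum>X\<in>\<K>. measure_pmf.prob ?M {Y. \<forall>d\<in>X. Y d}) = (\<Sum>X\<in>\<K>. q ^ k)"
    by (rule sum.cong[OF refl], subst bern_set_contains) (use R q K in auto)
  finally have ex: "measure_pmf.expectation ?M f = q * real (card R) - q ^ k * real (card \<K>)"
    by (simp add: mult.commute)
  obtain Y where Y: "Y \<in> set_pmf ?M" "measure_pmf.expectation ?M f \<le> f Y"
  proof (rule ccontr)
    assume "\<not> thesis"
    then have "\<And>Y. Y \<in> set_pmf ?M \<Longrightarrow> f Y < measure_pmf.expectation ?M f" using that not_le by blast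
    then have "measure_pmf.expectation ?M f < measure_pmf.expectation ?M f"
      by (intro measure_pmf.expectation_less int) (simp add: AE_measure_pmf_iff)
    then show False by simp
  qed
  define J where "J = {e\<in>R. Y e}"
  define B where "B = {X\<in>\<K>. X \<subseteq> J}"
  have fJ: "finite J" using R by (simp add: J_def)
  have fB: "finite B" using K by (simp add: B_def)
  have "f Y = real (card J) - real (card B)"
  proof -
    have "(\<Sum>e\<in>R. indicator {Y. \<forall>d\<in>{e}. Y d} Y :: real) = (\<Sum>e\<in>J. 1)"
      by (rule sum.mono_neutral_cong_right) (use R in \<open>auto simp: J_def\<close>)
    moreover have "(\<Sum>X\<in>\<K>. indicator {Y. \<forall>d\<in>X. Y d} Y :: real) = (\<Sum>X\<in>B. 1)"
      by (rule sum.mono_neutral_cong_right) (use K in \<open>auto simp: B_def J_def indicator_def\<close>)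
    ultimately show ?thesis by (simp add: f_def)
  qed
  then have JB: "q * real (card R) - q ^ k * real (card \<K>) \<le> real (card J) - real (card B)" using Y ex by simp
  have "\<exists>x. x \<in> X" if "X \<in> B" for X
  proof -
    have "card X \<ge> 1" using that K k by (auto simp: B_def)
    then show ?thesis by (cases "X = {}") auto
  qed
  then obtain x where x: "\<And>X. X \<in> B \<Longrightarrow> x X \<in> X" by metis
  define I where "I = J - x ` B"
  have "I \<subseteq> R" by (auto simp: I_def J_def)
  moreover have "avoids \<K> I"
    unfolding avoids_def
  proof (intro ballI notI)
    fix X assume X: "X \<in> \<K>" "X \<subseteq> I"
    then have "X \<in> B" by (auto simp: B_def I_def)
    then show False using x[of X] X by (auto simp: I_def)
  qed
  moreover have "real (card J) - real (card B) \<le> real (card I)"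
  proof -
    have "card J \<le> card I + card (x ` B)"
      using card_Un_le[of I "x ` B"] card_mono[of "I \<union> x ` B" J] fJ fB by (fastforce simp: I_def)
    moreover have "card (x ` B) \<le> card B" by (rule card_image_le[OF fB])
    ultimately show ?thesis by linarith
  qed
  ultimately show ?thesis using that JB by fastforce
qed

lemma prob_many_members:
  assumes U: "finite U" and K: "finite \<K>" "\<And>X. X \<in> \<K> \<Longrightarrow> X \<subseteq> U \<and> card X = k"
    and p: "0 \<le> p" "p \<le> 1" and t: "t > 0"
  shows "measure_pmf.prob (bern_set U p) {Y. t \<le> real (card {X\<in>\<K>. \<forall>d\<in>X. Y d})} \<le> real (card \<K>) * p ^ k / t"
proof -
  let ?M = "bern_set U p"
  have int: "integrable (measure_pmf ?M) g" for g :: "_ \<Rightarrow> real"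
    by (rule integrable_measure_pmf_finite[OF finite_set_bern[OF U]])
  have eq: "real (card {X\<in>\<K>. \<forall>d\<in>X. Y d}) = (\<Sum>X\<in>\<K>. indicator {Y. \<forall>d\<in>X. Y d} Y)" for Y
  proof -
    have "(\<Sum>X\<in>\<K>. indicator {Y. \<forall>d\<in>X. Y d} Y :: real) = (\<Sum>X\<in>{X\<in>\<K>. \<forall>d\<in>X. Y d}. 1)"
      by (rule sum.mono_neutral_cong_right) (use K in \<open>auto simp: indicator_def\<close>)
    then show ?thesis by simp
  qed
  have "measure_pmf.prob ?M {Y. t \<le> real (card {X\<in>\<K>. \<forall>d\<in>X. Y d})}
     \<le> measure_pmf.expectation ?M (\<lambda>Y. real (card {X\<in>\<K>. \<forall>d\<in>X. Y d})) / t"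
    by (rule pmf_markov) (use finite_set_bern[OF U] t in auto)
  also have "measure_pmf.expectation ?M (\<lambda>Y. real (card {X\<in>\<K>. \<forall>d\<in>X. Y d}))
     = (\<Sum>X\<in>\<K>. measure_pmf.prob ?M {Y. \<forall>d\<in>X. Y d})"
    unfolding eq by (simp add: Bochner_Integration.integral_sum[OF int])
  also have "\<dots> = (\<Sum>X\<in>\<K>. p ^ k)"
    by (rule sum.cong[OF refl], subst bern_set_contains) (use U p K in auto)
  finally show ?thesis by simp
qed

context forbidden_graph begin

text \<open>
  An \<open>F\<close>-free subgraph with few vertices has a bounded number of edges; any other lies in a container. So if the
  extremal number exceeds \<open>t = P ln^3 n\<close>, some container receives \<open>t\<close> random edges.
\<close>

lemma upper_bound_prob:
  obtains n0 where "\<And>n p. n \<ge> n0 \<Longrightarrow> 0 \<le> p \<Longrightarrow> p \<le> 1 \<Longrightarrow> p \<le> real n powr (1 / (real E)\<^sup>2 - 1 / m2) \<Longrightarrow>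
    measure_pmf.prob (random_graph n p)
      {G. \<not> real (ex_number G F) \<le> real n powr (2 - 1 / m2) * ln (real n) powr 3} \<le> 1 / real n"
proof -
  obtain c n1 where c: "c > 0" and cont: "\<And>n. n \<ge> n1 \<Longrightarrow> \<exists>\<C>. finite \<C> \<and>
       real (card \<C>) \<le> exp (c * real n powr (2 - 1 / m2) * (ln (real n))\<^sup>2) \<and>
       (\<forall>C\<in>\<C>. C \<subseteq> all_edges n \<and> real (card C) \<le> real n powr (2 - 1 / (real E)\<^sup>2)) \<and>
       (\<forall>I\<subseteq>all_edges n. avoids (embedded_copies F n) I \<longrightarrow> (\<exists>C\<in>\<C>. I \<subseteq> C))"
    using containers by blast
  \<comment> \<open>This makes \<open>ln n\<close> exceed \<open>c + 3\<close>, so that \<open>ln^3 n\<close> beats \<open>c ln^2 n + 2\<close> and \<open>P ln^3 n\<close> the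
    number of edges of any graph with fewer vertices than \<open>F\<close>.\<close>
  define n0 where "n0 = max n1 (nat \<lceil>exp (c + 3 + (real (card V))\<^sup>2)\<rceil>)"
  show thesis
  proof (rule that[of n0])
    fix n p assume n: "n \<ge> n0" and p: "0 \<le> p" "p \<le> 1" "p \<le> real n powr (1 / (real E)\<^sup>2 - 1 / m2)"
    have "exp (c + 3 + (real (card V))\<^sup>2) \<le> real n" using n unfolding n0_def by linarith
    moreover from this have np: "real n > 0" using exp_gt_zero less_le_trans by blast
    ultimately have L: "c + 3 + (real (card V))\<^sup>2 \<le> ln (real n)" by (simp add: ln_ge_iff)
    define l where "l = ln (real n)"
    have l: "l \<ge> 3" "l \<ge> c + 3" "l \<ge> (real (card V))\<^sup>2"
      using L c zero_le_power2[of "real (card V)"] unfolding l_def by linarith+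
    define P where "P = real n powr (2 - 1 / m2)"
    have P1: "P \<ge> 1" unfolding P_def
      by (rule ge_one_powr_ge_zero) (use np m2_ge1 in \<open>auto simp: divide_simps\<close>)
    define t where "t = P * l ^ 3"
    have t_eq: "real n powr (2 - 1 / m2) * ln (real n) powr 3 = t"
      using l by (simp add: t_def P_def l_def)
    have tV: "(real (card V))\<^sup>2 \<le> t"
    proof -
      have "l * 1 \<le> l * l\<^sup>2" using l by (intro mult_left_mono) (auto intro: one_le_power)
      also have "\<dots> = l ^ 3" by (simp add: power3_eq_cube power2_eq_square)
      also have "\<dots> \<le> P * l ^ 3" using P1 l by (simp add: mult_right_mono[of 1 P])
      finally show ?thesis using l by (simp add: t_def)
    qed
    obtain \<C> where C: "finite \<C>" "real (card \<C>) \<le> exp (c * P * l\<^sup>2)"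
       "\<And>C. C \<in> \<C> \<Longrightarrow> C \<subseteq> all_edges n \<and> real (card C) \<le> real n powr (2 - 1 / (real E)\<^sup>2)"
       "\<And>I. I \<subseteq> all_edges n \<Longrightarrow> avoids (embedded_copies F n) I \<Longrightarrow> \<exists>C\<in>\<C>. I \<subseteq> C"
      using cont[of n] n unfolding n0_def P_def l_def by auto
    let ?M = "bern_set (all_edges n) p"
    have incl: "{X. \<not> real (ex_number (Graph {..<n} {e \<in> all_edges n. X e}) F) \<le> t}
        \<subseteq> (\<Union>C\<in>\<C>. {X. t \<le> real (card {e\<in>C. X e})})"
    proof (rule subsetI, rule ccontr)
      fix X assume X: "X \<in> {X. \<not> real (ex_number (Graph {..<n} {e \<in> all_edges n. X e}) F) \<le> t}"
        and nX: "X \<notin> (\<Union>C\<in>\<C>. {X. t \<le> real (card {e\<in>C. X e})})"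
      have "real (ex_number (Graph {..<n} {e \<in> all_edges n. X e}) F) \<le> t"
      proof (rule ex_number_le)
        show "finite (edges (Graph {..<n} {e \<in> all_edges n. X e}))" using finite_all_edges by simp
        show "verts F \<noteq> {}" using V_ge3 by auto
        fix H assume H: "subgraph H (Graph {..<n} {e \<in> all_edges n. X e})" "graph_free F H"
        have sH: "simple_graph H" "edges H \<subseteq> {e \<in> all_edges n. X e}" using H by (auto simp: subgraph_def)
        show "real (num_edges H) \<le> t"
        proof (cases "card V \<le> num_verts H")
          case True
          then have "avoids (embedded_copies F n) (edges H)"
            by (rule free_avoids_copies[OF simple sH(1) H(2)])
          then obtain C where CC: "C \<in> \<C>" "edges H \<subseteq> C" using C(4)[of "edges H"] sH by auto
          have "finite C" using C(3)[OF CC(1)] finite_all_edges finite_subset by blast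
          then have "num_edges H \<le> card {e\<in>C. X e}" by (intro card_mono) (use CC sH in auto)
          moreover have "real (card {e\<in>C. X e}) < t" using nX CC by auto
          ultimately show ?thesis by linarith
        next
          case False
          have f: "finite (verts H)" using sH by (simp add: simple_graph_def)
          have "num_edges H \<le> card {e. e \<subseteq> verts H \<and> card e = 2}"
            by (rule card_mono) (use sH f in \<open>auto simp: simple_graph_def\<close>)
          also have "\<dots> = num_verts H choose 2" by (rule n_subsets[OF f])
          also have "\<dots> \<le> num_verts H * num_verts H" by (simp add: choose_two) (metis diff_le_self div_le_dividend le_trans mult_le_mono2)
          also have "\<dots> \<le> card V * card V" using False by (intro mult_mono) auto
          finally have "real (num_edges H) \<le> real (card V * card V)" by (rule of_nat_mono)
          then show ?thesis using tV by (simp add: power2_eq_square)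
        qed
      qed
      then show False using X by simp
    qed
    have pC: "p * real (card C) \<le> P" if "C \<in> \<C>" for C
    proof -
      have "p * real (card C) \<le> real n powr (1 / (real E)\<^sup>2 - 1 / m2) * real n powr (2 - 1 / (real E)\<^sup>2)"
        using C(3)[OF that] p by (intro mult_mono) auto
      also have "\<dots> = P" unfolding P_def powr_add[symmetric] by simp
      finally show ?thesis .
    qed
    have "measure_pmf.prob (random_graph n p)
      {G. \<not> real (ex_number G F) \<le> real n powr (2 - 1 / m2) * ln (real n) powr 3}
      = measure_pmf.prob ?M {X. \<not> real (ex_number (Graph {..<n} {e \<in> all_edges n. X e}) F) \<le> t}"
      unfolding prob_random_graph t_eq ..
    also have "\<dots> \<le> measure_pmf.prob ?M (\<Union>C\<in>\<C>. {X. t \<le> real (card {e\<in>C. X e})})"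
      by (rule measure_pmf.finite_measure_mono[OF incl]) simp
    also have "\<dots> \<le> (\<Sum>C\<in>\<C>. measure_pmf.prob ?M {X. t \<le> real (card {e\<in>C. X e})})"
      by (rule measure_pmf.finite_measure_subadditive_finite[OF C(1)]) auto
    also have "\<dots> \<le> (\<Sum>C\<in>\<C>. exp (2 * P - t))"
    proof (rule sum_mono)
      fix C assume CC: "C \<in> \<C>"
      have "measure_pmf.prob ?M {X. t \<le> real (card {e\<in>C. X e})} \<le> exp (2 * p * real (card C) - t)"
        by (rule bern_set_upper_tail[OF finite_all_edges _ p(1,2)]) (use C(3)[OF CC] in auto)
      also have "\<dots> \<le> exp (2 * P - t)" using pC[OF CC] by simp
      finally show "measure_pmf.prob ?M {X. t \<le> real (card {e\<in>C. X e})} \<le> exp (2 * P - t)" .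
    qed
    also have "\<dots> \<le> exp (c * P * l\<^sup>2) * exp (2 * P - t)" using C(2) by simp
    also have "\<dots> = exp (P * (c * l\<^sup>2 + 2 - l ^ 3))"
      by (simp add: exp_add[symmetric] t_def algebra_simps)
    also have "\<dots> \<le> exp (- l)"
    proof -
      have l2: "l \<le> l\<^sup>2" "1 \<le> l\<^sup>2" using l by (auto simp: power2_eq_square intro: order_trans[of 1 l] mult_mono[of 1 l 1 l, simplified])
      have "(c + 3) * l\<^sup>2 \<le> l * l\<^sup>2" using l by (intro mult_right_mono) auto
      then have a: "c * l\<^sup>2 + 2 - l ^ 3 \<le> - l"
        using l2 by (simp add: power3_eq_cube power2_eq_square algebra_simps)
      then have "P * (c * l\<^sup>2 + 2 - l ^ 3) \<le> P * (- l)" using P1 by (intro mult_left_mono) auto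
      also have "\<dots> \<le> - l" using P1 l by simp
      finally show ?thesis by simp
    qed
    also have "\<dots> = 1 / real n" using np by (simp add: l_def exp_minus inverse_eq_divide)
    finally show "measure_pmf.prob (random_graph n p)
      {G. \<not> real (ex_number G F) \<le> real n powr (2 - 1 / m2) * ln (real n) powr 3} \<le> 1 / real n" .
  qed
qed

text \<open>
  With high probability the random graph has at least \<open>p n^2 / 16\<close> edges and, by Markov's inequality, at most
  \<open>ln n\<close> times the expected number of copies of a subgraph \<open>F'\<close> attaining the 2-density. The deletion
  method is then applied with a retention probability that brings \<open>p\<close> down to
  \<open>n powr (-1/m2) / (32 ln n)\<close>.
\<close>

lemma lower_bound_prob:
  obtains n0 where "\<And>n p. n \<ge> n0 \<Longrightarrow> real n powr (- 1 / m2) \<le> p \<Longrightarrow> p \<le> 1 \<Longrightarrow>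
    measure_pmf.prob (random_graph n p)
      {G. \<not> real n powr (2 - 1 / m2) * ln (real n) powr (- 3) \<le> real (ex_number G F)} \<le> 16 / real n + 1 / ln (real n)"
proof -
  obtain F' where F': "subgraph F' F" "num_verts F' \<ge> 3"
      "real (num_edges F') - 1 = m2 * (real (num_verts F') - 2)"
    using density_attained[OF simple] V_ge3 by auto
  define v where "v = num_verts F'"
  define k where "k = num_edges F'"
  have sF': "simple_graph F'" using F'(1) by (simp add: subgraph_def)
  have "1 * 1 \<le> m2 * (real v - 2)" using m2_ge1 F'(2) by (intro mult_mono) (auto simp: v_def)
  then have k2: "k \<ge> 2" using F'(3) by (simp add: k_def v_def)
  define n0 where "n0 = nat \<lceil>exp (1024::real)\<rceil>"
  show thesis
  proof (rule that[of n0])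
    fix n p assume n: "n \<ge> n0" and p: "real n powr (- 1 / m2) \<le> p" "p \<le> 1"
    have "exp 1024 \<le> real n" using n unfolding n0_def by linarith
    moreover from this have np: "real n > 0" using exp_gt_zero less_le_trans by blast
    ultimately have L: "1024 \<le> ln (real n)" by (simp add: ln_ge_iff)
    define l where "l = ln (real n)"
    have l: "l \<ge> 1024" using L by (simp add: l_def)
    have n2: "real n \<ge> 2" using ln_less_self[OF np] L by linarith
    define P where "P = real n powr (2 - 1 / m2)"
    define ps where "ps = real n powr (- 1 / m2)"
    have ps: "0 < ps" "ps \<le> p" using np p by (auto simp: ps_def)
    have p0: "0 < p" using ps by linarith
    have P_eq: "P = ps * (real n)\<^sup>2"
      using np by (simp add: P_def ps_def powr_diff powr_minus_divide)
    have Pv: "ps ^ k * real n ^ v = P"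
    proof -
      have "ps ^ k = real n powr (real k * (- 1 / m2))" unfolding ps_def using np by (subst powr_power) auto
      moreover have "real n ^ v = real n powr real v" using powr_realpow[OF np, of v] by simp
      moreover have "real k * (- 1 / m2) + real v = 2 - 1 / m2"
      proof -
        have "real k = 1 + m2 * (real v - 2)" using F'(3) by (simp add: k_def v_def)
        then show ?thesis using m2_pos by (simp add: field_simps)
      qed
      ultimately show ?thesis by (simp add: P_def powr_add[symmetric])
    qed
    define \<K> where "\<K> = embedded_copies F' n"
    have fK: "finite \<K>" "real (card \<K>) \<le> real n ^ v"
      using card_embedded_copies[OF sF', of n] unfolding \<K>_def v_def of_nat_power[symmetric] by auto
    have K: "X \<subseteq> all_edges n \<and> card X = k" if "X \<in> \<K>" for X
      using embedded_copies_props[OF sF'] that by (auto simp: \<K>_def k_def)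
    define NN where "NN = real (card (all_edges n))"
    have NN: "NN \<ge> (real n)\<^sup>2 / 4"
    proof -
      have "real n * 2 \<le> real n * real n" using n2 by (intro mult_left_mono) auto
      then show ?thesis unfolding NN_def card_all_edges_real by (simp add: power2_eq_square field_simps)
    qed
    define t where "t = p * NN / 4"
    define \<mu> where "\<mu> = real n ^ v * p ^ k * l"
    have \<mu>0: "\<mu> > 0" using np p0 l by (simp add: \<mu>_def)
    let ?M = "bern_set (all_edges n) p"
    let ?A = "{Y. real (card {e\<in>all_edges n. Y e}) \<le> t}"
    let ?B = "{Y. \<mu> \<le> real (card {X\<in>\<K>. \<forall>d\<in>X. Y d})}"
    have A: "measure_pmf.prob ?M ?A \<le> 16 / real n"
    proof -
      have "measure_pmf.prob ?M ?A \<le> exp (t - p * NN / 2)"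
        unfolding NN_def by (rule bern_set_lower_tail[OF finite_all_edges]) (use p p0 in auto)
      also have "t - p * NN / 2 = - (p * NN / 4)" by (simp add: t_def)
      also have "exp (- (p * NN / 4)) \<le> exp (- (real n / 16))"
      proof -
        have "real n = real n powr 1" using np by simp
        also have "\<dots> \<le> P" unfolding P_def by (rule powr_mono) (use m2_ge1 n2 in \<open>auto simp: divide_simps\<close>)
        also have "\<dots> \<le> p * (real n)\<^sup>2" unfolding P_eq using ps by (intro mult_right_mono) auto
        also have "\<dots> \<le> p * (4 * NN)" using NN p0 by (intro mult_left_mono) auto
        finally show ?thesis by simp
      qed
      also have "\<dots> = 1 / exp (real n / 16)" by (simp add: exp_minus inverse_eq_divide)
      also have "\<dots> \<le> 1 / (real n / 16)"
      proof (rule divide_left_mono)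
        show "real n / 16 \<le> exp (real n / 16)" using exp_ge_add_one_self[of "real n / 16"] by linarith
      qed (use np in auto)
      finally show ?thesis by simp
    qed
    have B: "measure_pmf.prob ?M ?B \<le> 1 / l"
    proof -
      have "measure_pmf.prob ?M ?B \<le> real (card \<K>) * p ^ k / \<mu>"
        by (rule prob_many_members[OF finite_all_edges fK(1) K]) (use p p0 \<mu>0 in auto)
      also have "\<dots> \<le> real n ^ v * p ^ k / \<mu>"
        using fK(2) p0 \<mu>0 by (intro divide_right_mono mult_right_mono) auto
      also have "\<dots> = 1 / l" using np p0 by (simp add: \<mu>_def)
      finally show ?thesis .
    qed
    have incl: "{X. \<not> P * l powr (- 3) \<le> real (ex_number (Graph {..<n} {e \<in> all_edges n. X e}) F)} \<subseteq> ?A \<union> ?B"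
    proof (rule subsetI, rule ccontr)
      fix Y assume Y: "Y \<in> {X. \<not> P * l powr (- 3) \<le> real (ex_number (Graph {..<n} {e \<in> all_edges n. X e}) F)}"
        and nY: "Y \<notin> ?A \<union> ?B"
      define R where "R = {e \<in> all_edges n. Y e}"
      define KR where "KR = {X\<in>\<K>. \<forall>d\<in>X. Y d}"
      have R: "real (card R) \<ge> p * (real n)\<^sup>2 / 16"
      proof -
        have "p * ((real n)\<^sup>2 / 4) \<le> p * NN" using NN p0 by (intro mult_left_mono) auto
        then show ?thesis using nY by (auto simp: R_def t_def)
      qed
      have KR: "real (card KR) \<le> \<mu>" using nY by (auto simp: KR_def)
      \<comment> \<open>With \<open>q p = ps / (32 l)\<close> the edges kept number at least \<open>P / (512 l)\<close>, and since \<open>k \<ge> 2\<close> the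
        copies at most \<open>P l / (32 l)^2\<close>, which is half of that.\<close>
      define q where "q = ps / p / (32 * l)"
      have "ps / p \<le> 1" using ps p0 by simp
      moreover have "ps / p / (32 * l) \<le> ps / p / 1" using ps p0 l by (intro divide_left_mono) auto
      ultimately have "q \<le> 1" unfolding q_def by linarith
      moreover have "0 \<le> q" using ps p0 l by (simp add: q_def)
      ultimately have q: "0 \<le> q" "q \<le> 1" by auto
      obtain I where I: "I \<subseteq> R" "avoids KR I" "q * real (card R) - q ^ k * real (card KR) \<le> real (card I)"
      proof (rule random_deletion[of R KR k q])
        show "finite R" using finite_all_edges by (simp add: R_def)
        show "X \<subseteq> R \<and> card X = k" if "X \<in> KR" for X using that K by (auto simp: KR_def R_def)
      qed (use fK k2 q in \<open>auto simp: KR_def\<close>)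
      have avI: "avoids \<K> I" using I(1,2) unfolding avoids_def KR_def R_def by blast
      have sub: "subgraph (Graph {..<n} I) (Graph {..<n} R)"
        using I(1) by (auto simp: subgraph_def simple_graph_def R_def all_edges_def)
      have "graph_free F (Graph {..<n} I)"
        by (rule avoids_copies_free[OF F'(1)]) (use avI in \<open>simp add: \<K>_def\<close>)
      then have "card I \<le> ex_number (Graph {..<n} R) F"
        using ex_number_ge[OF _ sub, of F] finite_all_edges by (simp add: R_def)
      then have exI: "real (card I) \<le> real (ex_number (Graph {..<n} R) F)" by simp
      have "q * real (card R) \<ge> q * (p * (real n)\<^sup>2 / 16)" using R q by (intro mult_left_mono) auto
      moreover have "q * (p * (real n)\<^sup>2 / 16) = P / (512 * l)" using p0 l by (simp add: q_def P_eq field_simps)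
      moreover have "q ^ k * real (card KR) \<le> P / (1024 * l)"
      proof -
        have "q ^ k * real (card KR) \<le> q ^ k * \<mu>" using KR q by (intro mult_left_mono) auto
        also have "q ^ k * \<mu> = P * l / (32 * l) ^ k"
          using p0 by (simp add: q_def \<mu>_def Pv[symmetric] power_divide power_mult_distrib)
        also have "\<dots> \<le> P * l / (32 * l) ^ 2"
          by (intro divide_left_mono power_increasing) (use k2 l in \<open>auto simp: P_def\<close>)
        also have "\<dots> = P / (1024 * l)" using l by (simp add: power2_eq_square)
        finally show ?thesis .
      qed
      ultimately have "real (card I) \<ge> P / (512 * l) - P / (1024 * l)" using I(3) by linarith
      also have "P / (512 * l) - P / (1024 * l) = P / (1024 * l)" using l by (simp add: field_simps)
      finally have I2: "real (card I) \<ge> P / (1024 * l)" .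
      have "P * l powr (- 3) = P / l ^ 3" using l by (simp add: powr_minus_divide)
      also have "\<dots> \<le> P / (1024 * l)"
      proof (rule divide_left_mono)
        have "1024 * l \<le> l * l" using l by (intro mult_right_mono) auto
        also have "\<dots> \<le> l ^ 3" using l by (simp add: power3_eq_cube)
        finally show "1024 * l \<le> l ^ 3" .
      qed (use l in \<open>auto simp: P_def\<close>)
      finally have "P * l powr (- 3) \<le> real (ex_number (Graph {..<n} R) F)" using I2 exI by linarith
      then show False using Y by (simp add: R_def)
    qed
    have "measure_pmf.prob (random_graph n p)
        {G. \<not> real n powr (2 - 1 / m2) * ln (real n) powr (- 3) \<le> real (ex_number G F)}
      \<le> measure_pmf.prob ?M (?A \<union> ?B)"
      unfolding prob_random_graph P_def[symmetric] l_def[symmetric]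
      by (rule measure_pmf.finite_measure_mono[OF incl]) simp
    also have "\<dots> \<le> measure_pmf.prob ?M ?A + measure_pmf.prob ?M ?B"
      by (rule measure_Un_le) auto
    also have "\<dots> \<le> 16 / real n + 1 / ln (real n)" using A B by (simp add: l_def)
    finally show "measure_pmf.prob (random_graph n p)
      {G. \<not> real n powr (2 - 1 / m2) * ln (real n) powr (- 3) \<le> real (ex_number G F)} \<le> 16 / real n + 1 / ln (real n)" .
  qed
qed

end

theorem theorem2p2:
  fixes F :: "'a ugraph"
  assumes "simple_graph F"
    and "num_edges F \<ge> 2"
    and "\<exists>S T. bipartition F S T \<and>
           (\<exists>v\<in>T. \<forall>s\<in>S. {v, s} \<in> edges F) \<and>
           (\<forall>\<nu>. \<nu> \<subseteq> verts F \<and> card \<nu> \<ge> 3 \<and>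
                 (real (num_edges (induced_subgraph F \<nu>)) - 1) / (real (card \<nu>) - 2) = two_density F
               \<longrightarrow> S \<subseteq> \<nu>)"
  shows "\<exists>C::real. C > 0 \<and>
    (\<forall>p :: nat \<Rightarrow> real.
       (\<forall>n. 0 \<le> p n \<and> p n \<le> 1) \<and>
       (\<lambda>n. real n powr (- 1 / two_density F)) \<in> o(p) \<and>
       (\<forall>n\<ge>1. p n \<le> real n powr (1 / (real (num_edges F))\<^sup>2 - 1 / two_density F))
       \<longrightarrow> asymp_almost_surely (\<lambda>n. random_graph n (p n))
             (\<lambda>n G.
                real n powr (2 - 1 / two_density F) * ln (real n) powr (- C)
                  \<le> real (ex_number G F) \<and>
                real (ex_number G F)
                  \<le> real n powr (2 - 1 / two_density F) * ln (real n) powr C))"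
proof -
  obtain S T apex where "bipartition F S T" "apex \<in> T" "\<forall>s\<in>S. {apex, s} \<in> edges F"
    "\<forall>\<nu>. \<nu> \<subseteq> verts F \<and> card \<nu> \<ge> 3 \<and>
       (real (num_edges (induced_subgraph F \<nu>)) - 1) / (real (card \<nu>) - 2) = two_density F \<longrightarrow> S \<subseteq> \<nu>"
    using assms(3) by blast
  then interpret forbidden_graph F S T apex
    using assms(1,2) by unfold_locales auto
  obtain n1 where n1: "\<And>n p. n \<ge> n1 \<Longrightarrow> 0 \<le> p \<Longrightarrow> p \<le> 1 \<Longrightarrow> p \<le> real n powr (1 / (real E)\<^sup>2 - 1 / m2) \<Longrightarrow>
    measure_pmf.prob (random_graph n p)
      {G. \<not> real (ex_number G F) \<le> real n powr (2 - 1 / m2) * ln (real n) powr 3} \<le> 1 / real n"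
    using upper_bound_prob by blast
  obtain n2 where n2: "\<And>n p. n \<ge> n2 \<Longrightarrow> real n powr (- 1 / m2) \<le> p \<Longrightarrow> p \<le> 1 \<Longrightarrow>
    measure_pmf.prob (random_graph n p)
      {G. \<not> real n powr (2 - 1 / m2) * ln (real n) powr (- 3) \<le> real (ex_number G F)} \<le> 16 / real n + 1 / ln (real n)"
    using lower_bound_prob by blast
  show ?thesis
  proof (intro exI[of _ 3] conjI allI impI)
    fix p :: "nat \<Rightarrow> real"
    assume p: "(\<forall>n. 0 \<le> p n \<and> p n \<le> 1) \<and> (\<lambda>n. real n powr (- 1 / m2)) \<in> o(p) \<and>
       (\<forall>n\<ge>1. p n \<le> real n powr (1 / (real E)\<^sup>2 - 1 / m2))"
    define good :: "nat \<Rightarrow> nat ugraph set" where "good n = {G. real n powr (2 - 1 / m2) * ln (real n) powr (- 3) \<le> real (ex_number G F) \<and>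
        real (ex_number G F) \<le> real n powr (2 - 1 / m2) * ln (real n) powr 3}" for n
    have "eventually (\<lambda>n. norm (real n powr (- 1 / m2)) \<le> 1 * norm (p n)) sequentially"
      using p landau_o.smallD[of "\<lambda>n. real n powr (- 1 / m2)" sequentially p 1] by auto
    then have ev: "eventually (\<lambda>n. real n powr (- 1 / m2) \<le> p n) sequentially"
      by (rule eventually_mono) (use p in auto)
    have lower: "eventually (\<lambda>n. 1 - (17 / real n + 1 / ln (real n)) \<le> measure_pmf.prob (random_graph n (p n)) (good n)) sequentially"
      using ev eventually_ge_at_top[of "max 1 (max n1 n2)"]
    proof eventually_elim
      case (elim n)
      let ?M = "random_graph n (p n)"
      let ?A = "{G. \<not> real (ex_number G F) \<le> real n powr (2 - 1 / m2) * ln (real n) powr 3}"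
      let ?B = "{G. \<not> real n powr (2 - 1 / m2) * ln (real n) powr (- 3) \<le> real (ex_number G F)}"
      have "measure_pmf.prob ?M (- good n) \<le> measure_pmf.prob ?M (?A \<union> ?B)"
        by (rule measure_pmf.finite_measure_mono) (auto simp: good_def)
      also have "\<dots> \<le> measure_pmf.prob ?M ?A + measure_pmf.prob ?M ?B"
        by (rule measure_Un_le) auto
      also have "\<dots> \<le> 1 / real n + (16 / real n + 1 / ln (real n))"
        by (intro add_mono n1 n2) (use elim p in auto)
      also have "\<dots> = 17 / real n + 1 / ln (real n)" by simp
      finally have "measure_pmf.prob ?M (- good n) \<le> 17 / real n + 1 / ln (real n)" .
      moreover have "measure_pmf.prob ?M (- good n) = 1 - measure_pmf.prob ?M (good n)"
        using measure_pmf.prob_compl[of "good n" ?M] by (simp add: Compl_eq_Diff_UNIV)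
      ultimately show ?case by linarith
    qed
    have lim: "(\<lambda>n. 1 - (17 / real n + 1 / ln (real n))) \<longlonglongrightarrow> 1 - (0 + 0)"
      by (intro tendsto_intros tendsto_divide_0[OF tendsto_const] filterlim_at_top_imp_at_infinity
          filterlim_compose[OF ln_at_top] filterlim_real_sequentially)
    have "(\<lambda>n. measure_pmf.prob (random_graph n (p n)) (good n)) \<longlonglongrightarrow> 1"
      by (rule tendsto_sandwich[OF lower _ _ tendsto_const]) (use lim in auto)
    then show "asymp_almost_surely (\<lambda>n. random_graph n (p n))
       (\<lambda>n G. real n powr (2 - 1 / m2) * ln (real n) powr (- 3) \<le> real (ex_number G F) \<and>
              real (ex_number G F) \<le> real n powr (2 - 1 / m2) * ln (real n) powr 3)"
      by (simp add: asymp_almost_surely_def good_def)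
  qed simp
qed

end
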